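(* Let $R$ be an associative ring and let $\mathcal{L}$ be a class of left $R$-modules that is projectively resolving and special precovering in $R$-Mod. Then every complex of left $R$-modules has a special $\widetilde{\mathcal{L}}$-precover in the category $\mathcal{C}(R)$ of complexes of left $R$-modules.
   Context: $R$-Mod is the category of left $R$-modules and $\mathcal{C}(R)$ is the category of ($\mathbb{Z}$-indexed, unbounded) complexes of left $R$-modules with chain maps as morphisms. All classes of modules are assumed closed under isomorphisms and to contain the zero module. For a complex $(C,\delta)$, with $\delta_n: C_n\to C_{n-1}$, put $\mathrm{Z}_n(C)=\ker(\delta_n)$. An $\mathcal{L}$ complex is an exact complex $C$ with $\mathrm{Z}_i(C)\in\mathcal{L}$ for all $i\in\mathbb{Z}$; $\widetilde{\mathcal{L}}$ is the class of all $\mathcal{L}$ complexes. $\mathrm{Ext}^1$ in $\mathcal{C}(R)$ is the first right derived functor of $\mathrm{Hom}$ (chain maps) in the abelian category $\mathcal{C}(R)$. For a class $\mathcal{X}$ of objects in an abelian category, a special $\mathcal{X}$-precover of an object $M$ is an epimorphism $f: X\to M$ with $X\in\mathcal{X}$ and $\mathrm{Ext}^1(X',\ker f)=0$ for all $X'\in\mathcal{X}$. A class $\mathcal{L}$ of modules is special precovering if every module has a special $\mathcal{L}$-precover. A class of modules is projectively resolving if it is closed under extensions and kernels of surjections (between modules of the class) and contains all projective modules. *)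

theory Defs
  imports
    "HOL-Algebra.Module" "HOL-Algebra.AbelCoset" "HOL-Algebra.Elementary_Groups"
    "HOL-Library.Equipollence"
begin

section \<open>Left modules and the size of the category of modules\<close>

text \<open>
  The locale \<^locale>\<open>module\<close> of the library requires a commutative ring of scalars. The
  ring multiplication and unit that the record \<^typ>\<open>('r, 'm) module\<close> carries for the
  module itself are ignored throughout.
\<close>

locale left_module = R?: ring R + M?: abelian_group M
  for R :: "('r, 'a) ring_scheme" (structure) and M :: "('r, 'm) module" (structure) +
  assumes smult_closed:
      "\<lbrakk>a \<in> carrier R; x \<in> carrier M\<rbrakk> \<Longrightarrow> a \<odot>\<^bsub>M\<^esub> x \<in> carrier M"
    and smult_l_distr:
      "\<lbrakk>a \<in> carrier R; b \<in> carrier R; x \<in> carrier M\<rbrakk> \<Longrightarrow>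
       (a \<oplus> b) \<odot>\<^bsub>M\<^esub> x = a \<odot>\<^bsub>M\<^esub> x \<oplus>\<^bsub>M\<^esub> b \<odot>\<^bsub>M\<^esub> x"
    and smult_r_distr:
      "\<lbrakk>a \<in> carrier R; x \<in> carrier M; y \<in> carrier M\<rbrakk> \<Longrightarrow>
       a \<odot>\<^bsub>M\<^esub> (x \<oplus>\<^bsub>M\<^esub> y) = a \<odot>\<^bsub>M\<^esub> x \<oplus>\<^bsub>M\<^esub> a \<odot>\<^bsub>M\<^esub> y"
    and smult_assoc1:
      "\<lbrakk>a \<in> carrier R; b \<in> carrier R; x \<in> carrier M\<rbrakk> \<Longrightarrow>
       (a \<otimes> b) \<odot>\<^bsub>M\<^esub> x = a \<odot>\<^bsub>M\<^esub> (b \<odot>\<^bsub>M\<^esub> x)"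
    and smult_one: "x \<in> carrier M \<Longrightarrow> \<one> \<odot>\<^bsub>M\<^esub> x = x"

text \<open>
  Proper classes of modules are handled relative to a universe \<open>U\<close>: ``every module'' means
  every left module whose carrier is a set in \<open>U\<close>. Membership in \<open>U\<close> depends only on
  cardinality, and \<open>U\<close> is large enough for the modules in it to have enough projectives,
  enough injectives and countable products. These closure properties hold in particular for the
  small sets of a Grothendieck universe containing the ring, but no inaccessible cardinal is
  needed: see \<open>module_universe_exists\<close> below, where \<open>U\<close> consists of all sets of
  elements of a suitable type.
\<close>

definition module_universe :: "('r, 'a) ring_scheme \<Rightarrow> 'm set set \<Rightarrow> bool" where
  "module_universe R U \<longleftrightarrow>
     (\<forall>A\<in>U. \<forall>B. B \<lesssim> A \<longrightarrow> B \<in> U) \<and>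
     (\<exists>A\<in>U. infinite A) \<and>
     (\<exists>A\<in>U. carrier R \<lesssim> A) \<and>
     (\<forall>A. (\<forall>n::nat. A n \<in> U) \<longrightarrow> (\<exists>B\<in>U. (\<Pi>\<^sub>E n\<in>UNIV. A n) \<lesssim> B)) \<and>
     (\<forall>A\<in>U. \<exists>B\<in>U. (carrier R \<rightarrow>\<^sub>E A) \<lesssim> B)"

lemma module_universe_exists:
  fixes R :: "('r, 'a) ring_scheme"
  shows "module_universe R (UNIV :: ('r + nat) list set set set)"
proof -
  let ?T = "UNIV :: ('r + nat) list set set"
  let ?tag = "\<lambda>c f I. {c i # e | i e. i \<in> I \<and> e \<in> f i}"
  have nat: "(\<Pi>\<^sub>E n\<in>UNIV. A n) \<lesssim> ?T" for A :: "nat \<Rightarrow> ('r + nat) list set set"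
  proof -
    have "f = g" if "?tag Inr f UNIV = ?tag Inr g UNIV"
      for f g :: "nat \<Rightarrow> ('r + nat) list set"
    proof
      fix n
      have "e \<in> f n \<longleftrightarrow> Inr n # e \<in> ?tag Inr f UNIV"
           "e \<in> g n \<longleftrightarrow> Inr n # e \<in> ?tag Inr g UNIV" for e by auto
      then show "f n = g n" using that by blast
    qed
    then have "inj (\<lambda>f :: nat \<Rightarrow> ('r + nat) list set. ?tag Inr f UNIV)" by (rule injI)
    then show ?thesis unfolding lepoll_def by (blast intro: inj_on_subset)
  qed
  have pow: "(carrier R \<rightarrow>\<^sub>E A) \<lesssim> ?T" for A :: "('r + nat) list set set"
  proof -
    have "f = g" if "?tag Inl f (carrier R) = ?tag Inl g (carrier R)"
      and fg: "f \<in> carrier R \<rightarrow>\<^sub>E A" "g \<in> carrier R \<rightarrow>\<^sub>E A" for f g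
    proof (rule PiE_ext[OF fg])
      fix r assume "r \<in> carrier R"
      then have "e \<in> f r \<longleftrightarrow> Inl r # e \<in> ?tag Inl f (carrier R)"
           "e \<in> g r \<longleftrightarrow> Inl r # e \<in> ?tag Inl g (carrier R)" for e by auto
      then show "f r = g r" using that(1) by blast
    qed
    then have "inj_on (\<lambda>f. ?tag Inl f (carrier R)) (carrier R \<rightarrow>\<^sub>E A)"
      by (intro inj_onI)
    then show ?thesis unfolding lepoll_def by blast
  qed
  have ring: "carrier R \<lesssim> ?T"
    unfolding lepoll_def by (rule exI[of _ "\<lambda>r. {[Inl r]}"]) (auto simp: inj_on_def)
  have "infinite (UNIV :: ('r + nat) list set)" by (rule infinite_UNIV_listI)
  then have "infinite ?T" by (simp add: Finite_Set.finite_set)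
  then show ?thesis
    unfolding module_universe_def using nat pow ring by blast
qed


section \<open>Homological notions in an abelian category\<close>

text \<open>
  An abelian category of structured sets. Morphism groups are written multiplicatively, so
  that \<^term>\<open>\<one>\<^bsub>Mor \<A> X Y\<^esub>\<close> is the zero morphism; \<open>Comp \<A> X g f\<close> is the composite
  of \<open>f\<close>, with domain \<open>X\<close>, followed by \<open>g\<close>; \<open>Epi \<A> X Y\<close> is the set of epimorphisms;
  \<open>Ker \<A> X Y f\<close> is the kernel of \<open>f\<close> as a subobject of \<open>X\<close>, whose inclusion is the identity
  on elements. Hence \<open>W \<rightarrow> X \<rightarrow> Y\<close> with maps \<open>d\<close>, \<open>f\<close> is exact at \<open>X\<close> iff
  \<open>d \<in> Epi \<A> W (Ker \<A> X Y f)\<close>.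
\<close>

record ('o, 'f) abcat =
  Obj :: "'o set"
  Mor :: "'o \<Rightarrow> 'o \<Rightarrow> 'f monoid"
  Comp :: "'o \<Rightarrow> 'f \<Rightarrow> 'f \<Rightarrow> 'f"
  Epi :: "'o \<Rightarrow> 'o \<Rightarrow> 'f set"
  Ker :: "'o \<Rightarrow> 'o \<Rightarrow> 'f \<Rightarrow> 'o"

definition projective :: "('o, 'f) abcat \<Rightarrow> 'o \<Rightarrow> bool" where
  "projective \<A> P \<longleftrightarrow> P \<in> Obj \<A> \<and>
     (\<forall>X\<in>Obj \<A>. \<forall>Y\<in>Obj \<A>. \<forall>e\<in>Epi \<A> X Y. \<forall>g\<in>carrier (Mor \<A> P Y).
        \<exists>h\<in>carrier (Mor \<A> P X). Comp \<A> P e h = g)"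

definition projective_resolution ::
  "('o, 'f) abcat \<Rightarrow> 'o \<Rightarrow> (nat \<Rightarrow> 'o) \<times> (nat \<Rightarrow> 'f) \<times> 'f \<Rightarrow> bool" where
  "projective_resolution \<A> X = (\<lambda>(P, d, e).
     (\<forall>n. projective \<A> (P n)) \<and>
     (\<forall>n. d n \<in> carrier (Mor \<A> (P (Suc n)) (P n))) \<and>
     e \<in> Epi \<A> (P 0) X \<and>
     d 0 \<in> Epi \<A> (P 1) (Ker \<A> (P 0) X e) \<and>
     (\<forall>n. d (Suc n) \<in> Epi \<A> (P (Suc (Suc n))) (Ker \<A> (P (Suc n)) (P n) (d n))))"

definition chosen_resolution ::
  "('o, 'f) abcat \<Rightarrow> 'o \<Rightarrow> (nat \<Rightarrow> 'o) \<times> (nat \<Rightarrow> 'f) \<times> 'f" where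
  "chosen_resolution \<A> X = (SOME r. projective_resolution \<A> X r)"

text \<open>
  The first cohomology group of
  \<open>Hom(P\<^sub>0, Y) \<rightarrow> Hom(P\<^sub>1, Y) \<rightarrow> Hom(P\<^sub>2, Y)\<close>.
\<close>

definition Ext1 :: "('o, 'f) abcat \<Rightarrow> 'o \<Rightarrow> 'o \<Rightarrow> 'f set monoid" where
  "Ext1 \<A> X Y =
    (let (P, d, e) = chosen_resolution \<A> X;
         Z = kernel (Mor \<A> (P 1) Y) (Mor \<A> (P 2) Y) (\<lambda>f. Comp \<A> (P 2) f (d 1));
         B = (\<lambda>f. Comp \<A> (P 1) f (d 0)) ` carrier (Mor \<A> (P 0) Y)
     in (Mor \<A> (P 1) Y)\<lparr>carrier := Z\<rparr> Mod B)"

definition special_precover :: "('o, 'f) abcat \<Rightarrow> 'o set \<Rightarrow> 'o \<Rightarrow> 'o \<Rightarrow> 'f \<Rightarrow> bool" where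
  "special_precover \<A> \<X> M X f \<longleftrightarrow>
     X \<in> \<X> \<and> f \<in> Epi \<A> X M \<and> (\<forall>X'\<in>\<X>. trivial_group (Ext1 \<A> X' (Ker \<A> X M f)))"

definition special_precovering :: "('o, 'f) abcat \<Rightarrow> 'o set \<Rightarrow> bool" where
  "special_precovering \<A> \<X> \<longleftrightarrow> (\<forall>M\<in>Obj \<A>. \<exists>X f. special_precover \<A> \<X> M X f)"


section \<open>The category of left modules\<close>

definition mod_hom ::
  "('r, 'a) ring_scheme \<Rightarrow> ('r, 'm) module \<Rightarrow> ('r, 'm) module \<Rightarrow> ('m \<Rightarrow> 'm) set" where
  "mod_hom R M N = {f \<in> carrier M \<rightarrow>\<^sub>E carrier N.
     (\<forall>x\<in>carrier M. \<forall>y\<in>carrier M. f (x \<oplus>\<^bsub>M\<^esub> y) = f x \<oplus>\<^bsub>N\<^esub> f y) \<and>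
     (\<forall>a\<in>carrier R. \<forall>x\<in>carrier M. f (a \<odot>\<^bsub>M\<^esub> x) = a \<odot>\<^bsub>N\<^esub> f x)}"

definition mod_hom_group ::
  "('r, 'a) ring_scheme \<Rightarrow> ('r, 'm) module \<Rightarrow> ('r, 'm) module \<Rightarrow> ('m \<Rightarrow> 'm) monoid" where
  "mod_hom_group R M N =
     \<lparr>carrier = mod_hom R M N,
      monoid.mult = (\<lambda>f g. \<lambda>x\<in>carrier M. f x \<oplus>\<^bsub>N\<^esub> g x),
      one = (\<lambda>x\<in>carrier M. \<zero>\<^bsub>N\<^esub>)\<rparr>"

definition mod_ker :: "('r, 'm) module \<Rightarrow> ('r, 'm) module \<Rightarrow> ('m \<Rightarrow> 'm) \<Rightarrow> ('r, 'm) module" where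
  "mod_ker M N f = M\<lparr>carrier := a_kernel M N f\<rparr>"

definition Modules ::
  "('r, 'a) ring_scheme \<Rightarrow> 'm set set \<Rightarrow> (('r, 'm) module, 'm \<Rightarrow> 'm) abcat" where
  "Modules R U =
     \<lparr>Obj = {M. left_module R M \<and> carrier M \<in> U},
      Mor = mod_hom_group R,
      Comp = (\<lambda>M g f. compose (carrier M) g f),
      Epi = (\<lambda>M N. {f \<in> mod_hom R M N. f ` carrier M = carrier N}),
      Ker = mod_ker\<rparr>"

definition module_class ::
  "('r, 'a) ring_scheme \<Rightarrow> 'm set set \<Rightarrow> ('r, 'm) module set \<Rightarrow> bool" where
  "module_class R U L \<longleftrightarrow>
     L \<subseteq> Obj (Modules R U) \<and>
     (\<forall>M\<in>L. \<forall>N\<in>Obj (Modules R U).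
        (\<exists>f\<in>mod_hom R M N. bij_betw f (carrier M) (carrier N)) \<longrightarrow> N \<in> L) \<and>
     (\<forall>M\<in>Obj (Modules R U). carrier M = {\<zero>\<^bsub>M\<^esub>} \<longrightarrow> M \<in> L)"

definition projectively_resolving ::
  "('r, 'a) ring_scheme \<Rightarrow> 'm set set \<Rightarrow> ('r, 'm) module set \<Rightarrow> bool" where
  "projectively_resolving R U L \<longleftrightarrow>
     (\<forall>A\<in>L. \<forall>C\<in>L. \<forall>B\<in>Obj (Modules R U). \<forall>i\<in>mod_hom R A B. \<forall>p\<in>Epi (Modules R U) B C.
        inj_on i (carrier A) \<and> i ` carrier A = a_kernel B C p \<longrightarrow> B \<in> L) \<and>
     (\<forall>B\<in>L. \<forall>C\<in>L. \<forall>p\<in>Epi (Modules R U) B C. mod_ker B C p \<in> L) \<and>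
     (\<forall>P. projective (Modules R U) P \<longrightarrow> P \<in> L)"


section \<open>The category of complexes\<close>

record ('r, 'm) cplx =
  component :: "int \<Rightarrow> ('r, 'm) module"
  diff :: "int \<Rightarrow> 'm \<Rightarrow> 'm"

definition is_complex :: "('r, 'a) ring_scheme \<Rightarrow> 'm set set \<Rightarrow> ('r, 'm) cplx \<Rightarrow> bool" where
  "is_complex R U C \<longleftrightarrow>
     (\<forall>n. component C n \<in> Obj (Modules R U)) \<and>
     (\<forall>n. diff C n \<in> mod_hom R (component C n) (component C (n - 1))) \<and>
     (\<forall>n. \<forall>x\<in>carrier (component C n). diff C (n - 1) (diff C n x) = \<zero>\<^bsub>component C (n - 2)\<^esub>)"

definition chain_map ::
  "('r, 'a) ring_scheme \<Rightarrow> ('r, 'm) cplx \<Rightarrow> ('r, 'm) cplx \<Rightarrow> (int \<Rightarrow> 'm \<Rightarrow> 'm) set" where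
  "chain_map R C D = {f.
     (\<forall>n. f n \<in> mod_hom R (component C n) (component D n)) \<and>
     (\<forall>n. \<forall>x\<in>carrier (component C n). f (n - 1) (diff C n x) = diff D n (f n x))}"

definition chain_map_group ::
  "('r, 'a) ring_scheme \<Rightarrow> ('r, 'm) cplx \<Rightarrow> ('r, 'm) cplx \<Rightarrow> (int \<Rightarrow> 'm \<Rightarrow> 'm) monoid" where
  "chain_map_group R C D =
     \<lparr>carrier = chain_map R C D,
      monoid.mult = (\<lambda>f g n. f n \<otimes>\<^bsub>mod_hom_group R (component C n) (component D n)\<^esub> g n),
      one = (\<lambda>n. \<one>\<^bsub>mod_hom_group R (component C n) (component D n)\<^esub>)\<rparr>"

definition complex_ker ::
  "('r, 'm) cplx \<Rightarrow> ('r, 'm) cplx \<Rightarrow> (int \<Rightarrow> 'm \<Rightarrow> 'm) \<Rightarrow> ('r, 'm) cplx" where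
  "complex_ker C D f =
     \<lparr>component = (\<lambda>n. mod_ker (component C n) (component D n) (f n)),
      diff = (\<lambda>n. restrict (diff C n) (a_kernel (component C n) (component D n) (f n)))\<rparr>"

definition Complexes ::
  "('r, 'a) ring_scheme \<Rightarrow> 'm set set \<Rightarrow> (('r, 'm) cplx, int \<Rightarrow> 'm \<Rightarrow> 'm) abcat" where
  "Complexes R U =
     \<lparr>Obj = {C. is_complex R U C},
      Mor = chain_map_group R,
      Comp = (\<lambda>C g f n. compose (carrier (component C n)) (g n) (f n)),
      Epi = (\<lambda>C D. {f \<in> chain_map R C D.
               \<forall>n. f n ` carrier (component C n) = carrier (component D n)}),
      Ker = complex_ker\<rparr>"

definition cycles :: "('r, 'm) cplx \<Rightarrow> int \<Rightarrow> ('r, 'm) module" where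
  "cycles C n = mod_ker (component C n) (component C (n - 1)) (diff C n)"

definition exact_complex :: "('r, 'm) cplx \<Rightarrow> bool" where
  "exact_complex C \<longleftrightarrow>
     (\<forall>n. diff C (n + 1) ` carrier (component C (n + 1)) = carrier (cycles C n))"

definition tilde ::
  "('r, 'a) ring_scheme \<Rightarrow> 'm set set \<Rightarrow> ('r, 'm) module set \<Rightarrow> ('r, 'm) cplx set" where
  "tilde R U L = {C \<in> Obj (Complexes R U). exact_complex C \<and> (\<forall>n. cycles C n \<in> L)}"

end

theory Submission
  imports Defs "HOL-Algebra.IntRing"
begin

text \<open>
  The precover of \<open>C\<close> is a composite \<open>A \<rightarrow> E \<rightarrow> C\<close>. The exact complex \<open>E\<close> is the limit of a tower over
  \<open>C\<close> in which each step adjoins injective modules that kill the homology of the previous stage.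
  The map \<open>A \<rightarrow> E\<close> comes from special \<open>L\<close>-precovers of the cycles of \<open>E\<close> by a horseshoe construction,
  so its kernel is exact with cycles right orthogonal to \<open>L\<close>. Both kernels are built from complexes \<open>K\<close>
  with zero differential and components right orthogonal to \<open>L\<close>, and these satisfy \<open>Ext\<^sup>1(A', K) = 0\<close>
  for exact \<open>A'\<close> with cycles in \<open>L\<close>, since that group consists of the groups
  \<open>Ext\<^sup>1(A'\<^sub>n / B\<^sub>n(A'), K\<^sub>n)\<close>. The vanishing of \<open>Ext\<^sup>1(A', K)\<close> enters as the extension of maps to \<open>K\<close>
  along the inclusion \<open>ker (P \<rightarrow> A') \<rightarrow> P\<close> for a projective \<open>P\<close> mapping onto \<open>A'\<close>.
\<close>

section \<open>Linear maps\<close>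

text \<open>Complexes are unbounded, so there is no end from which a resolution could be built by
  induction on the degree; the tower treats all degrees at once, and its limit costs only the
  countable products of \<open>module_universe\<close>. Exactness of \<open>E\<close> comes before
  any precover because the horseshoe construction needs the short exact sequences
  \<open>0 -> Z_n -> E_n -> Z_(n-1) -> 0\<close>. Combining precovers of the two ends meets an
  obstruction in a second Ext group, which vanishes because \<open>L\<close> is closed under kernels
  of surjections. The kernel of the composite \<open>A -> C\<close> is never analysed. Its
  orthogonality is read off from a lifting property of the maps, which is stable under composition
  and under limits of towers, so that neither long exact sequences nor filtrations of kernels occur.
  Intermediate modules live on pairs, functions and sequences; an isomorphic copy then brings them
  back to the carrier type of the given modules.\<close>

lemma left_module_ring: "left_module R M \<Longrightarrow> ring R"
  by (simp add: left_module_def)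

lemma left_module_group: "left_module R M \<Longrightarrow> abelian_group M"
  by (simp add: left_module_def)

lemmas left_module_smult = left_module.smult_closed left_module.smult_l_distr
  left_module.smult_r_distr left_module.smult_assoc1 left_module.smult_one

lemmas ag_closed = abelian_monoid.a_closed[OF abelian_group.axioms(1)]
  abelian_monoid.zero_closed[OF abelian_group.axioms(1)]
  abelian_group.a_inv_closed abelian_group.minus_closed

lemma neg_zero: assumes "abelian_group M" shows "\<ominus>\<^bsub>M\<^esub> \<zero>\<^bsub>M\<^esub> = \<zero>\<^bsub>M\<^esub>"
proof -
  interpret abelian_group M by fact
  show ?thesis using l_neg[of "\<zero>\<^bsub>M\<^esub>"] by simp
qed

lemmas ag_zero = abelian_monoid.l_zero[OF abelian_group.axioms(1)]
  abelian_monoid.r_zero[OF abelian_group.axioms(1)]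
  abelian_group.r_neg abelian_group.l_neg
  abelian_group.minus_minus neg_zero

lemmas ag = ag_closed ag_zero
  abelian_monoid.a_assoc[OF abelian_group.axioms(1)]
  abelian_monoid.a_comm[OF abelian_group.axioms(1)]
  abelian_monoid.a_lcomm[OF abelian_group.axioms(1)]
  abelian_group.r_neg1 abelian_group.r_neg2 abelian_group.minus_add
  abelian_group.minus_eq

lemma minus_eq_zeroD:
  assumes "abelian_group M" "x \<in> carrier M" "y \<in> carrier M" "x \<ominus>\<^bsub>M\<^esub> y = \<zero>\<^bsub>M\<^esub>" shows "x = y"
proof -
  interpret abelian_group M by fact
  show ?thesis using assms r_neg2[OF assms(3), of x] minus_equality[of x "\<ominus>\<^bsub>M\<^esub> y"]
    by (simp add: a_minus_def)
qed

lemma left_moduleI: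
  assumes "ring R"
    and "\<And>x y. \<lbrakk>x \<in> carrier M; y \<in> carrier M\<rbrakk> \<Longrightarrow> x \<oplus>\<^bsub>M\<^esub> y \<in> carrier M"
    and "\<zero>\<^bsub>M\<^esub> \<in> carrier M"
    and "\<And>x y z. \<lbrakk>x \<in> carrier M; y \<in> carrier M; z \<in> carrier M\<rbrakk> \<Longrightarrow>
          (x \<oplus>\<^bsub>M\<^esub> y) \<oplus>\<^bsub>M\<^esub> z = x \<oplus>\<^bsub>M\<^esub> (y \<oplus>\<^bsub>M\<^esub> z)"
    and "\<And>x y. \<lbrakk>x \<in> carrier M; y \<in> carrier M\<rbrakk> \<Longrightarrow> x \<oplus>\<^bsub>M\<^esub> y = y \<oplus>\<^bsub>M\<^esub> x"
    and "\<And>x. x \<in> carrier M \<Longrightarrow> \<zero>\<^bsub>M\<^esub> \<oplus>\<^bsub>M\<^esub> x = x"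
    and "\<And>x. x \<in> carrier M \<Longrightarrow> \<exists>y\<in>carrier M. y \<oplus>\<^bsub>M\<^esub> x = \<zero>\<^bsub>M\<^esub>"
    and "\<And>a x. \<lbrakk>a \<in> carrier R; x \<in> carrier M\<rbrakk> \<Longrightarrow> a \<odot>\<^bsub>M\<^esub> x \<in> carrier M"
    and "\<And>a b x. \<lbrakk>a \<in> carrier R; b \<in> carrier R; x \<in> carrier M\<rbrakk> \<Longrightarrow>
          (a \<oplus>\<^bsub>R\<^esub> b) \<odot>\<^bsub>M\<^esub> x = a \<odot>\<^bsub>M\<^esub> x \<oplus>\<^bsub>M\<^esub> b \<odot>\<^bsub>M\<^esub> x"
    and "\<And>a x y. \<lbrakk>a \<in> carrier R; x \<in> carrier M; y \<in> carrier M\<rbrakk> \<Longrightarrow>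
          a \<odot>\<^bsub>M\<^esub> (x \<oplus>\<^bsub>M\<^esub> y) = a \<odot>\<^bsub>M\<^esub> x \<oplus>\<^bsub>M\<^esub> a \<odot>\<^bsub>M\<^esub> y"
    and "\<And>a b x. \<lbrakk>a \<in> carrier R; b \<in> carrier R; x \<in> carrier M\<rbrakk> \<Longrightarrow>
          (a \<otimes>\<^bsub>R\<^esub> b) \<odot>\<^bsub>M\<^esub> x = a \<odot>\<^bsub>M\<^esub> (b \<odot>\<^bsub>M\<^esub> x)"
    and "\<And>x. x \<in> carrier M \<Longrightarrow> \<one>\<^bsub>R\<^esub> \<odot>\<^bsub>M\<^esub> x = x"
  shows "left_module R M"
proof -
  have "abelian_group M" by (rule abelian_groupI) (use assms in auto)
  then show ?thesis
    unfolding left_module_def left_module_axioms_def using assms by blast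
qed

lemma add_self_zeroD:
  assumes "abelian_group M" "x \<in> carrier M" "x \<oplus>\<^bsub>M\<^esub> x = x" shows "x = \<zero>\<^bsub>M\<^esub>"
  using assms by (metis abelian_group.r_neg1 abelian_group.l_neg)

lemma smult_zero:
  assumes "left_module R M" "a \<in> carrier R"
  shows "a \<odot>\<^bsub>M\<^esub> \<zero>\<^bsub>M\<^esub> = \<zero>\<^bsub>M\<^esub>"
proof -
  interpret left_module R M by fact
  show ?thesis
    using smult_r_distr[of a "\<zero>\<^bsub>M\<^esub>" "\<zero>\<^bsub>M\<^esub>"] assms(2) smult_closed
    by (intro add_self_zeroD[OF M.abelian_group_axioms]) simp_all
qed

lemma zero_smult:
  assumes "left_module R M" "x \<in> carrier M"
  shows "\<zero>\<^bsub>R\<^esub> \<odot>\<^bsub>M\<^esub> x = \<zero>\<^bsub>M\<^esub>"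
proof -
  interpret left_module R M by fact
  show ?thesis
    using smult_l_distr[of "\<zero>\<^bsub>R\<^esub>" "\<zero>\<^bsub>R\<^esub>" x] assms(2) smult_closed
    by (intro add_self_zeroD[OF M.abelian_group_axioms]) simp_all
qed

lemma minus_one_smult:
  assumes "left_module R M" "x \<in> carrier M"
  shows "(\<ominus>\<^bsub>R\<^esub> \<one>\<^bsub>R\<^esub>) \<odot>\<^bsub>M\<^esub> x = \<ominus>\<^bsub>M\<^esub> x"
proof -
  interpret left_module R M by fact
  have "(\<ominus>\<^bsub>R\<^esub> \<one>\<^bsub>R\<^esub>) \<odot>\<^bsub>M\<^esub> x \<oplus>\<^bsub>M\<^esub> x = (\<ominus>\<^bsub>R\<^esub> \<one>\<^bsub>R\<^esub> \<oplus>\<^bsub>R\<^esub> \<one>\<^bsub>R\<^esub>) \<odot>\<^bsub>M\<^esub> x"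
    using smult_l_distr assms(2) smult_one by simp
  also have "\<dots> = \<zero>\<^bsub>M\<^esub>" using zero_smult[OF assms] by (simp add: R.l_neg)
  finally show ?thesis using assms(2) smult_closed
    by (metis M.add.inv_equality M.minus_minus R.a_inv_closed R.one_closed)
qed

lemma smult_minus:
  assumes "left_module R M" "a \<in> carrier R" "x \<in> carrier M"
  shows "a \<odot>\<^bsub>M\<^esub> (\<ominus>\<^bsub>M\<^esub> x) = \<ominus>\<^bsub>M\<^esub> (a \<odot>\<^bsub>M\<^esub> x)"
proof -
  interpret left_module R M by fact
  have "a \<odot>\<^bsub>M\<^esub> (\<ominus>\<^bsub>M\<^esub> x) \<oplus>\<^bsub>M\<^esub> a \<odot>\<^bsub>M\<^esub> x = \<zero>\<^bsub>M\<^esub>"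
    using smult_r_distr[of a "\<ominus>\<^bsub>M\<^esub> x" x] assms smult_zero[OF assms(1,2)] by (simp add: M.l_neg)
  then show ?thesis using assms smult_closed M.add.inv_equality by simp
qed

text \<open>Unlike \<open>mod_hom\<close>, this asks neither for extensionality nor for a common
  carrier type, since the auxiliary modules live on pairs, functions and sequences. Both ends being
  modules is part of the predicate, so that a single fact feeds every rule about the map.\<close>

definition lin :: "('r, 'a) ring_scheme \<Rightarrow> ('r, 'm) module \<Rightarrow> ('r, 'n) module \<Rightarrow> ('m \<Rightarrow> 'n) \<Rightarrow> bool" where
  "lin R M N f \<longleftrightarrow> left_module R M \<and> left_module R N \<and>
     (\<forall>x\<in>carrier M. f x \<in> carrier N) \<and>
     (\<forall>x\<in>carrier M. \<forall>y\<in>carrier M. f (x \<oplus>\<^bsub>M\<^esub> y) = f x \<oplus>\<^bsub>N\<^esub> f y) \<and>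
     (\<forall>a\<in>carrier R. \<forall>x\<in>carrier M. f (a \<odot>\<^bsub>M\<^esub> x) = a \<odot>\<^bsub>N\<^esub> f x)"

lemma linI:
  assumes "left_module R M" "left_module R N"
    and "\<And>x. x \<in> carrier M \<Longrightarrow> f x \<in> carrier N"
    and "\<And>x y. x \<in> carrier M \<Longrightarrow> y \<in> carrier M \<Longrightarrow> f (x \<oplus>\<^bsub>M\<^esub> y) = f x \<oplus>\<^bsub>N\<^esub> f y"
    and "\<And>a x. a \<in> carrier R \<Longrightarrow> x \<in> carrier M \<Longrightarrow> f (a \<odot>\<^bsub>M\<^esub> x) = a \<odot>\<^bsub>N\<^esub> f x"
  shows "lin R M N f"
  using assms unfolding lin_def by blast

lemma
  assumes "lin R M N f"
  shows lin_dom: "left_module R M" and lin_cod: "left_module R N"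
    and lin_closed: "\<And>x. x \<in> carrier M \<Longrightarrow> f x \<in> carrier N"
    and lin_add: "\<And>x y. x \<in> carrier M \<Longrightarrow> y \<in> carrier M \<Longrightarrow> f (x \<oplus>\<^bsub>M\<^esub> y) = f x \<oplus>\<^bsub>N\<^esub> f y"
    and lin_smult: "\<And>a x. a \<in> carrier R \<Longrightarrow> x \<in> carrier M \<Longrightarrow> f (a \<odot>\<^bsub>M\<^esub> x) = a \<odot>\<^bsub>N\<^esub> f x"
  using assms unfolding lin_def by blast+

lemma lin_dom_group: "lin R M N f \<Longrightarrow> abelian_group M"
  and lin_cod_group: "lin R M N f \<Longrightarrow> abelian_group N"
  by (auto dest: lin_dom lin_cod left_module_group)

lemma lin_zero: assumes "lin R M N f" shows "f \<zero>\<^bsub>M\<^esub> = \<zero>\<^bsub>N\<^esub>"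
proof -
  interpret M: left_module R M by (rule lin_dom[OF assms])
  have "f (\<zero>\<^bsub>R\<^esub> \<odot>\<^bsub>M\<^esub> \<zero>\<^bsub>M\<^esub>) = \<zero>\<^bsub>R\<^esub> \<odot>\<^bsub>N\<^esub> f \<zero>\<^bsub>M\<^esub>" using lin_smult[OF assms] by simp
  then show ?thesis
    using zero_smult[OF lin_dom[OF assms]] zero_smult[OF lin_cod[OF assms]] lin_closed[OF assms] by simp
qed

lemma lin_neg:
  assumes "lin R M N f" "x \<in> carrier M" shows "f (\<ominus>\<^bsub>M\<^esub> x) = \<ominus>\<^bsub>N\<^esub> f x"
proof -
  interpret M: left_module R M by (rule lin_dom[OF assms(1)])
  show ?thesis
    using lin_smult[OF assms(1), of "\<ominus>\<^bsub>R\<^esub> \<one>\<^bsub>R\<^esub>" x] assms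
    by (simp add: minus_one_smult[OF lin_dom[OF assms(1)]] minus_one_smult[OF lin_cod[OF assms(1)]]
        lin_closed[OF assms(1)])
qed

lemma lin_minus:
  assumes "lin R M N f" "x \<in> carrier M" "y \<in> carrier M"
  shows "f (x \<ominus>\<^bsub>M\<^esub> y) = f x \<ominus>\<^bsub>N\<^esub> f y"
  using assms lin_dom_group[OF assms(1)] lin_cod_group[OF assms(1)]
  by (simp add: ag_closed abelian_group.minus_eq lin_add[OF assms(1)] lin_neg[OF assms(1)])

lemmas linD = lin_closed lin_add lin_smult lin_zero lin_neg lin_minus

lemma lin_id: "left_module R M \<Longrightarrow> lin R M M (\<lambda>x. x)"
  by (simp add: lin_def)

lemma lin_comp:
  assumes "lin R M N f" "lin R N K g" shows "lin R M K (\<lambda>x. g (f x))"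
  by (rule linI) (use lin_dom[OF assms(1)] lin_cod[OF assms(2)] in
      \<open>simp_all add: linD[OF assms(1)] linD[OF assms(2)]\<close>)

lemma lin_const_zero:
  assumes "left_module R M" "left_module R N" shows "lin R M N (\<lambda>x. \<zero>\<^bsub>N\<^esub>)"
  by (rule linI) (use assms left_module_group[OF assms(2)] in \<open>simp_all add: ag smult_zero\<close>)

lemma lin_plus:
  assumes "lin R M N f" "lin R M N g" shows "lin R M N (\<lambda>x. f x \<oplus>\<^bsub>N\<^esub> g x)"
  by (rule linI) (use lin_dom[OF assms(1)] lin_cod[OF assms(1)] lin_cod_group[OF assms(1)] in
      \<open>simp_all add: linD[OF assms(1)] linD[OF assms(2)] ag left_module_smult\<close>)

lemma lin_diff:
  assumes "lin R M N f" "lin R M N g" shows "lin R M N (\<lambda>x. f x \<ominus>\<^bsub>N\<^esub> g x)"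
  by (rule linI) (use lin_dom[OF assms(1)] lin_cod[OF assms(1)] lin_cod_group[OF assms(1)] in
      \<open>simp_all add: linD[OF assms(1)] linD[OF assms(2)] ag left_module_smult smult_minus\<close>)

lemma lin_cong:
  assumes "lin R M N f" "\<And>x. x \<in> carrier M \<Longrightarrow> g x = f x" shows "lin R M N g"
  by (rule linI) (use lin_dom[OF assms(1)] lin_cod[OF assms(1)] lin_dom_group[OF assms(1)] in
      \<open>simp_all add: linD[OF assms(1)] assms(2) ag_closed left_module_smult\<close>)

lemma lin_inj_iff:
  assumes "lin R M N f"
  shows "inj_on f (carrier M) \<longleftrightarrow> (\<forall>x\<in>carrier M. f x = \<zero>\<^bsub>N\<^esub> \<longrightarrow> x = \<zero>\<^bsub>M\<^esub>)" (is "?L \<longleftrightarrow> ?R")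
proof
  interpret M: abelian_group M by (rule lin_dom_group[OF assms])
  interpret N: abelian_group N by (rule lin_cod_group[OF assms])
  show "?L \<Longrightarrow> ?R" using lin_zero[OF assms] by (metis M.zero_closed inj_onD)
  show ?L if ?R
  proof (rule inj_onI)
    fix x y assume xy: "x \<in> carrier M" "y \<in> carrier M" "f x = f y"
    then have "f (x \<ominus>\<^bsub>M\<^esub> y) = \<zero>\<^bsub>N\<^esub>"
      using linD[OF assms] by (simp add: N.r_neg N.minus_eq)
    then show "x = y"
      using that xy M.minus_closed minus_eq_zeroD[OF M.abelian_group_axioms] by blast
  qed
qed

text \<open>Replaces the choice of representatives and the check of well-definedness.\<close>

lemma lin_of_relation:
  assumes W: "left_module R W" and Y: "left_module R Y"
    and tot: "\<And>x. x \<in> carrier W \<Longrightarrow> \<exists>y\<in>carrier Y. G x y"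
    and add: "\<And>x y x' y'. \<lbrakk>x \<in> carrier W; x' \<in> carrier W; y \<in> carrier Y; y' \<in> carrier Y; G x y; G x' y'\<rbrakk>
      \<Longrightarrow> G (x \<oplus>\<^bsub>W\<^esub> x') (y \<oplus>\<^bsub>Y\<^esub> y')"
    and smult: "\<And>a x y. \<lbrakk>a \<in> carrier R; x \<in> carrier W; y \<in> carrier Y; G x y\<rbrakk>
      \<Longrightarrow> G (a \<odot>\<^bsub>W\<^esub> x) (a \<odot>\<^bsub>Y\<^esub> y)"
    and zero: "\<And>y. \<lbrakk>y \<in> carrier Y; G \<zero>\<^bsub>W\<^esub> y\<rbrakk> \<Longrightarrow> y = \<zero>\<^bsub>Y\<^esub>"
  shows "\<exists>f. lin R W Y f \<and> (\<forall>x\<in>carrier W. \<forall>y\<in>carrier Y. G x y \<longleftrightarrow> y = f x)"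
proof -
  interpret R: ring R by (rule left_module_ring[OF W])
  note gW = left_module_group[OF W] and gY = left_module_group[OF Y]
  have uniq: "y = z" if "x \<in> carrier W" "y \<in> carrier Y" "z \<in> carrier Y" "G x y" "G x z" for x y z
  proof (rule minus_eq_zeroD[OF gY that(2,3)])
    \<comment> \<open>Negation is multiplication by \<open>-1\<close>, so the closure rules put
      \<open>(0, y - z)\<close> into the relation, whose fibre over zero is trivial.\<close>
    have "G (\<ominus>\<^bsub>W\<^esub> x) (\<ominus>\<^bsub>Y\<^esub> z)"
      using smult[of "\<ominus>\<^bsub>R\<^esub> \<one>\<^bsub>R\<^esub>" x z] that by (simp add: minus_one_smult[OF W] minus_one_smult[OF Y])
    then have "G (x \<oplus>\<^bsub>W\<^esub> \<ominus>\<^bsub>W\<^esub> x) (y \<oplus>\<^bsub>Y\<^esub> \<ominus>\<^bsub>Y\<^esub> z)"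
      using that gW gY by (intro add) (simp_all add: ag)
    then show "y \<ominus>\<^bsub>Y\<^esub> z = \<zero>\<^bsub>Y\<^esub>"
      using that gW gY by (intro zero) (simp_all add: ag)
  qed
  define f where "f x = (SOME y. y \<in> carrier Y \<and> G x y)" for x
  have f: "f x \<in> carrier Y" "G x (f x)" if "x \<in> carrier W" for x
    using someI_ex[of "\<lambda>y. y \<in> carrier Y \<and> G x y"] tot[OF that] unfolding f_def by blast+
  have "lin R W Y f"
  proof (rule linI[OF W Y])
    fix x y assume "x \<in> carrier W" "y \<in> carrier W"
    then show "f (x \<oplus>\<^bsub>W\<^esub> y) = f x \<oplus>\<^bsub>Y\<^esub> f y"
      using f gW gY add by (intro uniq[of "x \<oplus>\<^bsub>W\<^esub> y"]) (simp_all add: ag_closed)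
  next
    fix a x assume "a \<in> carrier R" "x \<in> carrier W"
    then show "f (a \<odot>\<^bsub>W\<^esub> x) = a \<odot>\<^bsub>Y\<^esub> f x"
      using f W Y smult by (intro uniq[of "a \<odot>\<^bsub>W\<^esub> x"]) (simp_all add: left_module_smult)
  qed (rule f)
  moreover have "G x y \<longleftrightarrow> y = f x" if "x \<in> carrier W" "y \<in> carrier Y" for x y
    using uniq f that by blast
  ultimately show ?thesis by blast
qed

text \<open>The relation \<open>{(q w, h w)}\<close> is total because \<open>q\<close> is onto, and
  its fibre over zero is trivial because \<open>ker q\<close> lies in \<open>ker h\<close>.\<close>

lemma lin_factor:
  assumes q: "lin R W X q" "q ` carrier W = carrier X" and h: "lin R W Y h"
    and ker: "\<And>w. \<lbrakk>w \<in> carrier W; q w = \<zero>\<^bsub>X\<^esub>\<rbrakk> \<Longrightarrow> h w = \<zero>\<^bsub>Y\<^esub>"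
  obtains f where "lin R X Y f" "\<And>w. w \<in> carrier W \<Longrightarrow> f (q w) = h w"
proof -
  note D = linD[OF q(1)] linD[OF h]
  note gW = lin_dom_group[OF q(1)] and mW = lin_dom[OF q(1)]
  have "\<exists>f. lin R X Y f \<and>
    (\<forall>x\<in>carrier X. \<forall>y\<in>carrier Y. (\<exists>w\<in>carrier W. q w = x \<and> h w = y) \<longleftrightarrow> y = f x)"
  proof (rule lin_of_relation)
    show "left_module R X" "left_module R Y" using lin_cod q(1) h by blast+
    fix x assume "x \<in> carrier X"
    then obtain w where "w \<in> carrier W" "x = q w" using q(2) by auto
    then show "\<exists>y\<in>carrier Y. \<exists>w\<in>carrier W. q w = x \<and> h w = y" using D(7) by blast
  next
    fix x y x' y' assume "\<exists>w\<in>carrier W. q w = x \<and> h w = y" "\<exists>w\<in>carrier W. q w = x' \<and> h w = y'"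
    then obtain w w' where "w \<in> carrier W" "w' \<in> carrier W" "q w = x" "h w = y" "q w' = x'" "h w' = y'" by blast
    then show "\<exists>w\<in>carrier W. q w = x \<oplus>\<^bsub>X\<^esub> x' \<and> h w = y \<oplus>\<^bsub>Y\<^esub> y'"
      using D gW by (intro bexI[of _ "w \<oplus>\<^bsub>W\<^esub> w'"]) (auto simp: ag_closed)
  next
    fix a x y assume "a \<in> carrier R" "\<exists>w\<in>carrier W. q w = x \<and> h w = y"
    then show "\<exists>w\<in>carrier W. q w = a \<odot>\<^bsub>X\<^esub> x \<and> h w = a \<odot>\<^bsub>Y\<^esub> y"
      using D mW by (metis left_module.smult_closed)
  next
    fix y assume "\<exists>w\<in>carrier W. q w = \<zero>\<^bsub>X\<^esub> \<and> h w = y"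
    then show "y = \<zero>\<^bsub>Y\<^esub>" using ker by blast
  qed
  then obtain f where f: "lin R X Y f"
    "\<forall>x\<in>carrier X. \<forall>y\<in>carrier Y. (\<exists>w\<in>carrier W. q w = x \<and> h w = y) = (y = f x)"
    by (elim exE conjE)
  have "f (q w) = h w" if "w \<in> carrier W" for w
    using f(2)[rule_format, of "q w" "h w"] that D(1,7) by auto
  then show ?thesis using that f(1) by blast
qed

section \<open>Submodules, quotients and products\<close>

definition submod :: "('r, 'a) ring_scheme \<Rightarrow> ('r, 'm) module \<Rightarrow> 'm set \<Rightarrow> bool" where
  "submod R M S \<longleftrightarrow> S \<subseteq> carrier M \<and> \<zero>\<^bsub>M\<^esub> \<in> S \<and> (\<forall>x\<in>S. \<forall>y\<in>S. x \<oplus>\<^bsub>M\<^esub> y \<in> S) \<and>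
     (\<forall>a\<in>carrier R. \<forall>x\<in>S. a \<odot>\<^bsub>M\<^esub> x \<in> S)"

lemma submod_minus:
  assumes "left_module R M" "submod R M S" "x \<in> S" shows "\<ominus>\<^bsub>M\<^esub> x \<in> S"
proof -
  interpret left_module R M by fact
  have "(\<ominus>\<^bsub>R\<^esub> \<one>\<^bsub>R\<^esub>) \<odot>\<^bsub>M\<^esub> x \<in> S" using assms unfolding submod_def by blast
  moreover have "x \<in> carrier M" using assms unfolding submod_def by blast
  ultimately show ?thesis using minus_one_smult[OF assms(1)] by simp
qed

lemma submod_left_module:
  assumes M: "left_module R M" and S: "submod R M S"
  shows "left_module R (M\<lparr>carrier := S\<rparr>)"
proof -
  have S': "S \<subseteq> carrier M" using S by (simp add: submod_def)
  show ?thesis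
  proof (rule left_moduleI)
    fix x assume "x \<in> carrier (M\<lparr>carrier := S\<rparr>)"
    then show "\<exists>y\<in>carrier (M\<lparr>carrier := S\<rparr>). y \<oplus>\<^bsub>M\<lparr>carrier := S\<rparr>\<^esub> x = \<zero>\<^bsub>M\<lparr>carrier := S\<rparr>\<^esub>"
      using submod_minus[OF M S] S' left_module_group[OF M]
      by (auto intro!: bexI[of _ "\<ominus>\<^bsub>M\<^esub> x"] simp: ag subset_iff)
  qed (use M S S' left_module_group[OF M] left_module_ring[OF M] in
      \<open>auto simp: submod_def ag subset_iff left_module_smult\<close>)
qed

lemma submod_ker:
  assumes "lin R M N f" shows "submod R M {x \<in> carrier M. f x = \<zero>\<^bsub>N\<^esub>}"
  using assms lin_dom_group[OF assms] lin_cod_group[OF assms] lin_dom[OF assms] lin_cod[OF assms]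
  unfolding submod_def by (auto simp: linD[OF assms] ag left_module_smult smult_zero)

lemma submod_image:
  assumes "lin R M N f" shows "submod R N (f ` carrier M)"
proof -
  have m: "\<zero>\<^bsub>M\<^esub> \<in> carrier M" "\<And>x y. x \<in> carrier M \<Longrightarrow> y \<in> carrier M \<Longrightarrow> x \<oplus>\<^bsub>M\<^esub> y \<in> carrier M"
    "\<And>a x. a \<in> carrier R \<Longrightarrow> x \<in> carrier M \<Longrightarrow> a \<odot>\<^bsub>M\<^esub> x \<in> carrier M"
    using lin_dom_group[OF assms] lin_dom[OF assms] by (simp_all add: ag_closed left_module_smult)
  note L = linD[OF assms]
  show ?thesis unfolding submod_def
  proof (intro conjI ballI subsetI)
    show "\<zero>\<^bsub>N\<^esub> \<in> f ` carrier M" using m(1) L(4) by (metis imageI)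
    fix x y assume "x \<in> f ` carrier M" "y \<in> f ` carrier M"
    then show "x \<oplus>\<^bsub>N\<^esub> y \<in> f ` carrier M" using m(2) L(2) by (smt (verit) imageE imageI)
  next
    fix a x assume "x \<in> f ` carrier M" "a \<in> carrier R"
    then show "a \<odot>\<^bsub>N\<^esub> x \<in> f ` carrier M" using m(3) L(3) by (smt (verit) imageE imageI)
  qed (use L in auto)
qed

lemma lin_restrict_dom:
  assumes "lin R M N f" "submod R M S" shows "lin R (M\<lparr>carrier := S\<rparr>) N f"
  by (rule linI) (use submod_left_module[OF lin_dom[OF assms(1)] assms(2)] lin_cod[OF assms(1)] assms(2)
      in \<open>auto simp: submod_def subset_iff linD[OF assms(1)]\<close>)

lemma lin_restrict_cod:
  assumes "lin R M N f" "submod R N S" "\<And>x. x \<in> carrier M \<Longrightarrow> f x \<in> S"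
  shows "lin R M (N\<lparr>carrier := S\<rparr>) f"
  using assms submod_left_module[OF lin_cod[OF assms(1)] assms(2)]
  unfolding lin_def submod_def by auto

lemma lin_submod_inclusion:
  "left_module R M \<Longrightarrow> submod R M S \<Longrightarrow> lin R (M\<lparr>carrier := S\<rparr>) M (\<lambda>x. x)"
  by (rule lin_restrict_dom[OF lin_id])

text \<open>Every element of \<open>N\<close> is some \<open>q u\<close>, so each module law of
  \<open>N\<close> is the image of the same law in \<open>M\<close>. That \<open>N\<close> is a
  module is part of the conclusion; quotients and transported structures both obtain it
  here.\<close>

lemma left_module_image:
  assumes M: "left_module R M" and car: "carrier N = q ` carrier M"
    and zero: "\<zero>\<^bsub>N\<^esub> = q \<zero>\<^bsub>M\<^esub>"
    and add: "\<And>x y. x \<in> carrier M \<Longrightarrow> y \<in> carrier M \<Longrightarrow> q (x \<oplus>\<^bsub>M\<^esub> y) = q x \<oplus>\<^bsub>N\<^esub> q y"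
    and smult: "\<And>a x. a \<in> carrier R \<Longrightarrow> x \<in> carrier M \<Longrightarrow> q (a \<odot>\<^bsub>M\<^esub> x) = a \<odot>\<^bsub>N\<^esub> q x"
  shows "lin R M N q"
proof -
  note g = left_module_group[OF M]
  interpret R: ring R by (rule left_module_ring[OF M])
  have "left_module R N"
  proof (rule left_moduleI[OF left_module_ring[OF M]])
    fix x assume "x \<in> carrier N"
    then obtain u where "u \<in> carrier M" "x = q u" using car by auto
    then show "\<exists>y\<in>carrier N. y \<oplus>\<^bsub>N\<^esub> x = \<zero>\<^bsub>N\<^esub>"
      using g by (intro bexI[of _ "q (\<ominus>\<^bsub>M\<^esub> u)"])
        (simp_all add: car zero ag_closed add[symmetric] abelian_group.l_neg)
  qed (use M g in \<open>auto simp: car zero add[symmetric] smult[symmetric] ag left_module_smult\<close>)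
  then show ?thesis by (rule linI[OF M]) (auto simp: car add smult)
qed

section \<open>Quotient modules\<close>

definition coset_rep :: "('r, 'm) module \<Rightarrow> 'm set \<Rightarrow> 'm \<Rightarrow> 'm" where
  "coset_rep M S x = (SOME y. y \<in> carrier M \<and> x \<ominus>\<^bsub>M\<^esub> y \<in> S)"

text \<open>The quotient is carried by chosen representatives, so it lives on a subset of the
  carrier of the module.\<close>

definition quot :: "('r, 'm) module \<Rightarrow> 'm set \<Rightarrow> ('r, 'm) module" where
  "quot M S = M\<lparr>carrier := coset_rep M S ` carrier M, zero := coset_rep M S \<zero>\<^bsub>M\<^esub>,
     add := (\<lambda>x y. coset_rep M S (x \<oplus>\<^bsub>M\<^esub> y)), smult := (\<lambda>a x. coset_rep M S (a \<odot>\<^bsub>M\<^esub> x))\<rparr>"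

lemma coset_rep_eq_iff:
  assumes M: "left_module R M" and S: "submod R M S" and xy: "x \<in> carrier M" "y \<in> carrier M"
  shows "coset_rep M S x = coset_rep M S y \<longleftrightarrow> x \<ominus>\<^bsub>M\<^esub> y \<in> S"
proof -
  interpret left_module R M by fact
  have rep: "coset_rep M S u \<in> carrier M \<and> u \<ominus>\<^bsub>M\<^esub> coset_rep M S u \<in> S" if "u \<in> carrier M" for u
    unfolding coset_rep_def
    by (rule someI[of _ u]) (use that S in \<open>auto simp: submod_def M.r_neg a_minus_def\<close>)
  have tri: "u \<ominus>\<^bsub>M\<^esub> w \<in> S" if "u \<ominus>\<^bsub>M\<^esub> v \<in> S" "v \<ominus>\<^bsub>M\<^esub> w \<in> S" "u \<in> carrier M" "v \<in> carrier M" "w \<in> carrier M" for u v w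
  proof -
    have "(u \<ominus>\<^bsub>M\<^esub> v) \<oplus>\<^bsub>M\<^esub> (v \<ominus>\<^bsub>M\<^esub> w) = u \<ominus>\<^bsub>M\<^esub> w" using that by (simp add: ag M.abelian_group_axioms)
    then show ?thesis using that S by (metis submod_def)
  qed
  have sym: "v \<ominus>\<^bsub>M\<^esub> u \<in> S" if "u \<ominus>\<^bsub>M\<^esub> v \<in> S" "u \<in> carrier M" "v \<in> carrier M" for u v
    using submod_minus[OF M S that(1)] that by (simp add: ag M.abelian_group_axioms)
  show ?thesis
  proof
    assume "coset_rep M S x = coset_rep M S y"
    then show "x \<ominus>\<^bsub>M\<^esub> y \<in> S" using rep[OF xy(1)] rep[OF xy(2)] tri sym xy by metis
  next
    assume a: "x \<ominus>\<^bsub>M\<^esub> y \<in> S"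
    \<comment> \<open>Both choices range over the same candidates, hence pick the same
      element.\<close>
    have "(z \<in> carrier M \<and> x \<ominus>\<^bsub>M\<^esub> z \<in> S) = (z \<in> carrier M \<and> y \<ominus>\<^bsub>M\<^esub> z \<in> S)" for z
      using a tri sym xy by blast
    then show "coset_rep M S x = coset_rep M S y" unfolding coset_rep_def by presburger
  qed
qed

text \<open>Quotients are used through their projection: linear, onto, with kernel \<open>S\<close>.
  The last fact keeps a quotient within every size bound on \<open>M\<close>.\<close>

lemma
  assumes M: "left_module R M" and S: "submod R M S"
  shows lin_coset_rep: "lin R M (quot M S) (coset_rep M S)"
    and coset_rep_onto: "coset_rep M S ` carrier M = carrier (quot M S)"
    and coset_rep_zero_iff: "\<And>x. x \<in> carrier M \<Longrightarrow> coset_rep M S x = \<zero>\<^bsub>quot M S\<^esub> \<longleftrightarrow> x \<in> S"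
    and carrier_quot: "carrier (quot M S) \<subseteq> carrier M"
proof -
  interpret left_module R M by fact
  note g = M.abelian_group_axioms
  have rep: "coset_rep M S u \<in> carrier M \<and> u \<ominus>\<^bsub>M\<^esub> coset_rep M S u \<in> S" if "u \<in> carrier M" for u
    unfolding coset_rep_def
    by (rule someI[of _ u]) (use that S in \<open>auto simp: submod_def M.r_neg a_minus_def\<close>)
  show "lin R M (quot M S) (coset_rep M S)"
  proof (rule left_module_image[OF M])
    fix x y assume xy: "x \<in> carrier M" "y \<in> carrier M"
    have "(x \<oplus>\<^bsub>M\<^esub> y) \<ominus>\<^bsub>M\<^esub> (coset_rep M S x \<oplus>\<^bsub>M\<^esub> coset_rep M S y)
        = (x \<ominus>\<^bsub>M\<^esub> coset_rep M S x) \<oplus>\<^bsub>M\<^esub> (y \<ominus>\<^bsub>M\<^esub> coset_rep M S y)"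
      using xy rep g by (simp add: ag)
    then show "coset_rep M S (x \<oplus>\<^bsub>M\<^esub> y) = coset_rep M S x \<oplus>\<^bsub>quot M S\<^esub> coset_rep M S y"
      using S rep[OF xy(1)] rep[OF xy(2)] xy
      by (simp add: quot_def coset_rep_eq_iff[OF M S]) (simp add: submod_def)
  next
    fix a x assume ax: "a \<in> carrier R" "x \<in> carrier M"
    have "a \<odot>\<^bsub>M\<^esub> x \<ominus>\<^bsub>M\<^esub> a \<odot>\<^bsub>M\<^esub> coset_rep M S x = a \<odot>\<^bsub>M\<^esub> (x \<ominus>\<^bsub>M\<^esub> coset_rep M S x)"
      using ax rep by (simp add: a_minus_def smult_r_distr smult_minus[OF M])
    then show "coset_rep M S (a \<odot>\<^bsub>M\<^esub> x) = a \<odot>\<^bsub>quot M S\<^esub> coset_rep M S x"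
      using S rep[OF ax(2)] ax smult_closed
      by (simp add: quot_def coset_rep_eq_iff[OF M S]) (simp add: submod_def)
  qed (simp_all add: quot_def)
  show "coset_rep M S ` carrier M = carrier (quot M S)" by (simp add: quot_def)
  show "carrier (quot M S) \<subseteq> carrier M" using rep by (auto simp: quot_def)
  show "coset_rep M S x = \<zero>\<^bsub>quot M S\<^esub> \<longleftrightarrow> x \<in> S" if "x \<in> carrier M" for x
    using that coset_rep_eq_iff[OF M S that, of "\<zero>\<^bsub>M\<^esub>"] g
    by (simp add: quot_def a_minus_def neg_zero)
qed

section \<open>Binary and countable products\<close>

definition prod_module :: "('r, 'm) module \<Rightarrow> ('r, 'n) module \<Rightarrow> ('r, 'm \<times> 'n) module" where
  "prod_module M N = \<lparr>carrier = carrier M \<times> carrier N, monoid.mult = undefined, one = undefined,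
     zero = (\<zero>\<^bsub>M\<^esub>, \<zero>\<^bsub>N\<^esub>), add = (\<lambda>x y. (fst x \<oplus>\<^bsub>M\<^esub> fst y, snd x \<oplus>\<^bsub>N\<^esub> snd y)),
     smult = (\<lambda>a x. (a \<odot>\<^bsub>M\<^esub> fst x, a \<odot>\<^bsub>N\<^esub> snd x))\<rparr>"

lemma prod_module_simps [simp]:
  "carrier (prod_module M N) = carrier M \<times> carrier N"
  "\<zero>\<^bsub>prod_module M N\<^esub> = (\<zero>\<^bsub>M\<^esub>, \<zero>\<^bsub>N\<^esub>)"
  "x \<oplus>\<^bsub>prod_module M N\<^esub> y = (fst x \<oplus>\<^bsub>M\<^esub> fst y, snd x \<oplus>\<^bsub>N\<^esub> snd y)"
  "a \<odot>\<^bsub>prod_module M N\<^esub> x = (a \<odot>\<^bsub>M\<^esub> fst x, a \<odot>\<^bsub>N\<^esub> snd x)"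
  by (simp_all add: prod_module_def)

lemma left_module_prod:
  assumes M: "left_module R M" and N: "left_module R N"
  shows "left_module R (prod_module M N)"
proof (rule left_moduleI)
  fix x assume "x \<in> carrier (prod_module M N)"
  then show "\<exists>y\<in>carrier (prod_module M N). y \<oplus>\<^bsub>prod_module M N\<^esub> x = \<zero>\<^bsub>prod_module M N\<^esub>"
    using left_module_group[OF M] left_module_group[OF N]
    by (intro bexI[of _ "(\<ominus>\<^bsub>M\<^esub> fst x, \<ominus>\<^bsub>N\<^esub> snd x)"]) (auto simp: ag_closed ag_zero)
qed (use assms left_module_ring[OF M] left_module_group[OF M] left_module_group[OF N] in
    \<open>auto simp: ag left_module_smult\<close>)

lemma lin_fst: "left_module R M \<Longrightarrow> left_module R N \<Longrightarrow> lin R (prod_module M N) M fst"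
  by (rule linI) (auto simp: left_module_prod)

lemma lin_snd: "left_module R M \<Longrightarrow> left_module R N \<Longrightarrow> lin R (prod_module M N) N snd"
  by (rule linI) (auto simp: left_module_prod)

lemma lin_pair:
  assumes "lin R W M f" "lin R W N g" shows "lin R W (prod_module M N) (\<lambda>w. (f w, g w))"
  by (rule linI) (use lin_dom[OF assms(1)] left_module_prod[OF lin_cod[OF assms(1)] lin_cod[OF assms(2)]]
      in \<open>simp_all add: linD[OF assms(1)] linD[OF assms(2)]\<close>)

definition seq_module :: "(nat \<Rightarrow> ('r, 'm) module) \<Rightarrow> ('r, nat \<Rightarrow> 'm) module" where
  "seq_module M = \<lparr>carrier = {x. \<forall>k. x k \<in> carrier (M k)}, monoid.mult = undefined, one = undefined,
     zero = (\<lambda>k. \<zero>\<^bsub>M k\<^esub>), add = (\<lambda>x y k. x k \<oplus>\<^bsub>M k\<^esub> y k), smult = (\<lambda>a x k. a \<odot>\<^bsub>M k\<^esub> x k)\<rparr>"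

lemma seq_module_simps [simp]:
  "carrier (seq_module M) = {x. \<forall>k. x k \<in> carrier (M k)}"
  "\<zero>\<^bsub>seq_module M\<^esub> = (\<lambda>k. \<zero>\<^bsub>M k\<^esub>)"
  "x \<oplus>\<^bsub>seq_module M\<^esub> y = (\<lambda>k. x k \<oplus>\<^bsub>M k\<^esub> y k)"
  "a \<odot>\<^bsub>seq_module M\<^esub> x = (\<lambda>k. a \<odot>\<^bsub>M k\<^esub> x k)"
  by (simp_all add: seq_module_def)

lemma left_module_seq:
  assumes M: "\<And>k. left_module R (M k)"
  shows "left_module R (seq_module M)"
proof (rule left_moduleI)
  fix x assume "x \<in> carrier (seq_module M)"
  then show "\<exists>y\<in>carrier (seq_module M). y \<oplus>\<^bsub>seq_module M\<^esub> x = \<zero>\<^bsub>seq_module M\<^esub>"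
    using left_module_group[OF M]
    by (intro bexI[of _ "\<lambda>k. \<ominus>\<^bsub>M k\<^esub> x k"]) (auto simp: ag_closed ag_zero)
qed (use M left_module_ring[OF M] left_module_group[OF M] in
    \<open>auto simp: ag_closed ag_zero left_module_smult[OF M] abelian_monoid.a_assoc[OF abelian_group.axioms(1)]
      intro!: ext abelian_monoid.a_comm[OF abelian_group.axioms(1)]\<close>)

section \<open>Small sets and transport of modules into the universe\<close>

text \<open>Members of \<open>U\<close> are sets over the carrier type of the modules, whereas
  products, lists and function spaces have other types. Smallness compares cardinalities across
  types, and \<open>small_embedding\<close> turns it back into a member of \<open>U\<close>.\<close>

definition small :: "'m set set \<Rightarrow> 'n set \<Rightarrow> bool" where
  "small U S \<longleftrightarrow> (\<exists>B\<in>U. S \<lesssim> B)"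

lemma small_lepoll: "small U T \<Longrightarrow> S \<lesssim> T \<Longrightarrow> small U S"
  unfolding small_def using lepoll_trans by blast

lemma small_subset: "small U T \<Longrightarrow> S \<subseteq> T \<Longrightarrow> small U S"
  by (meson small_lepoll subset_imp_lepoll)

lemma small_mem: "S \<in> U \<Longrightarrow> small U S"
  unfolding small_def by blast

lemma small_inj: "small U T \<Longrightarrow> inj_on f S \<Longrightarrow> f ` S \<subseteq> T \<Longrightarrow> small U S"
  by (rule small_lepoll) (auto simp: lepoll_def)

lemma small_embedding:
  assumes "module_universe R U" "small U S"
  obtains \<phi> where "inj_on \<phi> S" "\<phi> ` S \<in> U"
proof -
  obtain B \<phi> where B: "B \<in> U" "inj_on \<phi> S" "\<phi> ` S \<subseteq> B"
    using assms(2) unfolding small_def lepoll_def by blast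
  have "\<phi> ` S \<in> U" using assms(1) B subset_imp_lepoll unfolding module_universe_def by blast
  then show ?thesis using that B by blast
qed

lemma small_seq:
  assumes U: "module_universe R U" and A: "\<And>k. small U (A k)"
  shows "small U {x. \<forall>k::nat. x k \<in> A k}"
proof -
  have "\<exists>\<phi>. inj_on \<phi> (A k) \<and> \<phi> ` A k \<in> U" for k
    using small_embedding[OF U A] by metis
  then obtain \<phi> where \<phi>: "\<And>k. inj_on (\<phi> k) (A k)" "\<And>k. \<phi> k ` A k \<in> U" by metis
  then obtain B where B: "B \<in> U" "(\<Pi>\<^sub>E k\<in>UNIV. \<phi> k ` A k) \<lesssim> B"
    using U unfolding module_universe_def by (elim conjE allE[of _ "\<lambda>k. \<phi> k ` A k"]) blast
  have "inj_on (\<lambda>x k. \<phi> k (x k)) {x. \<forall>k. x k \<in> A k}"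
  proof (rule inj_onI, rule ext)
    fix x y k assume xy: "x \<in> {x. \<forall>k. x k \<in> A k}" "y \<in> {x. \<forall>k. x k \<in> A k}"
      "(\<lambda>k. \<phi> k (x k)) = (\<lambda>k. \<phi> k (y k))"
    then show "x k = y k" using fun_cong[OF xy(3), of k] inj_onD[OF \<phi>(1)[of k]] by simp
  qed
  moreover have "(\<lambda>x k. \<phi> k (x k)) ` {x. \<forall>k. x k \<in> A k} \<subseteq> (\<Pi>\<^sub>E k\<in>UNIV. \<phi> k ` A k)" by auto
  ultimately show ?thesis by (rule small_inj[OF small_lepoll[OF small_mem[OF B(1)] B(2)]])
qed

lemma small_times:
  assumes U: "module_universe R U" and A: "small U A" and B: "small U B"
  shows "small U (A \<times> B)"
proof -
  obtain \<phi> \<psi> where \<phi>: "inj_on \<phi> A" "\<phi> ` A \<in> U" and \<psi>: "inj_on \<psi> B" "\<psi> ` B \<in> U"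
    using small_embedding[OF U A] small_embedding[OF U B] by metis
  \<comment> \<open>A pair \<open>(a, b)\<close> is coded as the sequence
    \<open>a, b, b, ...\<close>, which reduces binary to countable products.\<close>
  have "small U {x. \<forall>k::nat. x k \<in> (if k = 0 then \<phi> ` A else \<psi> ` B)}"
    by (rule small_seq[OF U]) (use \<phi> \<psi> in \<open>auto intro: small_mem\<close>)
  then show ?thesis
  proof (rule small_inj)
    let ?f = "\<lambda>p (k::nat). if k = 0 then \<phi> (fst p) else \<psi> (snd p)"
    show "inj_on ?f (A \<times> B)"
    proof (rule inj_onI)
      fix p q assume pq: "p \<in> A \<times> B" "q \<in> A \<times> B" "?f p = ?f q"
      have "\<phi> (fst p) = \<phi> (fst q)" "\<psi> (snd p) = \<psi> (snd q)"
        using fun_cong[OF pq(3), of 0] fun_cong[OF pq(3), of 1] by simp_all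
      then show "p = q" using pq(1,2) inj_onD[OF \<phi>(1)] inj_onD[OF \<psi>(1)]
        by (simp add: prod_eq_iff mem_Times_iff)
    qed
  qed auto
qed

lemma small_nat:
  assumes "module_universe R U" shows "small U (UNIV :: nat set)"
  using assms unfolding module_universe_def small_def infinite_le_lepoll by blast

lemma small_countable:
  assumes "module_universe R U" "countable A" shows "small U A"
  using assms small_inj[OF small_nat[OF assms(1)]] unfolding countable_def by blast

lemma small_ring:
  assumes "module_universe R U" shows "small U (carrier R)"
  using assms unfolding module_universe_def small_def by blast

lemma small_lists:
  assumes U: "module_universe R U" and A: "small U A" shows "small U (lists A)"
proof -
  \<comment> \<open>A list is coded by the sequence of its optional entries, each paired with the
    length of the list.\<close>
  have "small U {x. \<forall>k::nat. x k \<in> (UNIV :: nat set) \<times> insert None (Some ` A)}"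
  proof (intro small_seq[OF U] small_times[OF U] small_nat[OF U])
    have "small U ((UNIV :: nat set) \<times> A)" by (intro small_times[OF U] small_nat[OF U] A)
    moreover have "insert None (Some ` A) \<lesssim> (UNIV :: nat set) \<times> A" if a: "a \<in> A" for a
    proof -
      \<comment> \<open>Index \<open>0\<close> supplies \<open>None\<close> and every other index
        supplies \<open>Some x\<close>; the element \<open>a\<close> completes the pair with index
        \<open>0\<close>.\<close>
      have "insert None (Some ` A) \<subseteq> (\<lambda>(n, x). if n = 0 then None else Some x) ` ((UNIV :: nat set) \<times> A)"
        using a by (force simp: image_iff)
      then show ?thesis by (rule subset_image_lepoll)
    qed
    ultimately show "small U (insert None (Some ` A))"
      using small_lepoll small_countable[OF U, of "{None}"] by (cases "A = {}") auto
  qed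
  then show ?thesis
  proof (rule small_inj)
    let ?f = "\<lambda>xs (k::nat). (length xs, if k < length xs then Some (xs ! k) else None)"
    show "inj_on ?f (lists A)"
    proof (rule inj_onI, rule nth_equalityI)
      fix xs ys assume e: "?f xs = ?f ys"
      show l: "length xs = length ys" using fun_cong[OF e, of 0] by simp
      show "xs ! i = ys ! i" if "i < length xs" for i using fun_cong[OF e, of i] that l by simp
    qed
  qed (auto simp: in_lists_conv_set)
qed

lemma small_funcset:
  assumes U: "module_universe R U" and A: "small U A" shows "small U (carrier R \<rightarrow>\<^sub>E A)"
proof -
  obtain \<phi> where \<phi>: "inj_on \<phi> A" "\<phi> ` A \<in> U" using small_embedding[OF U A] by metis
  then obtain B where B: "B \<in> U" "(carrier R \<rightarrow>\<^sub>E \<phi> ` A) \<lesssim> B"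
    using U unfolding module_universe_def by blast
  then have "small U (carrier R \<rightarrow>\<^sub>E \<phi> ` A)" unfolding small_def by blast
  then show ?thesis
  proof (rule small_inj)
    let ?g = "\<lambda>f. restrict (\<lambda>r. \<phi> (f r)) (carrier R)"
    show "inj_on ?g (carrier R \<rightarrow>\<^sub>E A)"
    proof (rule inj_onI, rule PiE_ext)
      fix f g r assume fg: "f \<in> carrier R \<rightarrow>\<^sub>E A" "g \<in> carrier R \<rightarrow>\<^sub>E A" "?g f = ?g g" "r \<in> carrier R"
      have "\<phi> (f r) = \<phi> (g r)" using fun_cong[OF fg(3), of r] fg(4) by simp
      then show "f r = g r" using fg(4) inj_onD[OF \<phi>(1), of "f r" "g r"]
        by (simp add: PiE_mem[OF fg(1)] PiE_mem[OF fg(2)])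
    qed
    show "?g ` (carrier R \<rightarrow>\<^sub>E A) \<subseteq> carrier R \<rightarrow>\<^sub>E \<phi> ` A"
      by (intro image_subsetI PiE_I) (auto intro!: imageI intro: PiE_mem)
  qed
qed

definition fin_supp :: "'x set \<Rightarrow> 'c set \<Rightarrow> 'c \<Rightarrow> ('x \<Rightarrow> 'c) set" where
  "fin_supp X A z = {\<phi>. (\<forall>x. \<phi> x \<in> A) \<and> finite {x. \<phi> x \<noteq> z} \<and> (\<forall>x. x \<notin> X \<longrightarrow> \<phi> x = z)}"

text \<open>A finitely supported function is determined by its graph over the support, and a chosen
  enumeration of this finite set is a list over \<open>X \<times> A\<close>.\<close>

lemma small_fin_supp:
  fixes X :: "'x set" and A :: "'c set"
  assumes U: "module_universe R U" and X: "small U X" and A: "small U A"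
  shows "small U (fin_supp X A z)"
proof -
  define g where "g \<phi> = (SOME xs. set xs = (\<lambda>x. (x, \<phi> x)) ` {x. \<phi> x \<noteq> z})" for \<phi> :: "'x \<Rightarrow> 'c"
  have g: "set (g \<phi>) = (\<lambda>x. (x, \<phi> x)) ` {x. \<phi> x \<noteq> z}" if "\<phi> \<in> fin_supp X A z" for \<phi>
    unfolding g_def by (rule someI_ex, rule finite_list) (use that in \<open>auto simp: fin_supp_def\<close>)
  have "small U (lists (X \<times> A))" by (intro small_lists[OF U] small_times[OF U] X A)
  then show ?thesis
  proof (rule small_inj)
    show "inj_on g (fin_supp X A z)"
    proof (rule inj_onI, rule ext)
      fix \<phi> \<psi> x assume h: "\<phi> \<in> fin_supp X A z" "\<psi> \<in> fin_supp X A z" "g \<phi> = g \<psi>"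
      have "(y, c) \<in> set (g \<phi>) \<longleftrightarrow> \<phi> y \<noteq> z \<and> c = \<phi> y" "(y, c) \<in> set (g \<psi>) \<longleftrightarrow> \<psi> y \<noteq> z \<and> c = \<psi> y" for y c
        using g h(1,2) by auto
      then show "\<phi> x = \<psi> x" using h(3) by metis
    qed
    show "g ` fin_supp X A z \<subseteq> lists (X \<times> A)"
    proof
      fix xs assume "xs \<in> g ` fin_supp X A z"
      then obtain \<phi> where "\<phi> \<in> fin_supp X A z" "xs = g \<phi>" by blast
      then show "xs \<in> lists (X \<times> A)" using g[of \<phi>] by (auto simp: in_lists_conv_set fin_supp_def)
    qed
  qed
qed

lemma Obj_Modules [simp]: "M \<in> Obj (Modules R U) \<longleftrightarrow> left_module R M \<and> carrier M \<in> U"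
  by (simp add: Modules_def)

text \<open>The return to the fixed carrier type: a small module on any type has an isomorphic copy
  in the universe. Two mutually inverse linear maps are kept instead of a bijection, so that maps
  can be composed with either of them.\<close>

lemma module_transport:
  fixes N :: "('r, 'n) module" and U :: "'m set set"
  assumes U: "module_universe R U" and N: "left_module R N" and small: "small U (carrier N)"
  obtains M \<phi> \<psi> where "M \<in> Obj (Modules R U)" "lin R N M \<phi>" "lin R M N \<psi>"
    "\<And>x. x \<in> carrier N \<Longrightarrow> \<psi> (\<phi> x) = x" "\<And>y. y \<in> carrier M \<Longrightarrow> \<phi> (\<psi> y) = y"
proof -
  obtain \<phi> where \<phi>: "inj_on \<phi> (carrier N)" "\<phi> ` carrier N \<in> U" using small_embedding[OF U small] .
  define \<psi> where "\<psi> = inv_into (carrier N) \<phi>"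
  define M :: "('r, 'm) module" where "M = \<lparr>carrier = \<phi> ` carrier N, monoid.mult = undefined, one = undefined,
    zero = \<phi> \<zero>\<^bsub>N\<^esub>, add = (\<lambda>x y. \<phi> (\<psi> x \<oplus>\<^bsub>N\<^esub> \<psi> y)), smult = (\<lambda>a x. \<phi> (a \<odot>\<^bsub>N\<^esub> \<psi> x))\<rparr>"
  have inv: "\<psi> (\<phi> x) = x" if "x \<in> carrier N" for x
    unfolding \<psi>_def using \<phi>(1) that by simp
  have "lin R N M \<phi>" by (rule left_module_image[OF N]) (simp_all add: M_def inv)
  moreover from lin_cod[OF this] have "lin R M N \<psi>"
    by (intro linI N) (use N left_module_group[OF N] in
        \<open>auto simp: M_def inv left_module_smult ag_closed\<close>)
  moreover have "\<phi> (\<psi> y) = y" if "y \<in> carrier M" for y using that inv by (auto simp: M_def)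
  moreover have "M \<in> Obj (Modules R U)" using \<phi>(2) lin_cod[OF calculation(1)] by (simp add: M_def)
  ultimately show ?thesis using that inv by blast
qed

lemma mod_hom_iff:
  assumes "left_module R M" "left_module R N"
  shows "f \<in> mod_hom R M N \<longleftrightarrow> lin R M N f \<and> f \<in> extensional (carrier M)"
  using assms unfolding mod_hom_def lin_def by (auto simp: PiE_def)

lemma restrict_mod_hom:
  assumes "lin R M N f" shows "restrict f (carrier M) \<in> mod_hom R M N"
  using assms lin_cong[OF assms, of "restrict f (carrier M)"]
  by (simp add: mod_hom_iff[OF lin_dom[OF assms] lin_cod[OF assms]])

section \<open>Enough projective modules\<close>

text \<open>Morphisms of \<open>Modules\<close> are extensional. Restricting \<open>e\<close> and
  \<open>g\<close> to the carriers makes them morphisms, and restricting a linear lift makes it one,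
  so lifting arguments can ignore extensionality.\<close>

lemma projective_Modules_iff:
  "projective (Modules R U) P \<longleftrightarrow> P \<in> Obj (Modules R U) \<and>
     (\<forall>X\<in>Obj (Modules R U). \<forall>Y\<in>Obj (Modules R U). \<forall>e g. lin R X Y e \<longrightarrow> e ` carrier X = carrier Y \<longrightarrow>
        lin R P Y g \<longrightarrow> (\<exists>h. lin R P X h \<and> (\<forall>p\<in>carrier P. e (h p) = g p)))" (is "_ \<longleftrightarrow> _ \<and> ?lift")
proof (cases "P \<in> Obj (Modules R U)")
  case P: True
  have "projective (Modules R U) P \<longleftrightarrow> ?lift"
  proof
    assume pr: "projective (Modules R U) P"
    show ?lift
    proof (intro ballI allI impI)
      fix X Y e g
      assume h: "X \<in> Obj (Modules R U)" "Y \<in> Obj (Modules R U)" "lin R X Y e" "e ` carrier X = carrier Y" "lin R P Y g"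
      have "restrict e (carrier X) \<in> Epi (Modules R U) X Y"
        using h by (simp add: Modules_def restrict_mod_hom)
      moreover have "restrict g (carrier P) \<in> carrier (Mor (Modules R U) P Y)"
        using h by (simp add: Modules_def mod_hom_group_def restrict_mod_hom)
      ultimately obtain k where k: "k \<in> carrier (Mor (Modules R U) P X)"
        "Comp (Modules R U) P (restrict e (carrier X)) k = restrict g (carrier P)"
        using pr h(1,2) unfolding projective_def by blast
      then have l: "lin R P X k" using P h(1) by (simp add: Modules_def mod_hom_group_def mod_hom_iff)
      have "e (k p) = g p" if "p \<in> carrier P" for p
        using fun_cong[OF k(2), of p] that linD(1)[OF l that] by (simp add: Modules_def compose_def)
      then show "\<exists>h. lin R P X h \<and> (\<forall>p\<in>carrier P. e (h p) = g p)" using l by blast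
    qed
  next
    assume lift: ?lift
    show "projective (Modules R U) P" unfolding projective_def
    proof (intro conjI ballI P)
      fix X Y e g
      assume h: "X \<in> Obj (Modules R U)" "Y \<in> Obj (Modules R U)" "e \<in> Epi (Modules R U) X Y"
        "g \<in> carrier (Mor (Modules R U) P Y)"
      have g: "lin R P Y g" "g \<in> extensional (carrier P)" and e: "lin R X Y e" "e ` carrier X = carrier Y"
        using P h by (auto simp: Modules_def mod_hom_group_def mod_hom_iff)
      obtain k where k: "lin R P X k" "\<forall>p\<in>carrier P. e (k p) = g p" using lift h(1,2) g e by blast
      have "Comp (Modules R U) P e (restrict k (carrier P)) = g"
        using k g(2) by (auto simp: Modules_def compose_def extensional_def fun_eq_iff)
      then show "\<exists>h\<in>carrier (Mor (Modules R U) P X). Comp (Modules R U) P e h = g"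
        using restrict_mod_hom[OF k(1)]
        by (intro bexI[of _ "restrict k (carrier P)"]) (simp_all add: Modules_def mod_hom_group_def)
    qed
  qed
  then show ?thesis using P by blast
qed (unfold projective_def, blast)

text \<open>\<open>act c x\<close> is the contribution of the coefficient \<open>c\<close> at the
  index \<open>x\<close>, and \<open>z\<close> is the coefficient off the support. Leaving the
  action abstract serves two purposes: scalars of \<open>R\<close> acting on a family of elements,
  and rational coefficients acting through their integer parts.\<close>

definition supp_sum :: "('r, 'm) module \<Rightarrow> 'c \<Rightarrow> ('c \<Rightarrow> 'x \<Rightarrow> 'm) \<Rightarrow> ('x \<Rightarrow> 'c) \<Rightarrow> 'm" where
  "supp_sum M z act \<phi> = finsum M (\<lambda>x. act (\<phi> x) x) {x. \<phi> x \<noteq> z}"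

text \<open>Functions with different supports can be compared only over a common finite set; the
  additional indices contribute zero.\<close>

lemma supp_sum_superset:
  assumes M: "abelian_group M" and F: "finite F" "{x. \<phi> x \<noteq> z} \<subseteq> F"
    and closed: "\<And>x. x \<in> F \<Longrightarrow> act (\<phi> x) x \<in> carrier M"
    and zero: "\<And>x. x \<in> F \<Longrightarrow> \<phi> x = z \<Longrightarrow> act z x = \<zero>\<^bsub>M\<^esub>"
  shows "supp_sum M z act \<phi> = finsum M (\<lambda>x. act (\<phi> x) x) F"
proof -
  interpret abelian_group M by fact
  show ?thesis unfolding supp_sum_def
    by (rule add.finprod_mono_neutral_cong_left) (use F closed zero in auto)
qed

lemma supp_sum_closed:
  assumes "abelian_group M" "\<And>x. act (\<phi> x) x \<in> carrier M"
  shows "supp_sum M z act \<phi> \<in> carrier M"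
proof -
  interpret abelian_group M by fact
  show ?thesis unfolding supp_sum_def by (rule finsum_closed) (use assms in auto)
qed

lemma supp_sum_add:
  assumes M: "abelian_group M" and fin: "finite {x. \<phi> x \<noteq> z}" "finite {x. \<psi> x \<noteq> z}"
    and closed: "\<And>x. act (\<phi> x) x \<in> carrier M" "\<And>x. act (\<psi> x) x \<in> carrier M"
    and zero: "\<And>x. act z x = \<zero>\<^bsub>M\<^esub>"
    and add: "\<And>x. act (\<chi> x) x = act (\<phi> x) x \<oplus>\<^bsub>M\<^esub> act (\<psi> x) x"
    and supp: "\<And>x. \<phi> x = z \<Longrightarrow> \<psi> x = z \<Longrightarrow> \<chi> x = z"
  shows "supp_sum M z act \<chi> = supp_sum M z act \<phi> \<oplus>\<^bsub>M\<^esub> supp_sum M z act \<psi>"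
proof -
  interpret abelian_group M by fact
  let ?F = "{x. \<phi> x \<noteq> z} \<union> {x. \<psi> x \<noteq> z}"
  have F: "finite ?F" using fin by simp
  have "supp_sum M z act \<chi> = finsum M (\<lambda>x. act (\<chi> x) x) ?F"
    by (rule supp_sum_superset[OF M F]) (use supp closed zero add in auto)
  also have "\<dots> = finsum M (\<lambda>x. act (\<phi> x) x \<oplus>\<^bsub>M\<^esub> act (\<psi> x) x) ?F" by (simp only: add)
  also have "\<dots> = finsum M (\<lambda>x. act (\<phi> x) x) ?F \<oplus>\<^bsub>M\<^esub> finsum M (\<lambda>x. act (\<psi> x) x) ?F"
    by (rule finsum_addf) (use closed in auto)
  also have "finsum M (\<lambda>x. act (\<phi> x) x) ?F = supp_sum M z act \<phi>"
    by (rule supp_sum_superset[OF M F, symmetric]) (use closed zero in auto)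
  also have "finsum M (\<lambda>x. act (\<psi> x) x) ?F = supp_sum M z act \<psi>"
    by (rule supp_sum_superset[OF M F, symmetric]) (use closed zero in auto)
  finally show ?thesis .
qed

lemma smult_finsum:
  assumes M: "left_module R M" and a: "a \<in> carrier R" and F: "finite F"
    and f: "\<And>x. x \<in> F \<Longrightarrow> f x \<in> carrier M"
  shows "a \<odot>\<^bsub>M\<^esub> finsum M f F = finsum M (\<lambda>x. a \<odot>\<^bsub>M\<^esub> f x) F"
proof -
  interpret left_module R M by fact
  show ?thesis using F f
  proof (induction F rule: finite_induct)
    case (insert x F)
    then show ?case using a
      by (simp add: M.finsum_insert Pi_def smult_closed smult_r_distr M.finsum_closed)
  qed (simp add: smult_zero[OF M a])
qed

section \<open>Free modules and their universal property\<close>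

definition free_module :: "('r, 'a) ring_scheme \<Rightarrow> 'x set \<Rightarrow> ('r, 'x \<Rightarrow> 'r) module" where
  "free_module R X = \<lparr>carrier = fin_supp X (carrier R) \<zero>\<^bsub>R\<^esub>, monoid.mult = undefined, one = undefined,
     zero = (\<lambda>x. \<zero>\<^bsub>R\<^esub>), add = (\<lambda>\<phi> \<psi> x. \<phi> x \<oplus>\<^bsub>R\<^esub> \<psi> x), smult = (\<lambda>a \<phi> x. a \<otimes>\<^bsub>R\<^esub> \<phi> x)\<rparr>"

lemma left_module_free:
  assumes "ring R" shows "left_module R (free_module R X)"
proof -
  interpret ring R by fact
  have add: "(\<lambda>x. \<phi> x \<oplus>\<^bsub>R\<^esub> \<psi> x) \<in> fin_supp X (carrier R) \<zero>\<^bsub>R\<^esub>"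
    if "\<phi> \<in> fin_supp X (carrier R) \<zero>\<^bsub>R\<^esub>" "\<psi> \<in> fin_supp X (carrier R) \<zero>\<^bsub>R\<^esub>" for \<phi> \<psi>
  proof -
    have "{x. \<phi> x \<oplus>\<^bsub>R\<^esub> \<psi> x \<noteq> \<zero>\<^bsub>R\<^esub>} \<subseteq> {x. \<phi> x \<noteq> \<zero>\<^bsub>R\<^esub>} \<union> {x. \<psi> x \<noteq> \<zero>\<^bsub>R\<^esub>}" by auto
    from finite_subset[OF this] show ?thesis using that by (simp add: fin_supp_def)
  qed
  have smult: "(\<lambda>x. a \<otimes>\<^bsub>R\<^esub> \<phi> x) \<in> fin_supp X (carrier R) \<zero>\<^bsub>R\<^esub>"
    if "\<phi> \<in> fin_supp X (carrier R) \<zero>\<^bsub>R\<^esub>" "a \<in> carrier R" for a \<phi>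
  proof -
    have "{x. a \<otimes>\<^bsub>R\<^esub> \<phi> x \<noteq> \<zero>\<^bsub>R\<^esub>} \<subseteq> {x. \<phi> x \<noteq> \<zero>\<^bsub>R\<^esub>}" using that by auto
    from finite_subset[OF this] show ?thesis using that by (simp add: fin_supp_def)
  qed
  show ?thesis
  proof (rule left_moduleI[OF assms])
    fix \<phi> assume p: "\<phi> \<in> carrier (free_module R X)"
    then have "(\<lambda>x. \<ominus>\<^bsub>R\<^esub> \<one>\<^bsub>R\<^esub> \<otimes>\<^bsub>R\<^esub> \<phi> x) \<in> carrier (free_module R X)"
      using smult by (simp add: free_module_def)
    moreover have "(\<lambda>x. \<ominus>\<^bsub>R\<^esub> \<one>\<^bsub>R\<^esub> \<otimes>\<^bsub>R\<^esub> \<phi> x) \<oplus>\<^bsub>free_module R X\<^esub> \<phi> = \<zero>\<^bsub>free_module R X\<^esub>"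
      using p by (auto simp: free_module_def fin_supp_def l_minus l_neg)
    ultimately show "\<exists>y\<in>carrier (free_module R X). y \<oplus>\<^bsub>free_module R X\<^esub> \<phi> = \<zero>\<^bsub>free_module R X\<^esub>" by blast
  next
    fix a b \<phi> assume "a \<in> carrier R" "b \<in> carrier R" "\<phi> \<in> carrier (free_module R X)"
    then show "(a \<oplus>\<^bsub>R\<^esub> b) \<odot>\<^bsub>free_module R X\<^esub> \<phi> = a \<odot>\<^bsub>free_module R X\<^esub> \<phi> \<oplus>\<^bsub>free_module R X\<^esub> b \<odot>\<^bsub>free_module R X\<^esub> \<phi>"
      by (auto simp: free_module_def fin_supp_def l_distr)
  qed (auto simp: free_module_def add smult, auto simp: fin_supp_def a_ac m_assoc r_distr)
qed

definition free_basis :: "('r, 'a) ring_scheme \<Rightarrow> 'x \<Rightarrow> 'x \<Rightarrow> 'r" where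
  "free_basis R x = (\<lambda>y. if y = x then \<one>\<^bsub>R\<^esub> else \<zero>\<^bsub>R\<^esub>)"

lemma free_basis_closed: "ring R \<Longrightarrow> x \<in> X \<Longrightarrow> free_basis R x \<in> carrier (free_module R X)"
  by (auto simp: free_basis_def free_module_def fin_supp_def ring.ring_simprules)

lemma free_module_extend:
  assumes R: "ring R" and M: "left_module R M" and t: "\<And>x. x \<in> X \<Longrightarrow> t x \<in> carrier M"
  obtains f where "lin R (free_module R X) M f" "\<And>x. x \<in> X \<Longrightarrow> f (free_basis R x) = t x"
proof -
  interpret M: left_module R M by fact
  \<comment> \<open>The value zero off \<open>X\<close> places every summand in \<open>M\<close>
    without a condition on the index.\<close>
  define act where "act a x = (if x \<in> X then a \<odot>\<^bsub>M\<^esub> t x else \<zero>\<^bsub>M\<^esub>)" for a x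
  let ?f = "supp_sum M \<zero>\<^bsub>R\<^esub> act"
  note ag = M.abelian_group_axioms
  have zero: "act \<zero>\<^bsub>R\<^esub> x = \<zero>\<^bsub>M\<^esub>" for x using zero_smult[OF M] t by (simp add: act_def)
  have closed: "act (\<phi> x) x \<in> carrier M" if "\<phi> \<in> carrier (free_module R X)" for \<phi> x
    using that t M.smult_closed by (auto simp: act_def free_module_def fin_supp_def)
  have fin: "finite {x. \<phi> x \<noteq> \<zero>\<^bsub>R\<^esub>}" if "\<phi> \<in> carrier (free_module R X)" for \<phi>
    using that by (simp add: free_module_def fin_supp_def)
  have "lin R (free_module R X) M ?f"
  proof (rule linI[OF left_module_free[OF R] M])
    fix \<phi> assume p: "\<phi> \<in> carrier (free_module R X)"
    show "?f \<phi> \<in> carrier M" by (rule supp_sum_closed[OF ag]) (rule closed[OF p])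
    fix \<psi> assume q: "\<psi> \<in> carrier (free_module R X)"
    show "?f (\<phi> \<oplus>\<^bsub>free_module R X\<^esub> \<psi>) = ?f \<phi> \<oplus>\<^bsub>M\<^esub> ?f \<psi>"
      by (rule supp_sum_add[OF ag fin[OF p] fin[OF q] closed[OF p] closed[OF q] zero])
        (use p q t in \<open>auto simp: act_def free_module_def fin_supp_def M.smult_l_distr\<close>)
  next
    fix a \<phi> assume a: "a \<in> carrier R" and p: "\<phi> \<in> carrier (free_module R X)"
    have sm: "a \<odot>\<^bsub>free_module R X\<^esub> \<phi> \<in> carrier (free_module R X)"
      by (rule left_module.smult_closed[OF left_module_free[OF R] a p])
    have smult_eq: "a \<odot>\<^bsub>free_module R X\<^esub> \<phi> = (\<lambda>x. a \<otimes>\<^bsub>R\<^esub> \<phi> x)" by (simp add: free_module_def)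
    have "?f (a \<odot>\<^bsub>free_module R X\<^esub> \<phi>) = finsum M (\<lambda>x. act (a \<otimes>\<^bsub>R\<^esub> \<phi> x) x) {x. \<phi> x \<noteq> \<zero>\<^bsub>R\<^esub>}"
      unfolding smult_eq
    proof (rule supp_sum_superset[OF ag fin[OF p]])
      show "{x. a \<otimes>\<^bsub>R\<^esub> \<phi> x \<noteq> \<zero>\<^bsub>R\<^esub>} \<subseteq> {x. \<phi> x \<noteq> \<zero>\<^bsub>R\<^esub>}"
        using ring.ring_simprules(25)[OF R a] by auto
    qed (use closed[OF sm] zero in \<open>simp_all add: smult_eq\<close>)
    also have "\<dots> = finsum M (\<lambda>x. a \<odot>\<^bsub>M\<^esub> act (\<phi> x) x) {x. \<phi> x \<noteq> \<zero>\<^bsub>R\<^esub>}"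
      using a p t closed[OF p] M.smult_closed
      by (intro M.finsum_cong') (auto simp: act_def free_module_def fin_supp_def M.smult_assoc1 smult_zero[OF M])
    also have "\<dots> = a \<odot>\<^bsub>M\<^esub> ?f \<phi>"
      unfolding supp_sum_def by (rule smult_finsum[OF M a fin[OF p] closed[OF p], symmetric])
    finally show "?f (a \<odot>\<^bsub>free_module R X\<^esub> \<phi>) = a \<odot>\<^bsub>M\<^esub> ?f \<phi>" .
  qed
  moreover have "?f (free_basis R x) = t x" if "x \<in> X" for x
  proof -
    have "?f (free_basis R x) = finsum M (\<lambda>y. act (free_basis R x y) y) {x}"
      by (rule supp_sum_superset[OF ag])
        (use that t zero M.smult_closed zero_smult[OF M t] in \<open>auto simp: free_basis_def act_def\<close>)
    also have "\<dots> = t x" using that t by (simp add: act_def free_basis_def M.smult_one)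
    finally show ?thesis .
  qed
  ultimately show ?thesis using that by blast
qed

text \<open>Induction over a finite set containing the support: one coefficient is set to zero and
  given back as a multiple of a basis vector.\<close>

lemma free_module_ext:
  assumes R: "ring R" and f: "lin R (free_module R X) M f" and g: "lin R (free_module R X) M g"
    and eq: "\<And>x. x \<in> X \<Longrightarrow> f (free_basis R x) = g (free_basis R x)"
    and p: "\<phi> \<in> carrier (free_module R X)"
  shows "f \<phi> = g \<phi>"
proof -
  interpret ring R by fact
  note F = left_module_free[OF R]
  have "finite F \<Longrightarrow> {x. \<phi> x \<noteq> \<zero>\<^bsub>R\<^esub>} \<subseteq> F \<Longrightarrow> \<phi> \<in> carrier (free_module R X) \<Longrightarrow> f \<phi> = g \<phi>" for F \<phi>
  proof (induction F arbitrary: \<phi> rule: finite_induct)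
    case empty
    then have "\<phi> = \<zero>\<^bsub>free_module R X\<^esub>" by (auto simp: free_module_def)
    then show ?case using lin_zero[OF f] lin_zero[OF g] by simp
  next
    case (insert x F)
    show ?case
    proof (cases "\<phi> x = \<zero>\<^bsub>R\<^esub>")
      case True
      then show ?thesis using insert by (intro insert.IH) auto
    next
      case False
      then have x: "x \<in> X" "\<phi> x \<in> carrier R" using insert.prems by (auto simp: free_module_def fin_supp_def)
      let ?r = "\<phi>(x := \<zero>\<^bsub>R\<^esub>)"
      have r: "?r \<in> carrier (free_module R X)"
      proof -
        have "finite {y. ?r y \<noteq> \<zero>\<^bsub>R\<^esub>}"
          by (rule finite_subset[of _ "{y. \<phi> y \<noteq> \<zero>\<^bsub>R\<^esub>}"])
            (use insert.prems(2) in \<open>auto simp: free_module_def fin_supp_def\<close>)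
        then show ?thesis using insert.prems(2) by (auto simp: free_module_def fin_supp_def)
      qed
      have e: "\<phi> = ?r \<oplus>\<^bsub>free_module R X\<^esub> \<phi> x \<odot>\<^bsub>free_module R X\<^esub> free_basis R x"
        using insert.prems x by (auto simp: free_module_def free_basis_def fin_supp_def)
      have c: "\<phi> x \<odot>\<^bsub>free_module R X\<^esub> free_basis R x \<in> carrier (free_module R X)"
        by (rule left_module.smult_closed[OF F x(2) free_basis_closed[OF R x(1)]])
      have "f ?r = g ?r" using insert.prems by (intro insert.IH r) auto
      then show ?thesis
        using lin_add[OF f r c] lin_add[OF g r c] lin_smult[OF f x(2) free_basis_closed[OF R x(1)]]
          lin_smult[OF g x(2) free_basis_closed[OF R x(1)]] eq[OF x(1)] e by metis
    qed
  qed
  then show ?thesis using p unfolding free_module_def fin_supp_def by auto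
qed

text \<open>The free module on the underlying set of \<open>M\<close>, moved into the universe. It
  is small because it consists of finitely supported functions from a small set to
  \<open>R\<close>.\<close>

lemma enough_projective_modules:
  assumes R: "ring R" and U: "module_universe R U" and M: "M \<in> Obj (Modules R U)"
  obtains P e where "projective (Modules R U) P" "lin R P M e" "e ` carrier P = carrier M"
proof -
  let ?F = "free_module R (carrier M)"
  have mM: "left_module R M" using M by simp
  have "small U (carrier ?F)"
    unfolding free_module_def using small_fin_supp[OF U _ small_ring[OF U]] M by (auto intro: small_mem)
  then obtain P \<phi> \<psi> where P: "P \<in> Obj (Modules R U)" "lin R ?F P \<phi>" "lin R P ?F \<psi>"
    "\<And>x. x \<in> carrier ?F \<Longrightarrow> \<psi> (\<phi> x) = x" "\<And>y. y \<in> carrier P \<Longrightarrow> \<phi> (\<psi> y) = y"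
    using module_transport[OF U left_module_free[OF R]] by metis
  obtain f where f: "lin R ?F M f" "\<And>x. x \<in> carrier M \<Longrightarrow> f (free_basis R x) = x"
    using free_module_extend[OF R mM, of "carrier M" "\<lambda>x. x"] by metis
  note b = free_basis_closed[OF R, of _ "carrier M"]
  have "projective (Modules R U) P" unfolding projective_Modules_iff
  proof (intro conjI ballI allI impI P(1))
    fix X Y e g
    assume h: "X \<in> Obj (Modules R U)" "Y \<in> Obj (Modules R U)" "lin R X Y e" "e ` carrier X = carrier Y" "lin R P Y g"
    \<comment> \<open>The lift is prescribed on the basis by chosen preimages; it is a lift
      everywhere because maps out of a free module are determined by the basis.\<close>
    have "\<exists>t\<in>carrier X. e t = g (\<phi> (free_basis R x))" if "x \<in> carrier M" for x
      using linD(1)[OF h(5)] linD(1)[OF P(2)] b[OF that] h(4) by (metis imageE)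
    then obtain t where t: "\<And>x. x \<in> carrier M \<Longrightarrow> t x \<in> carrier X"
      "\<And>x. x \<in> carrier M \<Longrightarrow> e (t x) = g (\<phi> (free_basis R x))" by metis
    have mX: "left_module R X" using h(1) by simp
    obtain k where k: "lin R ?F X k" "\<And>x. x \<in> carrier M \<Longrightarrow> k (free_basis R x) = t x"
      using free_module_extend[OF R mX, of "carrier M" t] t(1) by metis
    have eq: "e (k q) = g (\<phi> q)" if "q \<in> carrier ?F" for q
      using free_module_ext[OF R lin_comp[OF k(1) h(3)] lin_comp[OF P(2) h(5)] _ that] k(2) t(2) by simp
    have "lin R P X (\<lambda>p. k (\<psi> p))" by (rule lin_comp[OF P(3) k(1)])
    moreover have "e (k (\<psi> p)) = g p" if "p \<in> carrier P" for p
      using eq[of "\<psi> p"] P(5)[OF that] linD(1)[OF P(3) that] by simp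
    ultimately show "\<exists>h. lin R P X h \<and> (\<forall>p\<in>carrier P. e (h p) = g p)" by blast
  qed
  moreover have l: "lin R P M (\<lambda>p. f (\<psi> p))" by (rule lin_comp[OF P(3) f(1)])
  moreover have "(\<lambda>p. f (\<psi> p)) ` carrier P = carrier M"
  proof
    show "carrier M \<subseteq> (\<lambda>p. f (\<psi> p)) ` carrier P"
    proof
      fix x assume x: "x \<in> carrier M"
      then show "x \<in> (\<lambda>p. f (\<psi> p)) ` carrier P"
        using f(2)[OF x] P(4)[OF b[OF x]] linD(1)[OF P(2) b[OF x]] by (metis image_eqI)
    qed
  qed (use linD(1)[OF l] in auto)
  ultimately show ?thesis using that by blast
qed

section \<open>Enough injective modules\<close>

lemma int_minus_one_smult:
  assumes "left_module \<Z> M" "x \<in> carrier M" shows "(- 1) \<odot>\<^bsub>M\<^esub> x = \<ominus>\<^bsub>M\<^esub> x"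
proof -
  have "\<ominus>\<^bsub>\<Z>\<^esub> 1 = - 1"
    using abelian_group.minus_equality[OF ring.axioms(1)[OF left_module_ring[OF assms(1)]], of "- 1" 1] by simp
  then show ?thesis using minus_one_smult[OF assms] by simp
qed

text \<open>Each multiple \<open>k x\<close> is reached from zero by adding or subtracting
  \<open>x\<close>, so induction on the integer \<open>k\<close> in both directions makes closure
  under scalars automatic.\<close>

lemma int_submodI:
  assumes M: "left_module \<Z> M" and S: "S \<subseteq> carrier M" "\<zero>\<^bsub>M\<^esub> \<in> S"
    and add: "\<And>x y. x \<in> S \<Longrightarrow> y \<in> S \<Longrightarrow> x \<oplus>\<^bsub>M\<^esub> y \<in> S"
    and neg: "\<And>x. x \<in> S \<Longrightarrow> \<ominus>\<^bsub>M\<^esub> x \<in> S"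
  shows "submod \<Z> M S"
proof -
  note Z = left_module_smult[OF M, simplified]
  note ab = left_module_group[OF M]
  have "k \<odot>\<^bsub>M\<^esub> x \<in> S" if x: "x \<in> S" for k x
  proof (induction k rule: int_induct[of _ 0])
    case base
    show ?case using zero_smult[OF M, of x] x S by auto
  next
    case (step1 i)
    then show ?case using x S add Z(2)[of x i 1] Z(5)[of x] by auto
  next
    case (step2 i)
    have "(i - 1) \<odot>\<^bsub>M\<^esub> x = i \<odot>\<^bsub>M\<^esub> x \<oplus>\<^bsub>M\<^esub> \<ominus>\<^bsub>M\<^esub> x"
      using Z(2)[of x i "- 1"] int_minus_one_smult[OF M, of x] x S by auto
    then show ?case using step2 add neg x by simp
  qed
  then show ?thesis using S add by (simp add: submod_def)
qed

lemma int_linI: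
  assumes A: "left_module \<Z> A" and B: "left_module \<Z> B"
    and f: "\<And>x. x \<in> carrier A \<Longrightarrow> f x \<in> carrier B"
    and add: "\<And>x y. x \<in> carrier A \<Longrightarrow> y \<in> carrier A \<Longrightarrow> f (x \<oplus>\<^bsub>A\<^esub> y) = f x \<oplus>\<^bsub>B\<^esub> f y"
  shows "lin \<Z> A B f"
proof -
  note ZA = left_module_smult[OF A, simplified] and ZB = left_module_smult[OF B, simplified]
  note gA = left_module_group[OF A] and gB = left_module_group[OF B]
  have zero: "f \<zero>\<^bsub>A\<^esub> = \<zero>\<^bsub>B\<^esub>"
    using add[of "\<zero>\<^bsub>A\<^esub>" "\<zero>\<^bsub>A\<^esub>"] f gA by (intro add_self_zeroD[OF gB]) (simp_all add: ag_closed ag_zero)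
  have neg: "f (\<ominus>\<^bsub>A\<^esub> x) = \<ominus>\<^bsub>B\<^esub> f x" if "x \<in> carrier A" for x
  proof -
    have "f (\<ominus>\<^bsub>A\<^esub> x) \<oplus>\<^bsub>B\<^esub> f x = \<zero>\<^bsub>B\<^esub>"
      using add[of "\<ominus>\<^bsub>A\<^esub> x" x] that gA zero by (simp add: ag_closed ag_zero)
    then show ?thesis using f that gA abelian_group.minus_equality[OF gB] by (simp add: ag_closed)
  qed
  have "f (k \<odot>\<^bsub>A\<^esub> x) = k \<odot>\<^bsub>B\<^esub> f x" if x: "x \<in> carrier A" for k x
  proof (induction k rule: int_induct[of _ 0])
    case base
    show ?case using zero_smult[OF A, of x] zero_smult[OF B, of "f x"] x f zero by simp
  next
    case (step1 i)
    then show ?case using ZA(2)[of x i 1] ZB(2)[of "f x" i 1] ZA(1,5) ZB(5) x f add by simp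
  next
    case (step2 i)
    then show ?case using ZA(2)[of x i "-1"] ZB(2)[of "f x" i "-1"] ZA(1) x f add neg gA
        int_minus_one_smult[OF A, of x] int_minus_one_smult[OF B, of "f x"] by (simp add: ag_closed)
  qed
  then show ?thesis by (intro linI[OF A B f add]) simp_all
qed

text \<open>Zorn's lemma is applied to submodules of \<open>W \<times> D\<close> that are graphs of partial maps.\<close>

lemma divisible_extend:
  fixes D :: "(int, 'd) module" and W :: "(int, 'w) module"
  assumes D: "left_module \<Z> D"
    and div: "\<And>n y. 0 < n \<Longrightarrow> y \<in> carrier D \<Longrightarrow> \<exists>z\<in>carrier D. n \<odot>\<^bsub>D\<^esub> z = y"
    and W: "left_module \<Z> W" and S: "submod \<Z> W S" and f: "lin \<Z> (W\<lparr>carrier := S\<rparr>) D f"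
  shows "\<exists>g. lin \<Z> W D g \<and> (\<forall>x\<in>S. g x = f x)"
proof -
  let ?P = "prod_module W D"
  \<comment> \<open>A submodule of the product is single-valued exactly when its fibre over zero is
    trivial.\<close>
  define \<G> where "\<G> = {G. submod \<Z> ?P G \<and> (\<forall>d. (\<zero>\<^bsub>W\<^esub>, d) \<in> G \<longrightarrow> d = \<zero>\<^bsub>D\<^esub>) \<and> (\<forall>x\<in>S. (x, f x) \<in> G)}"
  note P = left_module_prod[OF W D]
  note gW = left_module_group[OF W] and gD = left_module_group[OF D]
  note ZW = left_module_smult[OF W, simplified] and ZD = left_module_smult[OF D, simplified]
  note F = linD[OF f, simplified]
  have S': "S \<subseteq> carrier W" "\<zero>\<^bsub>W\<^esub> \<in> S" using S by (auto simp: submod_def)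
  have "\<exists>M\<in>\<G>. \<forall>X\<in>\<G>. M \<subseteq> X \<longrightarrow> X = M"
  proof (rule subset_Zorn_nonempty)
    have "submod \<Z> ?P ((\<lambda>x. (x, f x)) ` carrier (W\<lparr>carrier := S\<rparr>))"
      by (rule submod_image, rule lin_pair[OF lin_submod_inclusion[OF W S] f])
    then have "(\<lambda>x. (x, f x)) ` S \<in> \<G>" using F(4) by (auto simp: \<G>_def)
    then show "\<G> \<noteq> {}" by blast
  next
    fix \<C> assume C: "\<C> \<noteq> {}" "subset.chain \<G> \<C>"
    then have sub: "\<And>G. G \<in> \<C> \<Longrightarrow> G \<in> \<G>" and ch: "\<And>G H. G \<in> \<C> \<Longrightarrow> H \<in> \<C> \<Longrightarrow> G \<subseteq> H \<or> H \<subseteq> G"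
      by (auto simp: subset.chain_def)
    have sm: "submod \<Z> ?P G" if "G \<in> \<C>" for G using sub[OF that] by (simp add: \<G>_def)
    have "submod \<Z> ?P (\<Union>\<C>)" unfolding submod_def
    proof (intro conjI ballI)
      show "\<Union>\<C> \<subseteq> carrier ?P" using sm unfolding submod_def by blast
      show "\<zero>\<^bsub>?P\<^esub> \<in> \<Union>\<C>" using sm C(1) unfolding submod_def by blast
      fix x y assume "x \<in> \<Union>\<C>" "y \<in> \<Union>\<C>"
      then obtain G where "G \<in> \<C>" "x \<in> G" "y \<in> G" using ch by blast
      then show "x \<oplus>\<^bsub>?P\<^esub> y \<in> \<Union>\<C>" using sm unfolding submod_def by blast
    next
      fix a x assume "a \<in> carrier \<Z>" "x \<in> \<Union>\<C>"
      then show "a \<odot>\<^bsub>?P\<^esub> x \<in> \<Union>\<C>" using sm unfolding submod_def by blast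
    qed
    then show "\<Union>\<C> \<in> \<G>" using sub C(1) unfolding \<G>_def by blast
  qed
  then obtain M where M: "M \<in> \<G>" and max: "\<And>X. X \<in> \<G> \<Longrightarrow> M \<subseteq> X \<Longrightarrow> X = M" by blast
  have Msub: "submod \<Z> ?P M" and Mz: "\<And>d. (\<zero>\<^bsub>W\<^esub>, d) \<in> M \<Longrightarrow> d = \<zero>\<^bsub>D\<^esub>" and Mf: "\<And>x. x \<in> S \<Longrightarrow> (x, f x) \<in> M"
    using M by (auto simp: \<G>_def)
  have Mc: "x \<in> carrier W" "y \<in> carrier D" if "(x, y) \<in> M" for x y
    using Msub that by (auto simp: submod_def)
  have Madd: "(x \<oplus>\<^bsub>W\<^esub> x', y \<oplus>\<^bsub>D\<^esub> y') \<in> M" if "(x, y) \<in> M" "(x', y') \<in> M" for x y x' y'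
    using Msub that unfolding submod_def by fastforce
  have Msm: "(k \<odot>\<^bsub>W\<^esub> x, k \<odot>\<^bsub>D\<^esub> y) \<in> M" if "(x, y) \<in> M" for x y k
    using Msub that unfolding submod_def by fastforce
  have Mzero: "(\<zero>\<^bsub>W\<^esub>, \<zero>\<^bsub>D\<^esub>) \<in> M" using Msub by (simp add: submod_def)
  have M0: "(\<zero>\<^bsub>W\<^esub>, y \<oplus>\<^bsub>D\<^esub> \<ominus>\<^bsub>D\<^esub> y') \<in> M" if "(x, y) \<in> M" "(x, y') \<in> M" for x y y'
    using Madd[OF that(1) Msm[OF that(2), of "-1"]] Mc that gW
      int_minus_one_smult[OF W, of x] int_minus_one_smult[OF D, of y'] by (simp add: ag)
  have tot: "\<exists>d\<in>carrier D. (b, d) \<in> M" if b: "b \<in> carrier W" for b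
  proof -
    \<comment> \<open>A value \<open>d\<close> at \<open>b\<close> must be consistent with
      \<open>M\<close> on every multiple of \<open>b\<close> that is already in the domain; this
      suffices for extending \<open>M\<close> by \<open>(b, d)\<close>.\<close>
    have "\<exists>d\<in>carrier D. \<forall>n e. (n \<odot>\<^bsub>W\<^esub> b, e) \<in> M \<longrightarrow> e = n \<odot>\<^bsub>D\<^esub> d"
    proof (cases "\<exists>n>0. \<exists>e. (int n \<odot>\<^bsub>W\<^esub> b, e) \<in> M")
      case True
      \<comment> \<open>The integers \<open>n\<close> with \<open>n b\<close> in the domain form an
        ideal, generated by its least positive element \<open>k\<close>. Divisibility provides
        \<open>d\<close> such that \<open>k d\<close> is the value at \<open>k b\<close>.\<close>
      define k where "k = (LEAST n. 0 < n \<and> (\<exists>e. (int n \<odot>\<^bsub>W\<^esub> b, e) \<in> M))"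
      have k: "0 < k" "\<exists>e. (int k \<odot>\<^bsub>W\<^esub> b, e) \<in> M"
        using LeastI_ex[OF True] unfolding k_def by auto
      then obtain e0 where e0: "(int k \<odot>\<^bsub>W\<^esub> b, e0) \<in> M" by blast
      have kmin: "k \<le> n" if "0 < n" "(int n \<odot>\<^bsub>W\<^esub> b, e) \<in> M" for n e
        unfolding k_def by (rule Least_le) (use that in blast)
      obtain d where d: "d \<in> carrier D" "int k \<odot>\<^bsub>D\<^esub> d = e0" using div[of "int k" e0] k Mc(2)[OF e0] by auto
      have "e = n \<odot>\<^bsub>D\<^esub> d" if ne: "(n \<odot>\<^bsub>W\<^esub> b, e) \<in> M" for n e
      proof -
        \<comment> \<open>Division with remainder: subtracting \<open>q\<close> times the pair at
          \<open>k b\<close> puts \<open>r b\<close> into the domain, and minimality of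
          \<open>k\<close> forces \<open>r = 0\<close>.\<close>
        define q where "q = n div int k"
        define r where "r = n mod int k"
        have n: "n = r + q * int k" by (simp add: q_def r_def)
        have r: "0 \<le> r" "r < int k" using k(1) by (simp_all add: r_def)
        have "(n \<odot>\<^bsub>W\<^esub> b \<oplus>\<^bsub>W\<^esub> (-q) \<odot>\<^bsub>W\<^esub> (int k \<odot>\<^bsub>W\<^esub> b), e \<oplus>\<^bsub>D\<^esub> (-q) \<odot>\<^bsub>D\<^esub> e0) \<in> M"
          by (intro Madd Msm ne e0)
        moreover have "n \<odot>\<^bsub>W\<^esub> b \<oplus>\<^bsub>W\<^esub> (-q) \<odot>\<^bsub>W\<^esub> (int k \<odot>\<^bsub>W\<^esub> b) = r \<odot>\<^bsub>W\<^esub> b"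
          using b n ZW(2)[of b n "-(q * int k)"] ZW(4)[of b "-q" "int k"] by simp
        ultimately have "(int (nat r) \<odot>\<^bsub>W\<^esub> b, e \<oplus>\<^bsub>D\<^esub> (-q) \<odot>\<^bsub>D\<^esub> e0) \<in> M" using r(1) by simp
        then have "r = 0" using kmin[of "nat r"] r by force
        then have nn: "n = q * int k" using n by simp
        have "(n \<odot>\<^bsub>W\<^esub> b, q \<odot>\<^bsub>D\<^esub> e0) \<in> M" using Msm[OF e0, of q] b ZW(4)[of b q "int k"] nn by simp
        then have "e \<oplus>\<^bsub>D\<^esub> \<ominus>\<^bsub>D\<^esub> (q \<odot>\<^bsub>D\<^esub> e0) = \<zero>\<^bsub>D\<^esub>" using Mz M0[OF ne] by blast
        then have "e = q \<odot>\<^bsub>D\<^esub> e0"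
          using minus_eq_zeroD[OF gD Mc(2)[OF ne] ZD(1)[OF Mc(2)[OF e0]], of q] by (simp add: a_minus_def)
        then show ?thesis using nn d ZD(4)[of d q "int k"] by simp
      qed
      then show ?thesis using d(1) by blast
    next
      case False
      \<comment> \<open>Only \<open>n = 0\<close> puts \<open>n b\<close> into the domain, a
        negative \<open>n\<close> being excluded through \<open>- n\<close>, so zero is a consistent
        value.\<close>
      have "e = n \<odot>\<^bsub>D\<^esub> \<zero>\<^bsub>D\<^esub>" if ne: "(n \<odot>\<^bsub>W\<^esub> b, e) \<in> M" for n e
      proof -
        have "\<not> 0 < n" using False ne zero_less_imp_eq_int[of n] by blast
        moreover have "\<not> n < 0"
        proof
          assume "n < 0"
          moreover have "((- n) \<odot>\<^bsub>W\<^esub> b, (-1) \<odot>\<^bsub>D\<^esub> e) \<in> M" using Msm[OF ne, of "-1"] ZW(4)[of b "-1" n] b by simp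
          ultimately show False using False zero_less_imp_eq_int[of "- n"] neg_0_less_iff_less by metis
        qed
        ultimately have "n = 0" by simp
        then show ?thesis using ne Mz[of e] zero_smult[OF W b] smult_zero[OF D, of n] by simp
      qed
      then show ?thesis using gD by (intro bexI[of _ "\<zero>\<^bsub>D\<^esub>"]) (simp_all add: ag_closed)
    qed
    then obtain d where d: "d \<in> carrier D" "\<And>n e. (n \<odot>\<^bsub>W\<^esub> b, e) \<in> M \<Longrightarrow> e = n \<odot>\<^bsub>D\<^esub> d" by blast
    \<comment> \<open>The subgroup generated by \<open>M\<close> and \<open>(b, d)\<close>. Once it
      is known to be in \<open>\<G>\<close>, maximality makes it equal to \<open>M\<close>, so
      \<open>b\<close> was in the domain already.\<close>
    let ?G = "{(x \<oplus>\<^bsub>W\<^esub> n \<odot>\<^bsub>W\<^esub> b, y \<oplus>\<^bsub>D\<^esub> n \<odot>\<^bsub>D\<^esub> d) | x y n. (x, y) \<in> M}"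
    have mem: "(x \<oplus>\<^bsub>W\<^esub> n \<odot>\<^bsub>W\<^esub> b, y \<oplus>\<^bsub>D\<^esub> n \<odot>\<^bsub>D\<^esub> d) \<in> ?G" if "(x, y) \<in> M" for x y n using that by blast
    have MG: "(x, y) \<in> ?G" if "(x, y) \<in> M" for x y
      using mem[OF that, of 0] Mc[OF that] zero_smult[OF W b] zero_smult[OF D d(1)] gW gD by (simp add: ag)
    have "submod \<Z> ?P ?G" unfolding submod_def
    proof (intro conjI ballI)
      show "?G \<subseteq> carrier ?P" using Mc b d(1) gW gD ZW(1) ZD(1) by (auto simp: ag_closed)
      show "\<zero>\<^bsub>?P\<^esub> \<in> ?G" using MG[OF Mzero] by simp
      fix p q assume "p \<in> ?G" "q \<in> ?G"
      then obtain x y n x' y' n' where pq: "(x, y) \<in> M" "(x', y') \<in> M"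
        "p = (x \<oplus>\<^bsub>W\<^esub> n \<odot>\<^bsub>W\<^esub> b, y \<oplus>\<^bsub>D\<^esub> n \<odot>\<^bsub>D\<^esub> d)" "q = (x' \<oplus>\<^bsub>W\<^esub> n' \<odot>\<^bsub>W\<^esub> b, y' \<oplus>\<^bsub>D\<^esub> n' \<odot>\<^bsub>D\<^esub> d)" by blast
      have "p \<oplus>\<^bsub>?P\<^esub> q = (x \<oplus>\<^bsub>W\<^esub> x' \<oplus>\<^bsub>W\<^esub> (n + n') \<odot>\<^bsub>W\<^esub> b, y \<oplus>\<^bsub>D\<^esub> y' \<oplus>\<^bsub>D\<^esub> (n + n') \<odot>\<^bsub>D\<^esub> d)"
        using pq Mc[OF pq(1)] Mc[OF pq(2)] b d(1) gW gD ZW(1,2) ZD(1,2) by (simp add: ag)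
      then show "p \<oplus>\<^bsub>?P\<^esub> q \<in> ?G" using mem[OF Madd[OF pq(1,2)], of "n + n'"] by simp
    next
      fix k p assume "k \<in> carrier \<Z>" "p \<in> ?G"
      then obtain x y n where p: "(x, y) \<in> M" "p = (x \<oplus>\<^bsub>W\<^esub> n \<odot>\<^bsub>W\<^esub> b, y \<oplus>\<^bsub>D\<^esub> n \<odot>\<^bsub>D\<^esub> d)" by blast
      have "k \<odot>\<^bsub>?P\<^esub> p = (k \<odot>\<^bsub>W\<^esub> x \<oplus>\<^bsub>W\<^esub> (k * n) \<odot>\<^bsub>W\<^esub> b, k \<odot>\<^bsub>D\<^esub> y \<oplus>\<^bsub>D\<^esub> (k * n) \<odot>\<^bsub>D\<^esub> d)"
        using p Mc[OF p(1)] b d(1) ZW(1,3,4) ZD(1,3,4) by simp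
      then show "k \<odot>\<^bsub>?P\<^esub> p \<in> ?G" using mem[OF Msm[OF p(1)], of k "k * n"] by simp
    qed
    moreover have "y = \<zero>\<^bsub>D\<^esub>" if 0: "(\<zero>\<^bsub>W\<^esub>, y) \<in> ?G" for y
    proof -
      \<comment> \<open>From \<open>x' + n b = 0\<close> it follows that \<open>n b = - x'\<close>
        is in the domain with value \<open>- y'\<close>; consistency of \<open>d\<close> gives
        \<open>n d = - y'\<close>.\<close>
      obtain x' y' n where p: "(x', y') \<in> M" "\<zero>\<^bsub>W\<^esub> = x' \<oplus>\<^bsub>W\<^esub> n \<odot>\<^bsub>W\<^esub> b" "y = y' \<oplus>\<^bsub>D\<^esub> n \<odot>\<^bsub>D\<^esub> d" using 0 by blast
      have c: "x' \<in> carrier W" "y' \<in> carrier D" using Mc p(1) by blast+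
      have "\<ominus>\<^bsub>W\<^esub> x' = \<ominus>\<^bsub>W\<^esub> x' \<oplus>\<^bsub>W\<^esub> (x' \<oplus>\<^bsub>W\<^esub> n \<odot>\<^bsub>W\<^esub> b)" using p(2)[symmetric] c gW by (simp add: ag)
      also have "\<dots> = n \<odot>\<^bsub>W\<^esub> b" using c b ZW(1) by (simp add: abelian_group.r_neg1[OF gW])
      finally have "\<ominus>\<^bsub>W\<^esub> x' = n \<odot>\<^bsub>W\<^esub> b" .
      then have "(n \<odot>\<^bsub>W\<^esub> b, \<ominus>\<^bsub>D\<^esub> y') \<in> M"
        using Msm[OF p(1), of "-1"] int_minus_one_smult[OF W c(1)] int_minus_one_smult[OF D c(2)] by simp
      then have "n \<odot>\<^bsub>D\<^esub> d = \<ominus>\<^bsub>D\<^esub> y'" using d(2) by simp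
      then show ?thesis using p(3) c gD by (simp add: ag)
    qed
    ultimately have "?G \<in> \<G>" using MG Mf unfolding \<G>_def by blast
    then have "?G = M" by (rule max) (use MG in auto)
    moreover have "(b, d) \<in> ?G"
      using mem[OF Mzero, of 1] b d(1) gW gD ZW(5) ZD(5) by (simp add: ag_zero)
    ultimately show ?thesis using d(1) by blast
  qed
  have "\<exists>g. lin \<Z> W D g \<and> (\<forall>x\<in>carrier W. \<forall>y\<in>carrier D. ((x, y) \<in> M) = (y = g x))"
    by (rule lin_of_relation[OF W D]) (use tot Madd Msm Mz in auto)
  then obtain g where g: "lin \<Z> W D g" "\<forall>x\<in>carrier W. \<forall>y\<in>carrier D. ((x, y) \<in> M) = (y = g x)"
    by (elim exE conjE)
  have "g x = f x" if "x \<in> S" for x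
    using g(2)[rule_format, of x "f x"] Mf[OF that] S'(1) F(1)[OF that] that by auto
  then show ?thesis using g(1) by blast
qed

section \<open>Embedding an abelian group in a divisible one\<close>

definition int_module :: "('r, 'm) module \<Rightarrow> (int, 'm) module" where
  "int_module M = \<lparr>carrier = carrier M, monoid.mult = undefined, one = undefined,
     zero = \<zero>\<^bsub>M\<^esub>, add = (\<oplus>\<^bsub>M\<^esub>), smult = (\<lambda>k x. add_pow M k x)\<rparr>"

lemma int_module_simps [simp]:
  "carrier (int_module M) = carrier M" "\<zero>\<^bsub>int_module M\<^esub> = \<zero>\<^bsub>M\<^esub>"
  "x \<oplus>\<^bsub>int_module M\<^esub> y = x \<oplus>\<^bsub>M\<^esub> y" "k \<odot>\<^bsub>int_module M\<^esub> x = add_pow M k x"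
  by (simp_all add: int_module_def)

lemma left_module_int:
  assumes "abelian_group M" shows "left_module \<Z> (int_module M)"
proof -
  interpret abelian_group M by fact
  show ?thesis
  proof (rule left_moduleI)
    show "ring \<Z>" by (rule cring.axioms(1)[OF int_is_cring])
    fix x assume "x \<in> carrier (int_module M)"
    then show "\<exists>y\<in>carrier (int_module M). y \<oplus>\<^bsub>int_module M\<^esub> x = \<zero>\<^bsub>int_module M\<^esub>"
      by (intro bexI[of _ "\<ominus>\<^bsub>M\<^esub> x"]) (simp_all add: l_neg)
  qed (simp_all add: a_ac add.int_pow_mult add.int_pow_distrib add.int_pow_pow mult.commute)
qed

definition rat_module :: "'x set \<Rightarrow> (int, 'x \<Rightarrow> rat) module" where
  "rat_module X = \<lparr>carrier = fin_supp X UNIV 0, monoid.mult = undefined, one = undefined,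
     zero = (\<lambda>x. 0), add = (\<lambda>\<phi> \<psi> x. \<phi> x + \<psi> x), smult = (\<lambda>k \<phi> x. of_int k * \<phi> x)\<rparr>"

lemma rat_module_simps [simp]:
  "carrier (rat_module X) = fin_supp X UNIV 0" "\<zero>\<^bsub>rat_module X\<^esub> = (\<lambda>x. 0)"
  "\<phi> \<oplus>\<^bsub>rat_module X\<^esub> \<psi> = (\<lambda>x. \<phi> x + \<psi> x)" "k \<odot>\<^bsub>rat_module X\<^esub> \<phi> = (\<lambda>x. of_int k * \<phi> x)"
  by (simp_all add: rat_module_def)

lemma fin_supp_map2:
  assumes "\<phi> \<in> fin_supp X UNIV z" "\<psi> \<in> fin_supp X UNIV z" "h z z = z"
  shows "(\<lambda>x. h (\<phi> x) (\<psi> x)) \<in> fin_supp X UNIV z"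
proof -
  have "finite {x. h (\<phi> x) (\<psi> x) \<noteq> z}"
    by (rule finite_subset[of _ "{x. \<phi> x \<noteq> z} \<union> {x. \<psi> x \<noteq> z}"]) (use assms in \<open>auto simp: fin_supp_def\<close>)
  then show ?thesis using assms by (simp add: fin_supp_def)
qed

lemma left_module_rat: "left_module \<Z> (rat_module X)"
proof (rule left_moduleI)
  show "ring \<Z>" by (rule cring.axioms(1)[OF int_is_cring])
  fix \<phi> assume p: "\<phi> \<in> carrier (rat_module X)"
  then show "\<exists>\<psi>\<in>carrier (rat_module X). \<psi> \<oplus>\<^bsub>rat_module X\<^esub> \<phi> = \<zero>\<^bsub>rat_module X\<^esub>"
    using fin_supp_map2[of \<phi> X 0 \<phi> "\<lambda>a b. - a"]
    by (intro bexI[of _ "\<lambda>x. - \<phi> x"]) simp_all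
  fix \<psi> assume "\<psi> \<in> carrier (rat_module X)"
  then show "\<phi> \<oplus>\<^bsub>rat_module X\<^esub> \<psi> \<in> carrier (rat_module X)"
    using fin_supp_map2[of \<phi> X 0 \<psi> "(+)"] p by simp
next
  fix k \<phi> assume "\<phi> \<in> carrier (rat_module X)"
  then show "k \<odot>\<^bsub>rat_module X\<^esub> \<phi> \<in> carrier (rat_module X)"
    using fin_supp_map2[of \<phi> X 0 \<phi> "\<lambda>a b. of_int k * a"] by simp
qed (simp_all add: fin_supp_def algebra_simps)

lemma rat_module_minus:
  assumes "\<psi> \<in> fin_supp X UNIV 0" shows "\<phi> \<ominus>\<^bsub>rat_module X\<^esub> \<psi> = (\<lambda>x. \<phi> x - \<psi> x)"
  using int_minus_one_smult[OF left_module_rat, of \<psi> X, symmetric] assms by (simp add: a_minus_def)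

text \<open>The divisible hull \<open>\<rat>\<^bsup>(M)\<^esup> / K\<close>, where \<open>K\<close> is the group of relations, that is the kernel
  of the canonical map \<open>\<int>\<^bsup>(M)\<^esup> \<rightarrow> M\<close>.\<close>

lemma divisible_embedding:
  fixes M :: "('r, 'm) module"
  assumes M: "abelian_group M"
  obtains D :: "(int, 'm \<Rightarrow> rat) module" and j where "left_module \<Z> D"
    "\<And>n y. 0 < n \<Longrightarrow> y \<in> carrier D \<Longrightarrow> \<exists>z\<in>carrier D. n \<odot>\<^bsub>D\<^esub> z = y"
    "carrier D \<subseteq> fin_supp (carrier M) UNIV 0"
    "\<And>x. x \<in> carrier M \<Longrightarrow> j x \<in> carrier D"
    "\<And>x y. x \<in> carrier M \<Longrightarrow> y \<in> carrier M \<Longrightarrow> j (x \<oplus>\<^bsub>M\<^esub> y) = j x \<oplus>\<^bsub>D\<^esub> j y"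
    "\<And>x. x \<in> carrier M \<Longrightarrow> j x = \<zero>\<^bsub>D\<^esub> \<Longrightarrow> x = \<zero>\<^bsub>M\<^esub>"
proof -
  interpret M: abelian_group M by fact
  let ?F = "rat_module (carrier M)"
  \<comment> \<open>The floor matters at integral coefficients only, where it returns the integer;
    elsewhere it merely makes \<open>act\<close> total. It is not additive on the rationals, hence
    the integrality conditions in \<open>s_add\<close>.\<close>
  define act :: "rat \<Rightarrow> 'm \<Rightarrow> 'm" where "act q x = (if x \<in> carrier M then add_pow M \<lfloor>q\<rfloor> x else \<zero>\<^bsub>M\<^esub>)" for q x
  let ?s = "supp_sum M 0 act"
  have closed: "act q x \<in> carrier M" for q x by (simp add: act_def)
  have zero: "act 0 x = \<zero>\<^bsub>M\<^esub>" for x by (simp add: act_def add_pow_def)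
  have fin: "finite {x. \<phi> x \<noteq> 0}" if "\<phi> \<in> fin_supp (carrier M) UNIV 0" for \<phi> :: "'m \<Rightarrow> rat"
    using that by (simp add: fin_supp_def)
  have sc: "?s \<phi> \<in> carrier M" for \<phi> by (rule supp_sum_closed[OF M]) (rule closed)
  have s0: "?s (\<lambda>x. 0) = \<zero>\<^bsub>M\<^esub>" by (simp add: supp_sum_def)
  have s_add: "?s (\<lambda>x. \<phi> x + \<psi> x) = ?s \<phi> \<oplus>\<^bsub>M\<^esub> ?s \<psi>"
    if "\<phi> \<in> fin_supp (carrier M) UNIV 0" "\<psi> \<in> fin_supp (carrier M) UNIV 0" "\<And>x. \<phi> x \<in> \<int>" "\<And>x. \<psi> x \<in> \<int>" for \<phi> \<psi>
  proof (rule supp_sum_add[OF M fin[OF that(1)] fin[OF that(2)]])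
    fix x
    have "\<phi> x \<in> \<int>" "\<psi> x \<in> \<int>" using that(3,4) by blast+
    then obtain a b where "\<phi> x = of_int a" "\<psi> x = of_int b" by (meson Ints_cases)
    then show "act (\<phi> x + \<psi> x) x = act (\<phi> x) x \<oplus>\<^bsub>M\<^esub> act (\<psi> x) x"
      by (simp add: act_def M.add.int_pow_mult)
  qed (simp_all add: closed zero)
  define K where "K = {\<phi> \<in> carrier ?F. (\<forall>x. \<phi> x \<in> \<int>) \<and> ?s \<phi> = \<zero>\<^bsub>M\<^esub>}"
  have K: "submod \<Z> ?F K"
  proof (rule int_submodI[OF left_module_rat])
    show "K \<subseteq> carrier ?F" by (auto simp: K_def)
    show "\<zero>\<^bsub>?F\<^esub> \<in> K" by (simp add: K_def s0 fin_supp_def)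
    fix \<phi> assume p: "\<phi> \<in> K"
    then have n: "(\<lambda>x. - \<phi> x) \<in> fin_supp (carrier M) UNIV 0"
      using fin_supp_map2[of \<phi> _ 0 \<phi> "\<lambda>a b. - a"] by (simp add: K_def)
    have pK: "\<phi> \<in> fin_supp (carrier M) UNIV 0" "\<And>x. \<phi> x \<in> \<int>" "?s \<phi> = \<zero>\<^bsub>M\<^esub>"
      using p by (simp_all add: K_def)
    have "?s (\<lambda>x. \<phi> x + - \<phi> x) = ?s \<phi> \<oplus>\<^bsub>M\<^esub> ?s (\<lambda>x. - \<phi> x)"
      by (rule s_add[OF pK(1) n pK(2)]) (simp add: pK(2))
    then have sn: "?s (\<lambda>x. - \<phi> x) = \<zero>\<^bsub>M\<^esub>" using s0 pK(3) sc by simp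
    then show "\<ominus>\<^bsub>?F\<^esub> \<phi> \<in> K"
      using int_minus_one_smult[OF left_module_rat, of \<phi> "carrier M", symmetric] pK n sn by (simp add: K_def)
    fix \<psi> assume "\<psi> \<in> K"
    then have qK: "\<psi> \<in> fin_supp (carrier M) UNIV 0" "\<And>x. \<psi> x \<in> \<int>" "?s \<psi> = \<zero>\<^bsub>M\<^esub>"
      by (simp_all add: K_def)
    have "?s (\<lambda>x. \<phi> x + \<psi> x) = \<zero>\<^bsub>M\<^esub>" using s_add[OF pK(1) qK(1) pK(2) qK(2)] pK(3) qK(3) by simp
    then show "\<phi> \<oplus>\<^bsub>?F\<^esub> \<psi> \<in> K"
      using pK(2) qK(2) fin_supp_map2[OF pK(1) qK(1), of "(+)"] by (simp add: K_def)
  qed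
  let ?D = "quot ?F K"
  let ?c = "coset_rep ?F K"
  note q = lin_coset_rep[OF left_module_rat K]
  define \<delta> :: "'m \<Rightarrow> 'm \<Rightarrow> rat" where "\<delta> x = (\<lambda>y. if y = x then 1 else 0)" for x
  have \<delta>: "\<delta> x \<in> fin_supp (carrier M) UNIV 0" if "x \<in> carrier M" for x
    using that by (auto simp: \<delta>_def fin_supp_def)
  have \<delta>Z: "\<delta> x y \<in> \<int>" for x y by (simp add: \<delta>_def)
  have s\<delta>: "?s (\<delta> x) = x" if "x \<in> carrier M" for x
  proof -
    have "?s (\<delta> x) = finsum M (\<lambda>y. act (\<delta> x y) y) {x}"
      by (rule supp_sum_superset[OF M]) (use closed zero in \<open>auto simp: \<delta>_def\<close>)
    then show ?thesis using that by (simp add: act_def \<delta>_def)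
  qed
  \<comment> \<open>The basis vector \<open>\<delta> x\<close> is integral with sum
    \<open>x\<close>, so it lies in \<open>K\<close> only for \<open>x = 0\<close>: the embedding is
    injective.\<close>
  have K\<delta>: "?c (\<delta> x) = \<zero>\<^bsub>?D\<^esub> \<longleftrightarrow> x = \<zero>\<^bsub>M\<^esub>" if "x \<in> carrier M" for x
    using coset_rep_zero_iff[OF left_module_rat K, of "\<delta> x"] \<delta>[OF that] s\<delta>[OF that] \<delta>Z by (simp add: K_def)
  have add: "?c (\<delta> (x \<oplus>\<^bsub>M\<^esub> y)) = ?c (\<delta> x) \<oplus>\<^bsub>?D\<^esub> ?c (\<delta> y)" if xy: "x \<in> carrier M" "y \<in> carrier M" for x y
  proof -
    let ?p = "\<lambda>z. \<delta> x z + \<delta> y z"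
    \<comment> \<open>The relation \<open>[x + y] - [x] - [y]\<close> is integral with sum zero and
      hence lies in \<open>K\<close>; this makes the embedding additive.\<close>
    let ?r = "\<lambda>z. \<delta> (x \<oplus>\<^bsub>M\<^esub> y) z - ?p z"
    have p: "?p \<in> fin_supp (carrier M) UNIV 0"
      using fin_supp_map2[OF \<delta>[OF xy(1)] \<delta>[OF xy(2)], of "(+)"] by simp
    have r: "?r \<in> fin_supp (carrier M) UNIV 0"
      using fin_supp_map2[OF \<delta>[of "x \<oplus>\<^bsub>M\<^esub> y"] p, of "(-)"] xy by simp
    have "?s (\<lambda>z. ?r z + ?p z) = ?s ?r \<oplus>\<^bsub>M\<^esub> ?s ?p" by (rule s_add[OF r p]) (use \<delta>Z in auto)
    moreover have "?s ?p = x \<oplus>\<^bsub>M\<^esub> y" using s_add[OF \<delta> \<delta> \<delta>Z \<delta>Z, OF xy] s\<delta> xy by simp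
    ultimately have "x \<oplus>\<^bsub>M\<^esub> y = ?s ?r \<oplus>\<^bsub>M\<^esub> (x \<oplus>\<^bsub>M\<^esub> y)" using s\<delta> xy by simp
    then have "?s ?r = \<zero>\<^bsub>M\<^esub>" using sc xy by (metis M.a_closed M.add.r_cancel_one')
    then have "?r \<in> K" using r \<delta>Z by (simp add: K_def)
    then have "?c (\<delta> (x \<oplus>\<^bsub>M\<^esub> y)) = ?c ?p"
      using coset_rep_eq_iff[OF left_module_rat K, of "\<delta> (x \<oplus>\<^bsub>M\<^esub> y)" ?p] \<delta> p xy
      by (simp add: rat_module_minus)
    then show ?thesis using linD(2)[OF q, of "\<delta> x" "\<delta> y"] \<delta> xy by simp
  qed
  have div: "\<exists>z\<in>carrier ?D. n \<odot>\<^bsub>?D\<^esub> z = y" if n: "0 < n" and y: "y \<in> carrier ?D" for n y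
  proof -
    obtain \<phi> where p: "\<phi> \<in> carrier ?F" "y = ?c \<phi>"
      using y coset_rep_onto[OF left_module_rat K] by blast
    let ?z = "\<lambda>x. \<phi> x / of_int n"
    have z: "?z \<in> carrier ?F" using fin_supp_map2[of \<phi> _ 0 \<phi> "\<lambda>a b. a / of_int n"] p by simp
    have "n \<odot>\<^bsub>?D\<^esub> ?c ?z = y" using linD(3)[OF q, of n ?z] z n p by simp
    then show ?thesis using linD(1)[OF q z] by blast
  qed
  show ?thesis
    by (rule that[of ?D "\<lambda>x. ?c (\<delta> x)"])
      (use lin_cod[OF q] div carrier_quot[OF left_module_rat K] linD(1)[OF q] \<delta> add K\<delta> in auto)
qed

text \<open>The test module \<open>W\<close> ranges over all modules on the carrier type, with no
  bound on its size; the extension from submodules by Zorn's lemma works for each of them.\<close>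

definition injective_module :: "('r, 'a) ring_scheme \<Rightarrow> ('r, 'm) module \<Rightarrow> bool" where
  "injective_module R F \<longleftrightarrow> left_module R F \<and>
     (\<forall>(W :: ('r, 'm) module) S f. left_module R W \<longrightarrow> submod R W S \<longrightarrow> lin R (W\<lparr>carrier := S\<rparr>) F f \<longrightarrow>
        (\<exists>g. lin R W F g \<and> (\<forall>x\<in>S. g x = f x)))"

text \<open>The coinduced module \<open>Hom_Z(R, D)\<close>. Multiplying the argument by
  \<open>s\<close> on the right yields a left action, since
  \<open>(s (t f)) r = f (r s t)\<close>.\<close>

definition char_module :: "('r, 'a) ring_scheme \<Rightarrow> (int, 'd) module \<Rightarrow> ('r, 'r \<Rightarrow> 'd) module" where
  "char_module R D = \<lparr>carrier = {f \<in> carrier R \<rightarrow>\<^sub>E carrier D. \<forall>a\<in>carrier R. \<forall>b\<in>carrier R. f (a \<oplus>\<^bsub>R\<^esub> b) = f a \<oplus>\<^bsub>D\<^esub> f b},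
     monoid.mult = undefined, one = undefined, zero = (\<lambda>r\<in>carrier R. \<zero>\<^bsub>D\<^esub>),
     add = (\<lambda>f g. \<lambda>r\<in>carrier R. f r \<oplus>\<^bsub>D\<^esub> g r), smult = (\<lambda>s f. \<lambda>r\<in>carrier R. f (r \<otimes>\<^bsub>R\<^esub> s))\<rparr>"

lemma char_module_simps [simp]:
  "f \<in> carrier (char_module R D) \<longleftrightarrow> (\<forall>a\<in>carrier R. f a \<in> carrier D) \<and> f \<in> extensional (carrier R) \<and>
    (\<forall>a\<in>carrier R. \<forall>b\<in>carrier R. f (a \<oplus>\<^bsub>R\<^esub> b) = f a \<oplus>\<^bsub>D\<^esub> f b)"
  "\<zero>\<^bsub>char_module R D\<^esub> = (\<lambda>r\<in>carrier R. \<zero>\<^bsub>D\<^esub>)"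
  "f \<oplus>\<^bsub>char_module R D\<^esub> g = (\<lambda>r\<in>carrier R. f r \<oplus>\<^bsub>D\<^esub> g r)"
  "s \<odot>\<^bsub>char_module R D\<^esub> f = (\<lambda>r\<in>carrier R. f (r \<otimes>\<^bsub>R\<^esub> s))"
  by (auto simp: char_module_def PiE_def Pi_def)

lemma left_module_char:
  assumes R: "ring R" and D: "abelian_group D" shows "left_module R (char_module R D)"
proof -
  interpret R: ring R by fact
  interpret D: abelian_group D by fact
  have ext: "f = g" if "f \<in> extensional (carrier R)" "g \<in> extensional (carrier R)"
    "\<And>r. r \<in> carrier R \<Longrightarrow> f r = g r" for f g :: "_ \<Rightarrow> _"
    using extensionalityI that by blast
  show ?thesis
  proof (rule left_moduleI[OF R])
    fix f assume f: "f \<in> carrier (char_module R D)"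
    then show "\<exists>g\<in>carrier (char_module R D). g \<oplus>\<^bsub>char_module R D\<^esub> f = \<zero>\<^bsub>char_module R D\<^esub>"
      by (intro bexI[of _ "\<lambda>r\<in>carrier R. \<ominus>\<^bsub>D\<^esub> f r"])
        (auto simp: D.l_neg D.minus_add D.a_comm D.r_neg intro!: restrict_ext)
    show "\<zero>\<^bsub>char_module R D\<^esub> \<oplus>\<^bsub>char_module R D\<^esub> f = f" "\<one>\<^bsub>R\<^esub> \<odot>\<^bsub>char_module R D\<^esub> f = f"
      using f by (auto intro!: ext)
    fix g assume g: "g \<in> carrier (char_module R D)"
    show "f \<oplus>\<^bsub>char_module R D\<^esub> g \<in> carrier (char_module R D)" using f g by (simp add: D.a_ac)
    show "f \<oplus>\<^bsub>char_module R D\<^esub> g = g \<oplus>\<^bsub>char_module R D\<^esub> f" using f g by (auto simp: D.a_comm intro!: restrict_ext)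
    fix h assume h: "h \<in> carrier (char_module R D)"
    show "f \<oplus>\<^bsub>char_module R D\<^esub> g \<oplus>\<^bsub>char_module R D\<^esub> h = f \<oplus>\<^bsub>char_module R D\<^esub> (g \<oplus>\<^bsub>char_module R D\<^esub> h)"
      using f g h by (auto simp: D.a_assoc intro!: restrict_ext)
  next
    fix s f assume s: "s \<in> carrier R" and f: "f \<in> carrier (char_module R D)"
    show "s \<odot>\<^bsub>char_module R D\<^esub> f \<in> carrier (char_module R D)" using s f by (simp add: R.l_distr)
    fix t assume t: "t \<in> carrier R"
    show "(s \<oplus>\<^bsub>R\<^esub> t) \<odot>\<^bsub>char_module R D\<^esub> f = s \<odot>\<^bsub>char_module R D\<^esub> f \<oplus>\<^bsub>char_module R D\<^esub> t \<odot>\<^bsub>char_module R D\<^esub> f"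
      using s t f by (auto simp: R.r_distr intro!: restrict_ext)
    show "(s \<otimes>\<^bsub>R\<^esub> t) \<odot>\<^bsub>char_module R D\<^esub> f = s \<odot>\<^bsub>char_module R D\<^esub> (t \<odot>\<^bsub>char_module R D\<^esub> f)"
      using s t f by (auto simp: R.m_assoc intro!: restrict_ext)
  next
    fix s f g assume "s \<in> carrier R" "f \<in> carrier (char_module R D)" "g \<in> carrier (char_module R D)"
    then show "s \<odot>\<^bsub>char_module R D\<^esub> (f \<oplus>\<^bsub>char_module R D\<^esub> g) = s \<odot>\<^bsub>char_module R D\<^esub> f \<oplus>\<^bsub>char_module R D\<^esub> s \<odot>\<^bsub>char_module R D\<^esub> g"
      by (auto intro!: restrict_ext)
  qed simp
qed

text \<open>The adjunction between restriction to \<open>\<int>\<close> and coinduction.\<close>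

lemma char_module_extend:
  assumes R: "ring R" and D: "left_module \<Z> D"
    and div: "\<And>n y. 0 < n \<Longrightarrow> y \<in> carrier D \<Longrightarrow> \<exists>z\<in>carrier D. n \<odot>\<^bsub>D\<^esub> z = y"
    and W: "left_module R W" and S: "submod R W S" and f: "lin R (W\<lparr>carrier := S\<rparr>) (char_module R D) f"
  shows "\<exists>g. lin R W (char_module R D) g \<and> (\<forall>x\<in>S. g x = f x)"
proof -
  interpret R: ring R by fact
  note gW = left_module_group[OF W] and gD = left_module_group[OF D]
  note Z = left_module_int[OF gW]
  note F = linD[OF f, simplified]
  have S': "S \<subseteq> carrier W" using S by (simp add: submod_def)
  have SZ: "submod \<Z> (int_module W) S"
  proof (rule int_submodI[OF Z])
    fix x assume x: "x \<in> S"
    moreover have "\<ominus>\<^bsub>int_module W\<^esub> x = \<ominus>\<^bsub>W\<^esub> x" by (simp add: a_inv_def m_inv_def)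
    ultimately show "\<ominus>\<^bsub>int_module W\<^esub> x \<in> S" using submod_minus[OF W S] by simp
  qed (use S in \<open>auto simp: submod_def\<close>)
  \<comment> \<open>Evaluation at \<open>1\<close> turns \<open>f\<close> into a map of abelian
    groups, which extends because \<open>D\<close> is divisible.\<close>
  have "lin \<Z> ((int_module W)\<lparr>carrier := S\<rparr>) D (\<lambda>x. f x \<one>\<^bsub>R\<^esub>)"
    by (rule int_linI[OF submod_left_module[OF Z SZ] D]) (use F(1,2) in auto)
  then obtain g where g: "lin \<Z> (int_module W) D g" "\<And>x. x \<in> S \<Longrightarrow> g x = f x \<one>\<^bsub>R\<^esub>"
    using divisible_extend[OF D div Z SZ] by blast
  note G = linD[OF g(1), simplified]
  let ?g = "\<lambda>w. \<lambda>r\<in>carrier R. g (r \<odot>\<^bsub>W\<^esub> w)"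
  have "lin R W (char_module R D) ?g"
    by (rule linI[OF W left_module_char[OF R gD]])
      (use G left_module_smult[OF W] in \<open>auto intro!: restrict_ext\<close>)
  moreover have "?g x = f x" if x: "x \<in> S" for x
  proof (rule extensionalityI[of _ "carrier R"])
    show "f x \<in> extensional (carrier R)" using F(1)[OF x] by simp
    \<comment> \<open>\<open>g (r x)\<close> is the value of \<open>f (r x)\<close> at
      \<open>1\<close>; by linearity this is \<open>(r f(x)) 1\<close>, which is \<open>f x\<close>
      at \<open>r\<close>.\<close>
    fix r assume r: "r \<in> carrier R"
    then have "r \<odot>\<^bsub>W\<^esub> x \<in> S" using S x by (simp add: submod_def)
    then show "?g x r = f x r" using r g(2) F(3)[OF r x] by simp
  qed simp
  ultimately show ?thesis by blast
qed

text \<open>\<open>M\<close> embeds additively by \<open>i\<close> into a divisible group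
  \<open>D\<close>. Sending \<open>x\<close> to the function with value \<open>i (r x)\<close> at
  \<open>r\<close> embeds \<open>M\<close> linearly into the coinduced module of \<open>D\<close>;
  evaluation at \<open>1\<close> shows injectivity.\<close>

lemma enough_injective_modules:
  fixes M :: "('r, 'm) module"
  assumes R: "ring R" and U: "module_universe R U" and M: "M \<in> Obj (Modules R U)"
  obtains F j where "F \<in> Obj (Modules R U)" "injective_module R F" "lin R M F j"
    "\<And>x. x \<in> carrier M \<Longrightarrow> j x = \<zero>\<^bsub>F\<^esub> \<Longrightarrow> x = \<zero>\<^bsub>M\<^esub>"
proof -
  interpret R: ring R by fact
  have mM: "left_module R M" using M by simp
  obtain D :: "(int, 'm \<Rightarrow> rat) module" and i where D: "left_module \<Z> D"
    "\<And>n y. 0 < n \<Longrightarrow> y \<in> carrier D \<Longrightarrow> \<exists>z\<in>carrier D. n \<odot>\<^bsub>D\<^esub> z = y"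
    "carrier D \<subseteq> fin_supp (carrier M) UNIV 0"
    and i: "\<And>x. x \<in> carrier M \<Longrightarrow> i x \<in> carrier D"
    "\<And>x y. x \<in> carrier M \<Longrightarrow> y \<in> carrier M \<Longrightarrow> i (x \<oplus>\<^bsub>M\<^esub> y) = i x \<oplus>\<^bsub>D\<^esub> i y"
    "\<And>x. x \<in> carrier M \<Longrightarrow> i x = \<zero>\<^bsub>D\<^esub> \<Longrightarrow> x = \<zero>\<^bsub>M\<^esub>"
    by (rule divisible_embedding[OF left_module_group[OF mM]]) blast
  let ?H = "char_module R D"
  note H = left_module_char[OF R left_module_group[OF D(1)]]
  \<comment> \<open>The rationals are countable, so finitely supported rational functions on
    \<open>M\<close> form a small set; functions from \<open>R\<close> to \<open>D\<close> are then
    covered by the last closure property of the universe.\<close>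
  have "small U (carrier D)"
    by (rule small_subset[OF small_fin_supp[OF U] D(3)])
      (use M small_countable[OF U countableI_type] in \<open>auto intro: small_mem\<close>)
  then have "small U (carrier ?H)"
    by (rule small_subset[OF small_funcset[OF U]]) (auto simp: PiE_def Pi_def)
  then obtain F \<phi> \<psi> where F: "F \<in> Obj (Modules R U)" "lin R ?H F \<phi>" "lin R F ?H \<psi>"
    "\<And>x. x \<in> carrier ?H \<Longrightarrow> \<psi> (\<phi> x) = x" "\<And>y. y \<in> carrier F \<Longrightarrow> \<phi> (\<psi> y) = y"
    using module_transport[OF U H] by metis
  have inj: "injective_module R F" unfolding injective_module_def
  proof (intro conjI allI impI)
    show "left_module R F" using F(1) by simp
    fix W :: "('r, 'm) module" and S f
    assume W: "left_module R W" "submod R W S" and f: "lin R (W\<lparr>carrier := S\<rparr>) F f"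
    obtain g where g: "lin R W ?H g" "\<And>x. x \<in> S \<Longrightarrow> g x = \<psi> (f x)"
      using char_module_extend[OF R D(1,2) W lin_comp[OF f F(3)]] by blast
    have "\<phi> (g x) = f x" if "x \<in> S" for x
      using g(2)[OF that] F(5) linD(1)[OF f] that by simp
    then show "\<exists>g. lin R W F g \<and> (\<forall>x\<in>S. g x = f x)" using lin_comp[OF g(1) F(2)] by blast
  qed
  let ?j = "\<lambda>x. \<lambda>r\<in>carrier R. i (r \<odot>\<^bsub>M\<^esub> x)"
  have j: "lin R M ?H ?j"
    by (rule linI[OF mM H]) (use i left_module_smult[OF mM] in \<open>auto intro!: restrict_ext\<close>)
  have "x = \<zero>\<^bsub>M\<^esub>" if x: "x \<in> carrier M" "\<phi> (?j x) = \<zero>\<^bsub>F\<^esub>" for x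
  proof -
    have "?j x = \<zero>\<^bsub>?H\<^esub>" using F(4)[OF linD(1)[OF j x(1)]] x(2) linD(4)[OF F(3)] by simp
    then have "i (\<one>\<^bsub>R\<^esub> \<odot>\<^bsub>M\<^esub> x) = \<zero>\<^bsub>D\<^esub>" by (metis (no_types, lifting) R.one_closed char_module_simps(2) restrict_apply')
    then show ?thesis using i(3) x left_module_smult(5)[OF mM] by simp
  qed
  then show ?thesis using that[OF F(1) inj lin_comp[OF j F(2)]] by blast
qed

section \<open>Projective resolutions and orthogonality\<close>

text \<open>Stated for an arbitrary \<open>abcat\<close> so as to serve modules and complexes alike.
  The condition \<open>incl\<close> reflects that kernel inclusions are identities on elements: an
  epimorphism onto a kernel is itself a morphism to the ambient object.\<close>

lemma projective_resolution_exists: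
  assumes enough: "\<And>X. X \<in> Obj \<A> \<Longrightarrow> \<exists>P e. projective \<A> P \<and> e \<in> Epi \<A> P X"
    and ker: "\<And>X Y f. X \<in> Obj \<A> \<Longrightarrow> Y \<in> Obj \<A> \<Longrightarrow> f \<in> carrier (Mor \<A> X Y) \<Longrightarrow> Ker \<A> X Y f \<in> Obj \<A>"
    and epi: "\<And>X Y e. X \<in> Obj \<A> \<Longrightarrow> Y \<in> Obj \<A> \<Longrightarrow> e \<in> Epi \<A> X Y \<Longrightarrow> e \<in> carrier (Mor \<A> X Y)"
    and incl: "\<And>X Y f P e. \<lbrakk>X \<in> Obj \<A>; Y \<in> Obj \<A>; P \<in> Obj \<A>; f \<in> carrier (Mor \<A> X Y);
      e \<in> Epi \<A> P (Ker \<A> X Y f)\<rbrakk> \<Longrightarrow> e \<in> carrier (Mor \<A> P X)"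
    and X: "X \<in> Obj \<A>"
  shows "\<exists>r. projective_resolution \<A> X r"
proof -
  have obj: "P \<in> Obj \<A>" if "projective \<A> P" for P using that by (simp add: projective_def)
  obtain P0 e where P0: "projective \<A> P0" "e \<in> Epi \<A> P0 X" using enough[OF X] by blast
  note e = epi[OF obj[OF P0(1)] X P0(2)]
  obtain P1 d0 where P1: "projective \<A> P1" "d0 \<in> Epi \<A> P1 (Ker \<A> P0 X e)"
    using enough[OF ker[OF obj[OF P0(1)] X e]] by blast
  \<comment> \<open>A state \<open>(Q, P, d)\<close> is the current differential \<open>d\<close>
    from \<open>Q\<close> to \<open>P\<close>; its successor covers \<open>ker d\<close> and ends in
    \<open>Q\<close>. The state of index \<open>0\<close> is pinned so that the resolution joins the
    augmentation \<open>e\<close>.\<close>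
  define good where "good = (\<lambda>(Q, P, d). projective \<A> Q \<and> projective \<A> P \<and> d \<in> carrier (Mor \<A> Q P))"
  define start where "start = (\<lambda>n s. good s \<and> (n = (0::nat) \<longrightarrow> s = (P1, P0, d0)))"
  define next_step where "next_step = (\<lambda>(Q, P, d) (Q', P', d'). P' = Q \<and> d' \<in> Epi \<A> Q' (Ker \<A> Q P d))"
  have "\<exists>s. \<forall>n. start n (s n) \<and> next_step (s n) (s (Suc n))"
  proof (rule dependent_nat_choice)
    show "\<exists>s. start 0 s"
      using P0 P1 incl[OF obj[OF P0(1)] X obj[OF P1(1)] e P1(2)] by (simp add: start_def good_def)
  next
    fix s and n :: nat
    assume "start n s"
    then obtain Q P d where s: "s = (Q, P, d)" "projective \<A> Q" "projective \<A> P" "d \<in> carrier (Mor \<A> Q P)"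
      by (auto simp: start_def good_def)
    note o = obj[OF s(2)] obj[OF s(3)]
    obtain Q' d' where Q': "projective \<A> Q'" "d' \<in> Epi \<A> Q' (Ker \<A> Q P d)"
      using enough[OF ker[OF o s(4)]] by blast
    show "\<exists>t. start (Suc n) t \<and> next_step s t"
      using Q' s incl[OF o obj[OF Q'(1)] s(4) Q'(2)]
      by (intro exI[of _ "(Q', Q, d')"]) (simp add: start_def good_def next_step_def)
  qed
  then obtain s where s: "\<And>n. start n (s n)" "\<And>n. next_step (s n) (s (Suc n))" by blast
  define P where "P n = fst (snd (s n))" for n
  define d where "d n = snd (snd (s n))" for n
  have sn: "s n = (P (Suc n), P n, d n)" for n
    using s(2)[of n] by (cases "s n"; cases "s (Suc n)") (auto simp: next_step_def P_def d_def)
  have zero: "P 1 = P1" "P 0 = P0" "d 0 = d0" using s(1)[of 0] sn[of 0] by (simp_all add: start_def)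
  have "projective \<A> (P n)" "d n \<in> carrier (Mor \<A> (P (Suc n)) (P n))" for n
    using s(1)[of n] sn[of n] by (simp_all add: start_def good_def)
  moreover have "d (Suc n) \<in> Epi \<A> (P (Suc (Suc n))) (Ker \<A> (P (Suc n)) (P n) (d n))" for n
    using s(2)[of n] by (simp add: sn next_step_def)
  ultimately have "projective_resolution \<A> X (P, d, e)"
    using P0 P1 zero by (simp add: projective_resolution_def)
  then show ?thesis by blast
qed

lemma chosen_resolution:
  assumes "\<exists>r. projective_resolution \<A> X r"
  obtains P d e where "chosen_resolution \<A> X = (P, d, e)" "projective_resolution \<A> X (P, d, e)"
proof -
  have "projective_resolution \<A> X (chosen_resolution \<A> X)"
    unfolding chosen_resolution_def using assms by (rule someI_ex)
  then show ?thesis using that by (metis prod_cases3)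
qed

section \<open>Kernels and resolutions of modules\<close>

lemma mod_ker_eq: "mod_ker M N f = M\<lparr>carrier := {x \<in> carrier M. f x = \<zero>\<^bsub>N\<^esub>}\<rparr>"
  by (simp add: mod_ker_def a_kernel_def')

lemma mod_ker_simps [simp]:
  "carrier (mod_ker M N f) = {x \<in> carrier M. f x = \<zero>\<^bsub>N\<^esub>}" "\<zero>\<^bsub>mod_ker M N f\<^esub> = \<zero>\<^bsub>M\<^esub>"
  "x \<oplus>\<^bsub>mod_ker M N f\<^esub> y = x \<oplus>\<^bsub>M\<^esub> y" "a \<odot>\<^bsub>mod_ker M N f\<^esub> x = a \<odot>\<^bsub>M\<^esub> x"
  by (simp_all add: mod_ker_eq)

lemma left_module_ker: "lin R M N f \<Longrightarrow> left_module R (mod_ker M N f)"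
  unfolding mod_ker_eq by (rule submod_left_module[OF lin_dom submod_ker])

lemma lin_ker_dom: "lin R M Y g \<Longrightarrow> lin R M N f \<Longrightarrow> lin R (mod_ker M N f) Y g"
  unfolding mod_ker_eq by (rule lin_restrict_dom[OF _ submod_ker])

lemma lin_ker_incl: "lin R M N f \<Longrightarrow> lin R (mod_ker M N f) M (\<lambda>x. x)"
  by (rule lin_ker_dom[OF lin_id[OF lin_dom]])

lemma lin_ker_cod:
  "lin R W M g \<Longrightarrow> lin R M N f \<Longrightarrow> (\<And>x. x \<in> carrier W \<Longrightarrow> f (g x) = \<zero>\<^bsub>N\<^esub>) \<Longrightarrow> lin R W (mod_ker M N f) g"
  unfolding mod_ker_eq by (rule lin_restrict_cod[OF _ submod_ker]) (auto simp: linD)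

lemma lin_ker_codD: "lin R W (mod_ker M N f) g \<Longrightarrow> lin R M N f \<Longrightarrow> lin R W M g"
  using lin_comp[OF _ lin_ker_incl] by metis

lemma universe_subset:
  assumes "module_universe R U" "A \<in> U" "B \<subseteq> A" shows "B \<in> U"
  using assms subset_imp_lepoll unfolding module_universe_def by blast

lemma Modules_ker:
  assumes "module_universe R U" "M \<in> Obj (Modules R U)" "lin R M N f"
  shows "mod_ker M N f \<in> Obj (Modules R U)"
  using assms left_module_ker[OF assms(3)] universe_subset[OF assms(1), of "carrier M"] by auto

lemma Epi_Modules_iff:
  assumes "left_module R M" "left_module R N"
  shows "e \<in> Epi (Modules R U) M N \<longleftrightarrow> lin R M N e \<and> e \<in> extensional (carrier M) \<and> e ` carrier M = carrier N"
  by (auto simp: Modules_def mod_hom_iff[OF assms])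

lemma Mor_Modules_iff:
  assumes "left_module R M" "left_module R N"
  shows "f \<in> carrier (Mor (Modules R U) M N) \<longleftrightarrow> lin R M N f \<and> f \<in> extensional (carrier M)"
  by (simp add: Modules_def mod_hom_group_def mod_hom_iff[OF assms])

lemma Modules_resolution_exists:
  assumes R: "ring R" and U: "module_universe R U" and X: "X \<in> Obj (Modules R U)"
  shows "\<exists>r. projective_resolution (Modules R U) X r"
proof (rule projective_resolution_exists[OF _ _ _ _ X])
  fix X assume X: "X \<in> Obj (Modules R U)"
  obtain P e where P: "projective (Modules R U) P" "lin R P X e" "e ` carrier P = carrier X"
    using enough_projective_modules[OF R U X] .
  have "restrict e (carrier P) \<in> Epi (Modules R U) P X"
    using restrict_mod_hom[OF P(2)] P(3) by (simp add: Modules_def)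
  then show "\<exists>P e. projective (Modules R U) P \<and> e \<in> Epi (Modules R U) P X" using P(1) by blast
next
  fix X Y :: "('a, 'c) module" and f
  assume h: "X \<in> Obj (Modules R U)" "Y \<in> Obj (Modules R U)" "f \<in> carrier (Mor (Modules R U) X Y)"
  then have f: "lin R X Y f" by (simp add: Mor_Modules_iff)
  then show "Ker (Modules R U) X Y f \<in> Obj (Modules R U)"
    using Modules_ker[OF U h(1)] by (simp add: Modules_def)
  fix P e assume "P \<in> Obj (Modules R U)" "e \<in> Epi (Modules R U) P (Ker (Modules R U) X Y f)"
  then have "lin R P (mod_ker X Y f) e" "e \<in> extensional (carrier P)" "left_module R P"
    using left_module_ker[OF f] by (auto simp: Modules_def mod_hom_iff)
  then show "e \<in> carrier (Mor (Modules R U) P X)"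
    using lin_ker_codD[OF _ f] h by (simp add: Mor_Modules_iff)
qed (auto simp: Modules_def mod_hom_group_def)

text \<open>\<open>Y\<close> is right orthogonal to \<open>L\<close>, expressed through extension of maps instead of \<open>Ext\<close>.\<close>

definition ext_orthogonal ::
  "('r, 'a) ring_scheme \<Rightarrow> 'm set set \<Rightarrow> ('r, 'm) module set \<Rightarrow> ('r, 'm) module \<Rightarrow> bool" where
  "ext_orthogonal R U L Y \<longleftrightarrow> left_module R Y \<and>
     (\<forall>X\<in>L. \<forall>W\<in>Obj (Modules R U). \<forall>q. lin R W X q \<longrightarrow> q ` carrier W = carrier X \<longrightarrow>
        (\<forall>f. lin R (mod_ker W X q) Y f \<longrightarrow>
           (\<exists>g. lin R W Y g \<and> (\<forall>w\<in>carrier W. q w = \<zero>\<^bsub>X\<^esub> \<longrightarrow> g w = f w))))"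

lemma ext_orthogonalD:
  assumes "ext_orthogonal R U L Y" "X \<in> L" "W \<in> Obj (Modules R U)" "lin R W X q"
    "q ` carrier W = carrier X" "lin R (mod_ker W X q) Y f"
  obtains g where "lin R W Y g" "\<And>w. w \<in> carrier W \<Longrightarrow> q w = \<zero>\<^bsub>X\<^esub> \<Longrightarrow> g w = f w"
  using assms unfolding ext_orthogonal_def by blast

lemma injective_ext_orthogonal:
  assumes "injective_module R F" shows "ext_orthogonal R U L F"
  unfolding ext_orthogonal_def
proof (intro conjI ballI allI impI)
  show "left_module R F" using assms by (simp add: injective_module_def)
  fix X W q f assume h: "W \<in> Obj (Modules R U)" "lin R W X q" "lin R (mod_ker W X q) F f"
  then have "\<exists>g. lin R W F g \<and> (\<forall>x\<in>{w \<in> carrier W. q w = \<zero>\<^bsub>X\<^esub>}. g x = f x)"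
    using assms submod_ker[OF h(2)] unfolding injective_module_def mod_ker_eq Obj_Modules by blast
  then show "\<exists>g. lin R W F g \<and> (\<forall>w\<in>carrier W. q w = \<zero>\<^bsub>X\<^esub> \<longrightarrow> g w = f w)" by blast
qed

text \<open>For \<open>f\<close> on \<open>ker e\<close>, the composite \<open>f \<circ> d 0\<close>
  is a cocycle on \<open>P 1\<close>. If Ext vanishes it is a coboundary
  \<open>g \<circ> d 0\<close>, and since \<open>d 0\<close> maps onto \<open>ker e\<close>, the map
  \<open>g\<close> extends \<open>f\<close>. This reaches only the presentation at the start of the
  chosen resolution.\<close>

lemma Ext1_trivial_imp_extension:
  assumes R: "ring R" and U: "module_universe R U"
    and X: "X \<in> Obj (Modules R U)" and Y: "Y \<in> Obj (Modules R U)"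
    and triv: "trivial_group (Ext1 (Modules R U) X Y)"
  obtains P e where "projective (Modules R U) P" "lin R P X e" "e ` carrier P = carrier X"
    "\<And>f. lin R (mod_ker P X e) Y f \<Longrightarrow> \<exists>g. lin R P Y g \<and> (\<forall>p\<in>carrier P. e p = \<zero>\<^bsub>X\<^esub> \<longrightarrow> g p = f p)"
proof -
  let ?A = "Modules R U"
  obtain P d e where ch: "chosen_resolution ?A X = (P, d, e)" and res: "projective_resolution ?A X (P, d, e)"
    using chosen_resolution[OF Modules_resolution_exists[OF R U X]] .
  have pr: "projective ?A (P n)" for n using res by (simp add: projective_resolution_def)
  then have mP: "left_module R (P n)" for n by (simp add: projective_def)
  have mX: "left_module R X" and mY: "left_module R Y" using X Y by auto
  have Ker: "Ker ?A = mod_ker" by (simp add: Modules_def)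
  have e: "lin R (P 0) X e" "e ` carrier (P 0) = carrier X"
    using res by (simp_all add: projective_resolution_def Epi_Modules_iff mP mX)
  have d0: "lin R (P 1) (mod_ker (P 0) X e) (d 0)" "d 0 ` carrier (P 1) = carrier (mod_ker (P 0) X e)"
    using res by (simp_all add: projective_resolution_def Epi_Modules_iff mP left_module_ker[OF e(1)] Ker)
  note d0' = lin_ker_codD[OF d0(1) e(1)]
  have "d 1 \<in> Epi ?A (P 2) (mod_ker (P 1) (P 0) (d 0))"
    using res unfolding projective_resolution_def prod.case Ker by (metis One_nat_def numeral_2_eq_2)
  then have d1: "lin R (P 2) (mod_ker (P 1) (P 0) (d 0)) (d 1)"
    using Epi_Modules_iff[OF mP left_module_ker[OF d0']] by blast
  let ?G = "Mor ?A (P 1) Y"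
  let ?Z = "kernel ?G (Mor ?A (P 2) Y) (\<lambda>f. Comp ?A (P 2) f (d 1))"
  let ?B = "(\<lambda>f. Comp ?A (P 1) f (d 0)) ` carrier (Mor ?A (P 0) Y)"
  have "trivial_group ((?G\<lparr>carrier := ?Z\<rparr>) Mod ?B)"
    using triv by (simp add: Ext1_def ch Let_def)
  \<comment> \<open>The quotient being trivial, every coset of a cocycle is \<open>?B\<close>; a
    cocycle lies in its own coset and so is a coboundary.\<close>
  then have cosets: "rcosets\<^bsub>?G\<lparr>carrier := ?Z\<rparr>\<^esub> ?B = {?B}"
    by (simp add: trivial_group_def FactGroup_def)
  have one: "\<one>\<^bsub>?G\<^esub> \<in> ?B"
  proof
    have "lin R (P 0) Y (\<lambda>x. \<zero>\<^bsub>Y\<^esub>)" by (rule lin_const_zero[OF mP mY])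
    then show "(\<lambda>x\<in>carrier (P 0). \<zero>\<^bsub>Y\<^esub>) \<in> carrier (Mor ?A (P 0) Y)"
      by (simp add: Modules_def mod_hom_group_def restrict_mod_hom)
    show "\<one>\<^bsub>?G\<^esub> = Comp ?A (P 1) (\<lambda>x\<in>carrier (P 0). \<zero>\<^bsub>Y\<^esub>) (d 0)"
      using linD(1)[OF d0'] by (auto simp: Modules_def mod_hom_group_def compose_def intro!: restrict_ext)
  qed
  have "\<exists>g. lin R (P 0) Y g \<and> (\<forall>p\<in>carrier (P 0). e p = \<zero>\<^bsub>X\<^esub> \<longrightarrow> g p = f p)"
    if f: "lin R (mod_ker (P 0) X e) Y f" for f
  proof -
    let ?z = "\<lambda>x\<in>carrier (P 1). f (d 0 x)"
    have z: "?z \<in> carrier ?G"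
      using restrict_mod_hom[OF lin_comp[OF d0(1) f]] by (simp add: Modules_def mod_hom_group_def)
    have "Comp ?A (P 2) ?z (d 1) = \<one>\<^bsub>Mor ?A (P 2) Y\<^esub>"
      using linD(1)[OF d1] linD(4)[OF f] by (auto simp: Modules_def mod_hom_group_def compose_def intro!: restrict_ext)
    then have zZ: "?z \<in> ?Z" using z by (simp add: kernel_def)
    have "?B #>\<^bsub>?G\<lparr>carrier := ?Z\<rparr>\<^esub> ?z \<in> rcosets\<^bsub>?G\<lparr>carrier := ?Z\<rparr>\<^esub> ?B"
      using zZ by (auto simp: RCOSETS_def)
    then have "?B #>\<^bsub>?G\<lparr>carrier := ?Z\<rparr>\<^esub> ?z = ?B" using cosets by simp
    moreover have "\<one>\<^bsub>?G\<^esub> \<otimes>\<^bsub>?G\<^esub> ?z = ?z"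
      using linD(1)[OF lin_comp[OF d0(1) f]] left_module_group[OF mY]
      by (auto simp: Modules_def mod_hom_group_def ag_zero intro!: restrict_ext)
    moreover have "\<one>\<^bsub>?G\<^esub> \<otimes>\<^bsub>?G\<^esub> ?z \<in> ?B #>\<^bsub>?G\<lparr>carrier := ?Z\<rparr>\<^esub> ?z"
      unfolding r_coset_def by (rule UN_I[OF one]) simp
    ultimately have "?z \<in> ?B" by (simp only:)
    then obtain g where g: "g \<in> carrier (Mor ?A (P 0) Y)" "?z = Comp ?A (P 1) g (d 0)" by blast
    have "g p = f p" if "p \<in> carrier (P 0)" "e p = \<zero>\<^bsub>X\<^esub>" for p
    proof -
      have "p \<in> d 0 ` carrier (P 1)" using d0(2) that by simp
      then obtain x where "x \<in> carrier (P 1)" "p = d 0 x" by blast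
      then show ?thesis using fun_cong[OF g(2), of x] by (simp add: Modules_def compose_def)
    qed
    then show ?thesis using g(1) by (auto simp: Mor_Modules_iff mP mY)
  qed
  then show ?thesis using that[OF pr e] by blast
qed

text \<open>The extension property spreads from one projective presentation \<open>e\<close> to
  every epimorphism \<open>q\<close>. If \<open>s\<close> lifts \<open>e\<close> along
  \<open>q\<close>, then \<open>W\<close> is the sum of \<open>ker q\<close> and the image of
  \<open>s\<close>; the extension is \<open>f\<close> on the former and is given by an extension
  \<open>u\<close> of \<open>f \<circ> s\<close> on the latter.\<close>

lemma Ext1_trivial_imp_ext_orthogonal:
  assumes R: "ring R" and U: "module_universe R U" and L: "L \<subseteq> Obj (Modules R U)"
    and Y: "Y \<in> Obj (Modules R U)"
    and triv: "\<And>X. X \<in> L \<Longrightarrow> trivial_group (Ext1 (Modules R U) X Y)"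
  shows "ext_orthogonal R U L Y"
  unfolding ext_orthogonal_def
proof (intro conjI ballI allI impI)
  show mY: "left_module R Y" using Y by simp
  fix X W q f
  assume X: "X \<in> L" and W: "W \<in> Obj (Modules R U)" and q: "lin R W X q" "q ` carrier W = carrier X"
    and f: "lin R (mod_ker W X q) Y f"
  have XO: "X \<in> Obj (Modules R U)" using X L by blast
  obtain P e where P: "projective (Modules R U) P" "lin R P X e" "e ` carrier P = carrier X"
    "\<And>f. lin R (mod_ker P X e) Y f \<Longrightarrow> \<exists>g. lin R P Y g \<and> (\<forall>p\<in>carrier P. e p = \<zero>\<^bsub>X\<^esub> \<longrightarrow> g p = f p)"
    by (rule Ext1_trivial_imp_extension[OF R U XO Y triv[OF X]]) blast
  obtain s where s: "lin R P W s" "\<And>p. p \<in> carrier P \<Longrightarrow> q (s p) = e p"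
    using P(1) XO W q P(2) unfolding projective_Modules_iff by blast
  have "lin R (mod_ker P X e) (mod_ker W X q) s"
    by (rule lin_ker_cod[OF lin_ker_dom[OF s(1) P(2)] q(1)]) (simp add: s(2))
  from P(4)[OF lin_comp[OF this f]] obtain u where
    u: "lin R P Y u" "\<And>p. p \<in> carrier P \<Longrightarrow> e p = \<zero>\<^bsub>X\<^esub> \<Longrightarrow> u p = f (s p)" by blast
  have mW: "left_module R W" and mP: "left_module R P" using W P(1) by (auto simp: projective_def)
  note g = left_module_group[OF mW] left_module_group[OF mP] left_module_group[OF mY] lin_cod_group[OF q(1)]
  note F = linD[OF f, simplified]
  define k where "k w p = w \<ominus>\<^bsub>W\<^esub> s p" for w p
  have k: "k w p \<in> carrier W" "q (k w p) = \<zero>\<^bsub>X\<^esub>" if "w \<in> carrier W" "p \<in> carrier P" "e p = q w" for w p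
    using that g s linD[OF s(1)] linD[OF q(1)] linD[OF P(2)] by (simp_all add: k_def ag a_minus_def)
  \<comment> \<open>Two choices of \<open>p\<close> over the same \<open>w\<close> differ by an
    element of \<open>ker e\<close>, where \<open>u\<close> equals \<open>f \<circ> s\<close>; hence
    the value does not depend on \<open>p\<close>.\<close>
  define G where "G w y \<longleftrightarrow> (\<exists>p\<in>carrier P. e p = q w \<and> y = f (k w p) \<oplus>\<^bsub>Y\<^esub> u p)" for w y
  have "\<exists>h. lin R W Y h \<and> (\<forall>w\<in>carrier W. \<forall>y\<in>carrier Y. G w y = (y = h w))"
  proof (rule lin_of_relation[OF mW mY])
    fix w assume w: "w \<in> carrier W"
    then have "q w \<in> e ` carrier P" using P(3) linD(1)[OF q(1)] by simp
    then obtain p where p: "p \<in> carrier P" "e p = q w" by auto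
    then have "f (k w p) \<oplus>\<^bsub>Y\<^esub> u p \<in> carrier Y"
      using F(1) k[OF w] linD(1)[OF u(1)] g by (simp add: ag_closed)
    then show "\<exists>y\<in>carrier Y. G w y" using p unfolding G_def by blast
  next
    fix w y w' y' assume w: "w \<in> carrier W" "w' \<in> carrier W" and "G w y" "G w' y'"
    then obtain p p' where p: "p \<in> carrier P" "e p = q w" "y = f (k w p) \<oplus>\<^bsub>Y\<^esub> u p"
      and p': "p' \<in> carrier P" "e p' = q w'" "y' = f (k w' p') \<oplus>\<^bsub>Y\<^esub> u p'" unfolding G_def by blast
    have kk: "k (w \<oplus>\<^bsub>W\<^esub> w') (p \<oplus>\<^bsub>P\<^esub> p') = k w p \<oplus>\<^bsub>W\<^esub> k w' p'"
      using w p(1) p'(1) linD(1,2)[OF s(1)] g by (simp add: k_def ag)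
    note kp = k[OF w(1) p(1,2)] and kp' = k[OF w(2) p'(1,2)]
    have "f (k (w \<oplus>\<^bsub>W\<^esub> w') (p \<oplus>\<^bsub>P\<^esub> p')) \<oplus>\<^bsub>Y\<^esub> u (p \<oplus>\<^bsub>P\<^esub> p') = y \<oplus>\<^bsub>Y\<^esub> y'"
      using kp kp' p p' linD(1,2)[OF u(1)] F(1)[of "k w p"] F(1)[of "k w' p'"] F(2)[of "k w p" "k w' p'"] g
      unfolding kk by (simp add: ag)
    then show "G (w \<oplus>\<^bsub>W\<^esub> w') (y \<oplus>\<^bsub>Y\<^esub> y')"
      using w p(1,2) p'(1,2) linD(2)[OF q(1)] linD(2)[OF P(2)] g unfolding G_def
      by (intro bexI[of _ "p \<oplus>\<^bsub>P\<^esub> p'"]) (simp_all add: ag_closed)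
  next
    fix a w y assume a: "a \<in> carrier R" and w: "w \<in> carrier W" and "G w y"
    then obtain p where p: "p \<in> carrier P" "e p = q w" "y = f (k w p) \<oplus>\<^bsub>Y\<^esub> u p" unfolding G_def by blast
    have kk: "k (a \<odot>\<^bsub>W\<^esub> w) (a \<odot>\<^bsub>P\<^esub> p) = a \<odot>\<^bsub>W\<^esub> k w p"
      using a w p(1) linD(1,3)[OF s(1)] g left_module_smult[OF mW] smult_minus[OF mW]
      by (simp add: k_def ag_closed a_minus_def)
    note kp = k[OF w(1) p(1,2)]
    have "f (k (a \<odot>\<^bsub>W\<^esub> w) (a \<odot>\<^bsub>P\<^esub> p)) \<oplus>\<^bsub>Y\<^esub> u (a \<odot>\<^bsub>P\<^esub> p) = a \<odot>\<^bsub>Y\<^esub> y"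
      using a kp p linD(1,3)[OF u(1)] F(1)[of "k w p"] F(3)[OF a, of "k w p"] left_module_smult[OF mY]
      unfolding kk by simp
    then show "G (a \<odot>\<^bsub>W\<^esub> w) (a \<odot>\<^bsub>Y\<^esub> y)"
      using a w p(1,2) linD(3)[OF q(1)] linD(3)[OF P(2)] left_module_smult[OF mP] unfolding G_def
      by (intro bexI[of _ "a \<odot>\<^bsub>P\<^esub> p"]) simp_all
  next
    fix y assume "y \<in> carrier Y" "G \<zero>\<^bsub>W\<^esub> y"
    then obtain p where p: "p \<in> carrier P" "e p = q \<zero>\<^bsub>W\<^esub>" "y = f (k \<zero>\<^bsub>W\<^esub> p) \<oplus>\<^bsub>Y\<^esub> u p" unfolding G_def by blast
    have ep: "e p = \<zero>\<^bsub>X\<^esub>" using p linD(4)[OF q(1)] by simp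
    note kp = k[OF _ p(1,2)]
    have "u p \<oplus>\<^bsub>Y\<^esub> f (k \<zero>\<^bsub>W\<^esub> p) = f (s p \<oplus>\<^bsub>W\<^esub> k \<zero>\<^bsub>W\<^esub> p)"
      using F(2)[of "s p" "k \<zero>\<^bsub>W\<^esub> p"] kp g p(1) ep s(2) u(2) linD(1)[OF s(1)] by (simp add: ag_closed)
    also have "s p \<oplus>\<^bsub>W\<^esub> k \<zero>\<^bsub>W\<^esub> p = \<zero>\<^bsub>W\<^esub>" using g p(1) linD(1)[OF s(1)] by (simp add: k_def ag)
    finally show "y = \<zero>\<^bsub>Y\<^esub>"
      using F(1)[of "k \<zero>\<^bsub>W\<^esub> p"] F(4) kp g p linD(1)[OF u(1)] by (simp add: ag)
  qed
  then obtain h where h: "lin R W Y h" "\<forall>w\<in>carrier W. \<forall>y\<in>carrier Y. G w y = (y = h w)" by (elim exE conjE)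
  have "h w = f w" if w: "w \<in> carrier W" "q w = \<zero>\<^bsub>X\<^esub>" for w
  proof -
    \<comment> \<open>On \<open>ker q\<close> the choice \<open>p = 0\<close> recovers
      \<open>f\<close>.\<close>
    have "f w = f (k w \<zero>\<^bsub>P\<^esub>) \<oplus>\<^bsub>Y\<^esub> u \<zero>\<^bsub>P\<^esub>"
      using w g F(1) linD(4)[OF s(1)] linD(4)[OF u(1)] by (simp add: k_def ag)
    then have "G w (f w)" using g w linD(4)[OF P(2)] unfolding G_def by (intro bexI[of _ "\<zero>\<^bsub>P\<^esub>"]) (simp_all add: ag_closed)
    then show ?thesis using h(2)[rule_format, OF w(1), of "f w"] F(1) w by simp
  qed
  then show "\<exists>g. lin R W Y g \<and> (\<forall>w\<in>carrier W. q w = \<zero>\<^bsub>X\<^esub> \<longrightarrow> g w = f w)" using h(1) by blast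
qed

lemma special_precover_module:
  assumes R: "ring R" and U: "module_universe R U" and L: "L \<subseteq> Obj (Modules R U)"
    and pre: "special_precovering (Modules R U) L" and M: "M \<in> Obj (Modules R U)"
  obtains X a where "X \<in> L" "lin R X M a" "a ` carrier X = carrier M" "ext_orthogonal R U L (mod_ker X M a)"
proof -
  obtain X a where "special_precover (Modules R U) L M X a"
    using pre M unfolding special_precovering_def by blast
  then have X: "X \<in> L" "a \<in> Epi (Modules R U) X M"
    "\<And>X'. X' \<in> L \<Longrightarrow> trivial_group (Ext1 (Modules R U) X' (mod_ker X M a))"
    by (auto simp: special_precover_def Modules_def)
  have XO: "X \<in> Obj (Modules R U)" using X(1) L by blast
  then have a: "lin R X M a" "a ` carrier X = carrier M" using X(2) M by (simp_all add: Epi_Modules_iff)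
  show ?thesis
    using that[OF X(1) a Ext1_trivial_imp_ext_orthogonal[OF R U L Modules_ker[OF U XO a(1)] X(3)]] .
qed

section \<open>Complexes and chain maps\<close>

abbreviation car :: "('r, 'm) cplx \<Rightarrow> int \<Rightarrow> 'm set" where
  "car C n \<equiv> carrier (component C n)"

text \<open>The counterpart of \<open>lin\<close>: chain maps without extensionality, between
  complexes on possibly different carrier types.\<close>

definition cmap :: "('r, 'a) ring_scheme \<Rightarrow> ('r, 'm) cplx \<Rightarrow> ('r, 'n) cplx \<Rightarrow> (int \<Rightarrow> 'm \<Rightarrow> 'n) \<Rightarrow> bool" where
  "cmap R C D f \<longleftrightarrow> (\<forall>n. lin R (component C n) (component D n) (f n)) \<and>
     (\<forall>n. \<forall>x\<in>car C n. f (n - 1) (diff C n x) = diff D n (f n x))"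

text \<open>Complexes without restriction on the size and type of the carriers.\<close>

definition large_complex :: "('r, 'a) ring_scheme \<Rightarrow> ('r, 'm) cplx \<Rightarrow> bool" where
  "large_complex R C \<longleftrightarrow> (\<forall>n. lin R (component C n) (component C (n - 1)) (diff C n)) \<and>
     (\<forall>n. \<forall>x\<in>car C n. diff C (n - 1) (diff C n x) = \<zero>\<^bsub>component C (n - 2)\<^esub>)"

lemma is_complex_iff:
  "is_complex R U C \<longleftrightarrow> large_complex R C \<and> (\<forall>n. component C n \<in> Obj (Modules R U)) \<and>
     (\<forall>n. diff C n \<in> extensional (car C n))"
  unfolding is_complex_def large_complex_def by (auto simp: mod_hom_iff)

lemma Obj_Complexes [simp]: "C \<in> Obj (Complexes R U) \<longleftrightarrow> is_complex R U C"
  by (simp add: Complexes_def)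

lemma cmapI:
  assumes "\<And>n. lin R (component C n) (component D n) (f n)"
    and "\<And>n x. x \<in> car C n \<Longrightarrow> f (n - 1) (diff C n x) = diff D n (f n x)"
  shows "cmap R C D f"
  using assms by (simp add: cmap_def)

text \<open>\<open>cmap_diff_Suc\<close> is the same equation one degree up, which avoids degrees of
  the form \<open>n + 1 - 1\<close>.\<close>

lemma
  assumes "cmap R C D f"
  shows cmap_lin: "lin R (component C n) (component D n) (f n)"
    and cmap_diff: "x \<in> car C n \<Longrightarrow> f (n - 1) (diff C n x) = diff D n (f n x)"
    and cmap_diff_Suc: "x \<in> car C (n + 1) \<Longrightarrow> f n (diff C (n + 1) x) = diff D (n + 1) (f (n + 1) x)"
  using assms unfolding cmap_def by (metis, metis, metis add_diff_cancel_right')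

lemma cmap_closed: "cmap R C D f \<Longrightarrow> x \<in> car C n \<Longrightarrow> f n x \<in> car D n"
  by (rule linD(1)[OF cmap_lin])

lemma
  assumes "large_complex R C"
  shows diff_lin: "lin R (component C n) (component C (n - 1)) (diff C n)"
    and diff_lin_Suc: "lin R (component C (n + 1)) (component C n) (diff C (n + 1))"
    and diff_diff: "x \<in> car C n \<Longrightarrow> diff C (n - 1) (diff C n x) = \<zero>\<^bsub>component C (n - 2)\<^esub>"
    and diff_diff_Suc: "x \<in> car C (n + 1) \<Longrightarrow> diff C n (diff C (n + 1) x) = \<zero>\<^bsub>component C (n - 1)\<^esub>"
proof -
  show *: "lin R (component C n) (component C (n - 1)) (diff C n)"
    "x \<in> car C n \<Longrightarrow> diff C (n - 1) (diff C n x) = \<zero>\<^bsub>component C (n - 2)\<^esub>" for n x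
    using assms unfolding large_complex_def by metis+
  show "lin R (component C (n + 1)) (component C n) (diff C (n + 1))"
    using *(1)[of "n + 1"] by simp
  show "x \<in> car C (n + 1) \<Longrightarrow> diff C n (diff C (n + 1) x) = \<zero>\<^bsub>component C (n - 1)\<^esub>"
    using *(2)[of x "n + 1"] by simp
qed

lemma is_complex_large: "is_complex R U C \<Longrightarrow> large_complex R C"
  by (simp add: is_complex_iff)

lemma is_complex_component: "is_complex R U C \<Longrightarrow> component C n \<in> Obj (Modules R U)"
  by (simp add: is_complex_iff del: Obj_Modules)

lemma is_complex_module: "is_complex R U C \<Longrightarrow> left_module R (component C n)"
  using is_complex_component by fastforce

lemma chain_map_iff:
  assumes "\<And>n. left_module R (component C n)" "\<And>n. left_module R (component D n)"
  shows "f \<in> chain_map R C D \<longleftrightarrow> cmap R C D f \<and> (\<forall>n. f n \<in> extensional (car C n))"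
  unfolding chain_map_def cmap_def using assms by (auto simp: mod_hom_iff)

lemma restrict_chain_map:
  assumes f: "cmap R C D f" and C: "large_complex R C"
  shows "(\<lambda>n. restrict (f n) (car C n)) \<in> chain_map R C D"
proof -
  have "cmap R C D (\<lambda>n. restrict (f n) (car C n))"
  proof (rule cmapI)
    show "lin R (component C n) (component D n) (restrict (f n) (car C n))" for n
      by (rule lin_cong[OF cmap_lin[OF f]]) simp
    show "restrict (f (n - 1)) (car C (n - 1)) (diff C n x) = diff D n (restrict (f n) (car C n) x)"
      if "x \<in> car C n" for n x
      using that linD(1)[OF diff_lin[OF C] that] cmap_diff[OF f that] by simp
  qed
  then show ?thesis
    using chain_map_iff[OF lin_dom[OF cmap_lin[OF f]] lin_cod[OF cmap_lin[OF f]]] by simp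
qed

lemma cmap_comp:
  assumes f: "cmap R C D f" and g: "cmap R D E g" shows "cmap R C E (\<lambda>n x. g n (f n x))"
  by (rule cmapI, rule lin_comp[OF cmap_lin[OF f] cmap_lin[OF g]])
    (simp add: cmap_diff[OF f] cmap_diff[OF g] cmap_closed[OF f])

lemma cmap_plus:
  assumes f: "cmap R C D f" and g: "cmap R C D g" and D: "large_complex R D"
  shows "cmap R C D (\<lambda>n x. f n x \<oplus>\<^bsub>component D n\<^esub> g n x)"
  by (intro cmapI lin_plus cmap_lin[OF f] cmap_lin[OF g])
    (simp add: cmap_diff[OF f] cmap_diff[OF g] linD(2)[OF diff_lin[OF D]] cmap_closed[OF f] cmap_closed[OF g])

lemma cmap_minus:
  assumes f: "cmap R C D f" and g: "cmap R C D g" and D: "large_complex R D"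
  shows "cmap R C D (\<lambda>n x. f n x \<ominus>\<^bsub>component D n\<^esub> g n x)"
  by (intro cmapI lin_diff cmap_lin[OF f] cmap_lin[OF g])
    (simp add: cmap_diff[OF f] cmap_diff[OF g] linD(6)[OF diff_lin[OF D]] cmap_closed[OF f] cmap_closed[OF g])

lemma cmap_zero:
  assumes C: "\<And>n. left_module R (component C n)" and D: "large_complex R D"
  shows "cmap R C D (\<lambda>n x. \<zero>\<^bsub>component D n\<^esub>)"
  by (intro cmapI lin_const_zero C lin_dom[OF diff_lin[OF D]]) (simp add: linD(4)[OF diff_lin[OF D]])

text \<open>Degreewise transport of modules. The differential is conjugated by the isomorphisms and
  then restricted, as objects of \<open>Complexes\<close> have extensional differentials.\<close>

lemma complex_transport:
  fixes N :: "('r, 'n) cplx" and U :: "'m set set"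
  assumes U: "module_universe R U" and N: "large_complex R N" and small: "\<And>n. small U (car N n)"
  obtains C \<phi> \<psi> where "is_complex R U C" "cmap R N C \<phi>" "cmap R C N \<psi>"
    "\<And>n x. x \<in> car N n \<Longrightarrow> \<psi> n (\<phi> n x) = x" "\<And>n y. y \<in> car C n \<Longrightarrow> \<phi> n (\<psi> n y) = y"
proof -
  have "\<exists>M \<phi> \<psi>. M \<in> Obj (Modules R U) \<and> lin R (component N n) M \<phi> \<and> lin R M (component N n) \<psi> \<and>
    (\<forall>x\<in>car N n. \<psi> (\<phi> x) = x) \<and> (\<forall>y\<in>carrier M. \<phi> (\<psi> y) = y)" for n
    by (rule module_transport[OF U lin_dom[OF diff_lin[OF N]] small]) blast
  then obtain M \<phi> \<psi> where M: "\<And>n. M n \<in> Obj (Modules R U)"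
    and \<phi>: "\<And>n. lin R (component N n) (M n) (\<phi> n)" and \<psi>: "\<And>n. lin R (M n) (component N n) (\<psi> n)"
    and inv: "\<And>n x. x \<in> car N n \<Longrightarrow> \<psi> n (\<phi> n x) = x" "\<And>n y. y \<in> carrier (M n) \<Longrightarrow> \<phi> n (\<psi> n y) = y" by metis
  define C where "C = \<lparr>component = M, diff = (\<lambda>n. \<lambda>x\<in>carrier (M n). \<phi> (n - 1) (diff N n (\<psi> n x)))\<rparr>"
  have d: "lin R (M n) (M (n - 1)) (diff C n)" for n
    by (rule lin_cong[OF lin_comp[OF lin_comp[OF \<psi> diff_lin[OF N]] \<phi>]]) (simp add: C_def)
  have dd: "diff C (n - 1) (diff C n x) = \<zero>\<^bsub>M (n - 2)\<^esub>" if x: "x \<in> carrier (M n)" for n x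
  proof -
    note x1 = linD(1)[OF \<psi> x] linD(1)[OF diff_lin[OF N] linD(1)[OF \<psi> x]]
    have "diff C (n - 1) (diff C n x) = \<phi> (n - 2) (diff N (n - 1) (diff N n (\<psi> n x)))"
      using x x1 linD(1)[OF \<phi> x1(2)] by (simp add: C_def inv)
    then show ?thesis using diff_diff[OF N x1(1)] linD(4)[OF \<phi>] by simp
  qed
  have C: "is_complex R U C"
    using d dd M by (auto simp: is_complex_iff large_complex_def) (simp_all add: C_def)
  moreover have "cmap R N C \<phi>"
    by (rule cmapI) (use \<phi> in \<open>auto simp: C_def inv linD(1)[OF \<phi>]\<close>)
  moreover have "cmap R C N \<psi>"
    by (rule cmapI) (use \<psi> in \<open>auto simp: C_def inv linD(1)[OF \<psi>] linD(1)[OF diff_lin[OF N]]\<close>)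
  moreover have "\<phi> n (\<psi> n y) = y" if "y \<in> car C n" for n y using that inv by (simp add: C_def)
  ultimately show ?thesis using that inv(1) by blast
qed

lemma complex_ker_simps [simp]:
  "component (complex_ker C D f) n = mod_ker (component C n) (component D n) (f n)"
  "diff (complex_ker C D f) n = restrict (diff C n) {x \<in> car C n. f n x = \<zero>\<^bsub>component D n\<^esub>}"
  by (simp_all add: complex_ker_def a_kernel_def')

lemma large_complex_ker:
  assumes C: "large_complex R C" and D: "large_complex R D" and f: "cmap R C D f"
  shows "large_complex R (complex_ker C D f)"
proof -
  have d0: "f (n - 1) (diff C n x) = \<zero>\<^bsub>component D (n - 1)\<^esub>"
    if "x \<in> car C n" "f n x = \<zero>\<^bsub>component D n\<^esub>" for n x
    using that cmap_diff[OF f] linD(4)[OF diff_lin[OF D]] by simp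
  show ?thesis unfolding large_complex_def
  proof (intro conjI allI ballI)
    show "lin R (component (complex_ker C D f) n) (component (complex_ker C D f) (n - 1)) (diff (complex_ker C D f) n)" for n
      unfolding complex_ker_simps
      by (rule lin_cong[OF lin_ker_cod[OF lin_ker_dom[OF diff_lin[OF C] cmap_lin[OF f]] cmap_lin[OF f]]])
        (simp_all add: d0)
    show "diff (complex_ker C D f) (n - 1) (diff (complex_ker C D f) n x) = \<zero>\<^bsub>component (complex_ker C D f) (n - 2)\<^esub>"
      if "x \<in> car (complex_ker C D f) n" for n x
      using that d0 diff_diff[OF C] linD(1)[OF diff_lin[OF C]] by simp
  qed
qed

lemma is_complex_ker:
  assumes U: "module_universe R U" and C: "is_complex R U C" and D: "large_complex R D" and f: "cmap R C D f"
  shows "is_complex R U (complex_ker C D f)"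
  unfolding is_complex_iff
  using large_complex_ker[OF is_complex_large[OF C] D f]
    Modules_ker[OF U is_complex_component[OF C] cmap_lin[OF f]] by (auto simp: is_complex_iff)

lemma cmap_ker_cod:
  assumes g: "cmap R W C g" and f: "cmap R C D f"
    and 0: "\<And>n x. x \<in> car W n \<Longrightarrow> f n (g n x) = \<zero>\<^bsub>component D n\<^esub>"
  shows "cmap R W (complex_ker C D f) g"
  by (rule cmapI) (use 0 in \<open>auto simp: cmap_closed[OF g] cmap_diff[OF g] intro!: lin_ker_cod[OF cmap_lin[OF g] cmap_lin[OF f]]\<close>)

lemma cmap_ker_incl:
  assumes "large_complex R C" "cmap R C D f" shows "cmap R (complex_ker C D f) C (\<lambda>n x. x)"
  by (rule cmapI) (auto intro!: lin_ker_incl cmap_lin[OF assms(2)])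

lemma cmap_ker_dom:
  "large_complex R C \<Longrightarrow> cmap R C D f \<Longrightarrow> cmap R C E g \<Longrightarrow> cmap R (complex_ker C D f) E g"
  using cmap_comp[OF cmap_ker_incl] by metis

lemma exact_complexD:
  assumes "exact_complex C" "x \<in> car C n" "diff C n x = \<zero>\<^bsub>component C (n - 1)\<^esub>"
  obtains y where "y \<in> car C (n + 1)" "diff C (n + 1) y = x"
proof -
  have "x \<in> diff C (n + 1) ` car C (n + 1)"
    using assms unfolding exact_complex_def cycles_def by simp
  then show ?thesis using that by blast
qed

lemma exact_complexI:
  assumes C: "large_complex R C"
    and "\<And>n x. x \<in> car C n \<Longrightarrow> diff C n x = \<zero>\<^bsub>component C (n - 1)\<^esub> \<Longrightarrow> \<exists>y\<in>car C (n + 1). diff C (n + 1) y = x"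
  shows "exact_complex C"
  unfolding exact_complex_def cycles_def mod_ker_simps
  using assms(2) linD(1)[OF diff_lin_Suc[OF C]] diff_diff_Suc[OF C] by blast

section \<open>Enough projective complexes\<close>

lemma projectiveD:
  assumes "projective \<A> P" "X \<in> Obj \<A>" "Y \<in> Obj \<A>" "e \<in> Epi \<A> X Y" "g \<in> carrier (Mor \<A> P Y)"
  obtains h where "h \<in> carrier (Mor \<A> P X)" "Comp \<A> P e h = g"
  using assms unfolding projective_def by blast

lemma projective_Complexes_iff:
  "projective (Complexes R U) P \<longleftrightarrow> is_complex R U P \<and>
     (\<forall>X Y e g. is_complex R U X \<longrightarrow> is_complex R U Y \<longrightarrow> cmap R X Y e \<longrightarrow> (\<forall>n. e n ` car X n = car Y n) \<longrightarrow>
        cmap R P Y g \<longrightarrow> (\<exists>h. cmap R P X h \<and> (\<forall>n. \<forall>p\<in>car P n. e n (h n p) = g n p)))"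
  (is "_ \<longleftrightarrow> _ \<and> ?lift")
proof (cases "is_complex R U P")
  case P: True
  note mod = is_complex_module
  have "projective (Complexes R U) P \<longleftrightarrow> ?lift"
  proof
    assume pr: "projective (Complexes R U) P"
    show ?lift
    proof (intro allI impI)
      fix X Y e g
      assume h: "is_complex R U X" "is_complex R U Y" "cmap R X Y e" "\<forall>n. e n ` car X n = car Y n" "cmap R P Y g"
      let ?e = "\<lambda>n. restrict (e n) (car X n)" and ?g = "\<lambda>n. restrict (g n) (car P n)"
      have E: "?e \<in> Epi (Complexes R U) X Y"
        using h restrict_chain_map[OF h(3) is_complex_large[OF h(1)]] by (simp add: Complexes_def)
      have G: "?g \<in> carrier (Mor (Complexes R U) P Y)"
        using restrict_chain_map[OF h(5) is_complex_large[OF P]] by (simp add: Complexes_def chain_map_group_def)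
      have XY: "X \<in> Obj (Complexes R U)" "Y \<in> Obj (Complexes R U)" using h(1,2) by simp_all
      obtain k where k: "k \<in> carrier (Mor (Complexes R U) P X)" "Comp (Complexes R U) P ?e k = ?g"
        using projectiveD[OF pr XY E G] .
      then have l: "cmap R P X k"
        using chain_map_iff[OF mod[OF P] mod[OF h(1)]] by (simp add: Complexes_def chain_map_group_def)
      have "e n (k n p) = g n p" if "p \<in> car P n" for n p
        using fun_cong[OF fun_cong[OF k(2), of n], of p] that cmap_closed[OF l that]
        by (simp add: Complexes_def compose_def)
      then show "\<exists>h. cmap R P X h \<and> (\<forall>n. \<forall>p\<in>car P n. e n (h n p) = g n p)" using l by blast
    qed
  next
    assume lift: ?lift
    show "projective (Complexes R U) P" unfolding projective_def Obj_Complexes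
    proof (intro conjI ballI P)
      fix X Y e g
      assume h: "X \<in> Obj (Complexes R U)" "Y \<in> Obj (Complexes R U)" "e \<in> Epi (Complexes R U) X Y"
        "g \<in> carrier (Mor (Complexes R U) P Y)"
      then have XY: "is_complex R U X" "is_complex R U Y" by simp_all
      have g: "cmap R P Y g" "\<And>n. g n \<in> extensional (car P n)"
        using h(4) by (simp_all add: Complexes_def chain_map_group_def chain_map_iff[OF mod[OF P] mod[OF XY(2)]])
      have e: "cmap R X Y e" "\<forall>n. e n ` car X n = car Y n"
        using h(3) by (simp_all add: Complexes_def chain_map_iff[OF mod[OF XY(1)] mod[OF XY(2)]])
      obtain k where k: "cmap R P X k" "\<forall>n. \<forall>p\<in>car P n. e n (k n p) = g n p"
        using lift XY g(1) e by blast
      have "Comp (Complexes R U) P e (\<lambda>n. restrict (k n) (car P n)) = g"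
        using k g(2) by (auto simp: Complexes_def compose_def extensional_def fun_eq_iff)
      then show "\<exists>h\<in>carrier (Mor (Complexes R U) P X). Comp (Complexes R U) P e h = g"
        using restrict_chain_map[OF k(1) is_complex_large[OF P]]
        by (intro bexI[of _ "\<lambda>n. restrict (k n) (car P n)"]) (simp_all add: Complexes_def chain_map_group_def)
    qed
  qed
  then show ?thesis using P by blast
qed (simp add: projective_def)

lemma projective_complex_lift:
  assumes "projective (Complexes R U) P" "is_complex R U X" "is_complex R U Y" "cmap R X Y e"
    "\<And>n. e n ` car X n = car Y n" "cmap R P Y g"
  obtains h where "cmap R P X h" "\<And>n p. p \<in> car P n \<Longrightarrow> e n (h n p) = g n p"
proof -
  have "\<exists>h. cmap R P X h \<and> (\<forall>n. \<forall>p\<in>car P n. e n (h n p) = g n p)"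
    by (rule conjunct2[OF iffD1[OF projective_Complexes_iff assms(1)], rule_format, OF assms(2-4) _ assms(6)])
      (rule assms(5))
  then show ?thesis using that by (elim exE conjE) simp
qed

text \<open>The sum of the disks \<open>P\<^sub>n \<rightarrow> P\<^sub>n\<close>, in degrees \<open>n\<close> and \<open>n - 1\<close>.\<close>

definition disk_complex :: "(int \<Rightarrow> ('r, 'm) module) \<Rightarrow> ('r, 'm \<times> 'm) cplx" where
  "disk_complex P = \<lparr>component = (\<lambda>n. prod_module (P n) (P (n + 1))), diff = (\<lambda>n x. (\<zero>\<^bsub>P (n - 1)\<^esub>, fst x))\<rparr>"

lemma large_disk_complex:
  assumes P: "\<And>n. left_module R (P n)" shows "large_complex R (disk_complex P)"
  unfolding large_complex_def disk_complex_def
proof (simp, intro allI)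
  fix n
  have "lin R (prod_module (P n) (P (n + 1))) (P n) fst" by (rule lin_fst[OF P P])
  then show "lin R (prod_module (P n) (P (n + 1))) (prod_module (P (n - 1)) (P n)) (\<lambda>x. (\<zero>\<^bsub>P (n - 1)\<^esub>, fst x))"
    by (intro lin_pair lin_const_zero left_module_prod P)
qed

text \<open>A chain map out of a sum of disks amounts to an arbitrary linear map from
  \<open>P n\<close> to \<open>X n\<close> in each degree, so lifting reduces to the projective
  modules \<open>P n\<close>.\<close>

lemma enough_projective_complexes:
  assumes R: "ring R" and U: "module_universe R U" and C: "is_complex R U C"
  obtains Q e where "projective (Complexes R U) Q" "cmap R Q C e" "\<And>n. e n ` car Q n = car C n"
proof -
  have "\<exists>P p. projective (Modules R U) P \<and> lin R P (component C n) p \<and> p ` carrier P = car C n" for n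
    by (rule enough_projective_modules[OF R U is_complex_component[OF C]]) blast
  then obtain P p where P: "\<And>n. projective (Modules R U) (P n)" and p: "\<And>n. lin R (P n) (component C n) (p n)"
    and pon: "\<And>n. p n ` carrier (P n) = car C n" by metis
  have mP: "left_module R (P n)" and UP: "carrier (P n) \<in> U" for n using P by (simp_all add: projective_def)
  let ?D = "disk_complex P"
  have DD: "component ?D n = prod_module (P n) (P (n + 1))" "diff ?D n x = (\<zero>\<^bsub>P (n - 1)\<^esub>, fst x)" for n x
    by (simp_all add: disk_complex_def)
  note D = large_disk_complex[of R P, OF mP]
  have "small U (car ?D n)" for n
    using small_times[OF U small_mem[OF UP[of n]] small_mem[OF UP[of "n + 1"]]] by (simp add: DD)
  then obtain Q \<phi> \<psi> where Q: "is_complex R U Q" "cmap R ?D Q \<phi>" "cmap R Q ?D \<psi>"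
    "\<And>n x. x \<in> car ?D n \<Longrightarrow> \<psi> n (\<phi> n x) = x" "\<And>n y. y \<in> car Q n \<Longrightarrow> \<phi> n (\<psi> n y) = y"
    using complex_transport[OF U D] by metis
  \<comment> \<open>The first factor in degree \<open>n\<close> is the top of the disk on
    \<open>P n\<close>; the second is the bottom of the disk on \<open>P (n + 1)\<close>, so its
    image must be the boundary of the image of the top.\<close>
  have from_disk: "cmap R ?D X (\<lambda>n x. t n (fst x) \<oplus>\<^bsub>component X n\<^esub> diff X (n + 1) (t (n + 1) (snd x)))"
    if X: "large_complex R X" and t: "\<And>n. lin R (P n) (component X n) (t n)" for X :: "('a, 'c) cplx" and t
  proof (rule cmapI)
    fix n
    show "lin R (component ?D n) (component X n) (\<lambda>x. t n (fst x) \<oplus>\<^bsub>component X n\<^esub> diff X (n + 1) (t (n + 1) (snd x)))"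
      unfolding DD
      by (intro lin_plus lin_comp[OF lin_fst[OF mP mP] t]
          lin_comp[OF lin_comp[OF lin_snd[OF mP mP] t] diff_lin_Suc[OF X]])
    fix x assume x: "x \<in> car ?D n"
    then have "fst x \<in> carrier (P n)" "snd x \<in> carrier (P (n + 1))" by (auto simp: DD)
    note tx = linD(1)[OF t this(1)] linD(1)[OF t this(2)]
    show "t (n - 1) (fst (diff ?D n x)) \<oplus>\<^bsub>component X (n - 1)\<^esub> diff X (n - 1 + 1) (t (n - 1 + 1) (snd (diff ?D n x)))
      = diff X n (t n (fst x) \<oplus>\<^bsub>component X n\<^esub> diff X (n + 1) (t (n + 1) (snd x)))"
      using tx linD(4)[OF t] linD(1)[OF diff_lin_Suc[OF X] tx(2)] linD(1)[OF diff_lin[OF X] tx(1)]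
        diff_diff_Suc[OF X tx(2)] left_module_group[OF lin_cod[OF t]]
      by (simp add: DD linD(2)[OF diff_lin[OF X]] ag_zero)
  qed
  have "projective (Complexes R U) Q" unfolding projective_Complexes_iff
  proof (intro conjI allI impI Q(1))
    fix X Y e g
    assume h: "is_complex R U X" "is_complex R U Y" "cmap R X Y e" "\<forall>n. e n ` car X n = car Y n" "cmap R Q Y g"
    let ?i = "\<lambda>n y. \<phi> n (y, \<zero>\<^bsub>P (n + 1)\<^esub>)"
    have i: "lin R (P n) (component Q n) (?i n)" for n
      by (rule lin_comp[OF lin_pair[OF lin_id[OF mP] lin_const_zero[OF mP mP]]])
        (use cmap_lin[OF Q(2), of n] in \<open>simp add: DD\<close>)
    have "\<exists>t. lin R (P n) (component X n) t \<and> (\<forall>y\<in>carrier (P n). e n (t y) = g n (?i n y))" for n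
      using P[of n] is_complex_component[OF h(1)] is_complex_component[OF h(2)] cmap_lin[OF h(3)] h(4)
        lin_comp[OF i cmap_lin[OF h(5)]]
      unfolding projective_Modules_iff by blast
    then obtain t where t: "\<And>n. lin R (P n) (component X n) (t n)"
      "\<And>n y. y \<in> carrier (P n) \<Longrightarrow> e n (t n y) = g n (?i n y)" by metis
    let ?h = "\<lambda>n x. t n (fst x) \<oplus>\<^bsub>component X n\<^esub> diff X (n + 1) (t (n + 1) (snd x))"
    note hh = from_disk[OF is_complex_large[OF h(1)] t(1)]
    note gphi = cmap_comp[OF Q(2) h(5)]
    have eq: "e n (?h n x) = g n (\<phi> n x)" if x: "x \<in> car ?D n" for n x
    proof -
      have x': "fst x \<in> carrier (P n)" "snd x \<in> carrier (P (n + 1))" using x by (auto simp: DD)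
      have z: "\<zero>\<^bsub>P n\<^esub> \<in> carrier (P n)" for n using left_module_group[OF mP] by (simp add: ag_closed)
      have mem: "(fst x, \<zero>\<^bsub>P (n + 1)\<^esub>) \<in> car ?D n" "(\<zero>\<^bsub>P n\<^esub>, snd x) \<in> car ?D n"
        "(snd x, \<zero>\<^bsub>P (n + 1 + 1)\<^esub>) \<in> car ?D (n + 1)"
        using x' z[of n] z[of "n + 1"] z[of "n + 1 + 1"] by (simp_all add: DD del: add.assoc)
      have "e n (?h n x) = e n (t n (fst x)) \<oplus>\<^bsub>component Y n\<^esub> diff Y (n + 1) (e (n + 1) (t (n + 1) (snd x)))"
        using linD(1)[OF t(1) x'(1)] linD(1)[OF t(1) x'(2)]
          linD(1)[OF diff_lin_Suc[OF is_complex_large[OF h(1)]] linD(1)[OF t(1) x'(2)]]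
        by (simp add: linD(2)[OF cmap_lin[OF h(3)]] cmap_diff_Suc[OF h(3)])
      also have "\<dots> = g n (?i n (fst x)) \<oplus>\<^bsub>component Y n\<^esub> diff Y (n + 1) (g (n + 1) (?i (n + 1) (snd x)))"
        using t(2) x' by simp
      \<comment> \<open>A bottom element \<open>(0, y)\<close> is the boundary of the top element
        \<open>(y, 0)\<close> one degree higher, which determines \<open>g\<close> on it.\<close>
      also have "diff Y (n + 1) (g (n + 1) (?i (n + 1) (snd x))) = g n (\<phi> n (\<zero>\<^bsub>P n\<^esub>, snd x))"
        using cmap_diff_Suc[OF gphi mem(3)] by (simp add: DD)
      also have "g n (?i n (fst x)) \<oplus>\<^bsub>component Y n\<^esub> g n (\<phi> n (\<zero>\<^bsub>P n\<^esub>, snd x)) = g n (\<phi> n x)"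
        using linD(2)[OF cmap_lin[OF gphi] mem(1,2)] x' left_module_group[OF mP]
        by (simp add: DD ag_zero)
      finally show ?thesis .
    qed
    have "e n (?h n (\<psi> n q)) = g n q" if "q \<in> car Q n" for n q
      using eq[OF cmap_closed[OF Q(3) that]] Q(5)[OF that] by simp
    then show "\<exists>h. cmap R Q X h \<and> (\<forall>n. \<forall>q\<in>car Q n. e n (h n q) = g n q)"
      using cmap_comp[OF Q(3) hh] by blast
  qed
  moreover
  let ?e = "\<lambda>n x. p n (fst x) \<oplus>\<^bsub>component C n\<^esub> diff C (n + 1) (p (n + 1) (snd x))"
  have e: "cmap R Q C (\<lambda>n q. ?e n (\<psi> n q))"
    by (rule cmap_comp[OF Q(3) from_disk[OF is_complex_large[OF C] p]])
  moreover have "(\<lambda>q. ?e n (\<psi> n q)) ` car Q n = car C n" for n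
  proof
    show "car C n \<subseteq> (\<lambda>q. ?e n (\<psi> n q)) ` car Q n"
    proof
      fix c assume c: "c \<in> car C n"
      then have "c \<in> p n ` carrier (P n)" by (simp add: pon)
      then obtain y where y: "y \<in> carrier (P n)" "c = p n y" by blast
      \<comment> \<open>The tops of the disks alone already map onto \<open>C\<close>.\<close>
      have mem: "(y, \<zero>\<^bsub>P (n + 1)\<^esub>) \<in> car ?D n" using y left_module_group[OF mP] by (simp add: DD ag_closed)
      have "?e n (\<psi> n (\<phi> n (y, \<zero>\<^bsub>P (n + 1)\<^esub>))) = c"
        using Q(4)[OF mem] y c linD(4)[OF p] linD(4)[OF diff_lin_Suc[OF is_complex_large[OF C]]]
          left_module_group[OF lin_cod[OF p]] by (simp add: ag_zero)
      then show "c \<in> (\<lambda>q. ?e n (\<psi> n q)) ` car Q n" using cmap_closed[OF Q(2) mem] by blast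
    qed
  qed (use cmap_closed[OF e] in auto)
  ultimately show ?thesis using that by blast
qed

lemma Complexes_resolution_exists:
  assumes R: "ring R" and U: "module_universe R U" and X: "X \<in> Obj (Complexes R U)"
  shows "\<exists>r. projective_resolution (Complexes R U) X r"
proof (rule projective_resolution_exists[OF _ _ _ _ X])
  note mod = is_complex_module
  fix X assume "X \<in> Obj (Complexes R U)"
  then have "is_complex R U X" by simp
  from enough_projective_complexes[OF R U this]
  obtain P e where P: "projective (Complexes R U) P" "cmap R P X e" "\<And>n. e n ` car P n = car X n" by metis
  have "large_complex R P" using P(1) is_complex_large[of R U P] by (simp add: projective_def)
  then have "(\<lambda>n. restrict (e n) (car P n)) \<in> Epi (Complexes R U) P X"
    using restrict_chain_map[OF P(2)] P(3) by (simp add: Complexes_def)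
  then show "\<exists>P e. projective (Complexes R U) P \<and> e \<in> Epi (Complexes R U) P X" using P(1) by blast
next
  note mod = is_complex_module
  fix X Y :: "('a, 'c) cplx" and f
  assume h: "X \<in> Obj (Complexes R U)" "Y \<in> Obj (Complexes R U)" "f \<in> carrier (Mor (Complexes R U) X Y)"
  then have XY: "is_complex R U X" "is_complex R U Y" by simp_all
  then have f: "cmap R X Y f"
    using h(3) by (simp add: Complexes_def chain_map_group_def chain_map_iff[OF mod[OF XY(1)] mod[OF XY(2)]])
  note K = is_complex_ker[OF U XY(1) is_complex_large[OF XY(2)] f]
  then show "Ker (Complexes R U) X Y f \<in> Obj (Complexes R U)" by (simp add: Complexes_def)
  fix P e assume P: "P \<in> Obj (Complexes R U)" and e: "e \<in> Epi (Complexes R U) P (Ker (Complexes R U) X Y f)"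
  have P': "is_complex R U P" using P by simp
  have "e \<in> chain_map R P (complex_ker X Y f)" using e by (simp add: Complexes_def)
  then have "cmap R P (complex_ker X Y f) e" and ext: "\<forall>n. e n \<in> extensional (car P n)"
    using chain_map_iff[OF mod[OF P'] mod[OF K]] by blast+
  then have "cmap R P X e" using cmap_comp[OF _ cmap_ker_incl[OF is_complex_large[OF XY(1)] f]] by metis
  then show "e \<in> carrier (Mor (Complexes R U) P X)"
    using ext chain_map_iff[OF mod[OF P'] mod[OF XY(1)]] by (simp add: Complexes_def chain_map_group_def)
qed (auto simp: Complexes_def chain_map_group_def)

section \<open>Vanishing of Ext in the category of complexes\<close>

text \<open>\<open>trivial_group\<close> includes being a group, so establishing a trivial Ext group
  requires the group structure on chain maps.\<close>

lemma comm_group_chain_map: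
  assumes C: "large_complex R C" and D: "large_complex R D"
  shows "comm_group (chain_map_group R C D)"
proof -
  let ?G = "chain_map_group R C D"
  have mC: "left_module R (component C n)" and mD: "left_module R (component D n)" for n
    using lin_dom[OF diff_lin[OF C]] lin_dom[OF diff_lin[OF D]] by blast+
  note gD = left_module_group[OF mD]
  have G: "f \<in> carrier ?G \<longleftrightarrow> cmap R C D f \<and> (\<forall>n. f n \<in> extensional (car C n))" for f
    by (simp add: chain_map_group_def chain_map_iff[OF mC mD])
  have mult: "f \<otimes>\<^bsub>?G\<^esub> g = (\<lambda>n. \<lambda>x\<in>car C n. f n x \<oplus>\<^bsub>component D n\<^esub> g n x)" for f g
    by (simp add: chain_map_group_def mod_hom_group_def)
  have one: "\<one>\<^bsub>?G\<^esub> = (\<lambda>n. \<lambda>x\<in>car C n. \<zero>\<^bsub>component D n\<^esub>)"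
    by (simp add: chain_map_group_def mod_hom_group_def)
  have ext: "f = g" if "f \<in> carrier ?G" "g \<in> carrier ?G" "\<And>n x. x \<in> car C n \<Longrightarrow> f n x = g n x" for f g
  proof
    fix n
    show "f n = g n" by (rule extensionalityI[of _ "car C n"]) (use that in \<open>simp_all add: G\<close>)
  qed
  have mem: "(\<lambda>n. restrict (f n) (car C n)) \<in> carrier ?G" if "cmap R C D f" for f
    using restrict_chain_map[OF that C] by (simp add: chain_map_group_def)
  have val: "f n x \<in> car D n" if "f \<in> carrier ?G" "x \<in> car C n" for f n x
    using that cmap_closed[of R C D f x n] by (simp add: G)
  show ?thesis
  proof (rule comm_groupI)
    show one_closed: "\<one>\<^bsub>?G\<^esub> \<in> carrier ?G" unfolding one by (rule mem[OF cmap_zero[OF mC D]])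
    fix f assume f: "f \<in> carrier ?G"
    have fc: "cmap R C D f" using f by (simp add: G)
    show "\<one>\<^bsub>?G\<^esub> \<otimes>\<^bsub>?G\<^esub> f = f"
    proof (rule ext[OF _ f])
      show "\<one>\<^bsub>?G\<^esub> \<otimes>\<^bsub>?G\<^esub> f \<in> carrier ?G"
        unfolding mult one using mem[OF cmap_plus[OF cmap_zero[OF mC D] fc D]] by (simp cong: restrict_cong)
    qed (use val[OF f] gD in \<open>simp add: mult one ag_zero\<close>)
    show "\<exists>g\<in>carrier ?G. g \<otimes>\<^bsub>?G\<^esub> f = \<one>\<^bsub>?G\<^esub>"
    proof
      show "(\<lambda>n. \<lambda>x\<in>car C n. \<zero>\<^bsub>component D n\<^esub> \<ominus>\<^bsub>component D n\<^esub> f n x) \<in> carrier ?G"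
        by (rule mem[OF cmap_minus[OF cmap_zero[OF mC D] fc D]])
      show "(\<lambda>n. \<lambda>x\<in>car C n. \<zero>\<^bsub>component D n\<^esub> \<ominus>\<^bsub>component D n\<^esub> f n x) \<otimes>\<^bsub>?G\<^esub> f = \<one>\<^bsub>?G\<^esub>"
        unfolding mult one
      proof (rule HOL.ext, rule restrict_ext)
        fix n x assume x: "x \<in> car C n"
        then show "(\<lambda>x\<in>car C n. \<zero>\<^bsub>component D n\<^esub> \<ominus>\<^bsub>component D n\<^esub> f n x) x \<oplus>\<^bsub>component D n\<^esub> f n x = \<zero>\<^bsub>component D n\<^esub>"
          using val[OF f x] gD[of n] by (simp add: ag)
      qed
    qed
    fix g assume g: "g \<in> carrier ?G"
    have gc: "cmap R C D g" using g by (simp add: G)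
    show "f \<otimes>\<^bsub>?G\<^esub> g \<in> carrier ?G" unfolding mult by (rule mem[OF cmap_plus[OF fc gc D]])
    show "f \<otimes>\<^bsub>?G\<^esub> g = g \<otimes>\<^bsub>?G\<^esub> f" unfolding mult
    proof (rule HOL.ext, rule restrict_ext)
      show "f n x \<oplus>\<^bsub>component D n\<^esub> g n x = g n x \<oplus>\<^bsub>component D n\<^esub> f n x" if "x \<in> car C n" for n x
        using val[OF f that] val[OF g that] gD[of n] by (simp add: ag)
    qed
    fix h assume h: "h \<in> carrier ?G"
    show "f \<otimes>\<^bsub>?G\<^esub> g \<otimes>\<^bsub>?G\<^esub> h = f \<otimes>\<^bsub>?G\<^esub> (g \<otimes>\<^bsub>?G\<^esub> h)" unfolding mult
    proof (rule HOL.ext)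
      fix n
      have "f n x \<oplus>\<^bsub>component D n\<^esub> g n x \<oplus>\<^bsub>component D n\<^esub> h n x =
          f n x \<oplus>\<^bsub>component D n\<^esub> (g n x \<oplus>\<^bsub>component D n\<^esub> h n x)" if "x \<in> car C n" for x
        using val[OF f that] val[OF g that] val[OF h that] gD[of n] by (simp add: ag)
      then show "(\<lambda>x\<in>car C n. (\<lambda>x\<in>car C n. f n x \<oplus>\<^bsub>component D n\<^esub> g n x) x \<oplus>\<^bsub>component D n\<^esub> h n x) =
        (\<lambda>x\<in>car C n. f n x \<oplus>\<^bsub>component D n\<^esub> (\<lambda>x\<in>car C n. g n x \<oplus>\<^bsub>component D n\<^esub> h n x) x)"
        by (intro restrict_ext) simp
    qed
  qed
qed

lemma trivial_group_Mod_self: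
  assumes "group G" shows "trivial_group (G Mod carrier G)"
proof -
  interpret group G by fact
  have "group (G Mod carrier G)" by (rule normal.factorgroup_is_group[OF normal_self])
  moreover have "rcosets\<^bsub>G\<^esub> (carrier G) = {carrier G}"
    using coset_join2[OF _ subgroup_self] one_closed by (auto simp: RCOSETS_def)
  ultimately show ?thesis by (simp add: trivial_group_def FactGroup_def)
qed

text \<open>A cocycle on \<open>P 1\<close> kills the image of \<open>d 1\<close>, which is
  \<open>ker (d 0)\<close>, and therefore factors through the image of \<open>d 0\<close>, which is
  \<open>ker e\<close>. Extending the factor to \<open>P 0\<close> exhibits the cocycle as a
  coboundary.\<close>

lemma Ext1_trivial_complex:
  assumes R: "ring R" and U: "module_universe R U"
    and X: "is_complex R U X" and Y: "is_complex R U Y"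
    and ext: "\<And>P e f. \<lbrakk>projective (Complexes R U) P; cmap R P X e; \<forall>n. e n ` car P n = car X n;
      cmap R (complex_ker P X e) Y f\<rbrakk> \<Longrightarrow>
      \<exists>g. cmap R P Y g \<and> (\<forall>n. \<forall>p\<in>car P n. e n p = \<zero>\<^bsub>component X n\<^esub> \<longrightarrow> g n p = f n p)"
  shows "trivial_group (Ext1 (Complexes R U) X Y)"
proof -
  let ?A = "Complexes R U"
  have XO: "X \<in> Obj ?A" using X by simp
  obtain P d e where ch: "chosen_resolution ?A X = (P, d, e)" and res: "projective_resolution ?A X (P, d, e)"
    using chosen_resolution[OF Complexes_resolution_exists[OF R U XO]] .
  have pr: "projective ?A (P n)" for n using res by (simp add: projective_resolution_def)
  then have P: "is_complex R U (P n)" for n by (simp add: projective_def)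
  note lP = is_complex_large[OF P] and lX = is_complex_large[OF X] and lY = is_complex_large[OF Y]
  have Epi: "cmap R C D f \<and> (\<forall>n. f n ` car C n = car D n)"
    if "f \<in> Epi ?A C D" "large_complex R C" "large_complex R D" for C D f
    using that(1) chain_map_iff[OF lin_dom[OF diff_lin[OF that(2)]] lin_dom[OF diff_lin[OF that(3)]]]
    by (simp add: Complexes_def)
  have Ker: "Ker ?A = complex_ker" by (simp add: Complexes_def)
  have e: "cmap R (P 0) X e" "\<forall>n. e n ` car (P 0) n = car X n"
    using res Epi[OF _ lP lX] by (auto simp: projective_resolution_def)
  let ?N = "complex_ker (P 0) X e"
  note lN = large_complex_ker[OF lP lX e(1)]
  have d0: "cmap R (P 1) ?N (d 0)" "\<forall>n. d 0 n ` car (P 1) n = car ?N n"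
    using res Epi[OF _ lP lN] by (auto simp: projective_resolution_def Ker)
  have d0': "cmap R (P 1) (P 0) (d 0)"
    using cmap_comp[OF d0(1) cmap_ker_incl[OF lP e(1)]] by simp
  let ?N1 = "complex_ker (P 1) (P 0) (d 0)"
  have "d 1 \<in> Epi ?A (P 2) ?N1"
    using res unfolding projective_resolution_def prod.case Ker by (metis One_nat_def numeral_2_eq_2)
  then have d1: "cmap R (P 2) ?N1 (d 1)" "\<forall>n. d 1 n ` car (P 2) n = car ?N1 n"
    using Epi[OF _ lP large_complex_ker[OF lP lP d0']] by blast+
  have d1': "cmap R (P 2) (P 1) (d 1)"
    using cmap_comp[OF d1(1) cmap_ker_incl[OF lP d0']] by simp
  let ?G = "Mor ?A (P 1) Y" and ?H = "Mor ?A (P 2) Y"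
  let ?r = "\<lambda>f. Comp ?A (P 2) f (d 1)"
  let ?Z = "kernel ?G ?H ?r"
  let ?B = "(\<lambda>f. Comp ?A (P 1) f (d 0)) ` carrier (Mor ?A (P 0) Y)"
  have Mor: "f \<in> carrier (Mor ?A C Y) \<longleftrightarrow> cmap R C Y f \<and> (\<forall>n. f n \<in> extensional (car C n))"
    if "is_complex R U C" for C f
    using chain_map_iff[OF is_complex_module[OF that] is_complex_module[OF Y]]
    by (simp add: Complexes_def chain_map_group_def)
  have one: "\<one>\<^bsub>Mor ?A C Y\<^esub> = (\<lambda>n. \<lambda>x\<in>car C n. \<zero>\<^bsub>component Y n\<^esub>)" for C
    by (simp add: Complexes_def chain_map_group_def mod_hom_group_def)
  have Comp: "Comp ?A C f g = (\<lambda>n. \<lambda>x\<in>car C n. f n (g n x))" for C :: "('a, 'c) cplx" and f g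
    by (simp add: Complexes_def compose_def)
  have restr: "(\<lambda>n. restrict (f n) (car C n)) \<in> carrier (Mor ?A C Y)" if "cmap R C Y f" "is_complex R U C" for f C
    using restrict_chain_map[OF that(1) is_complex_large[OF that(2)]] by (simp add: Complexes_def chain_map_group_def)
  have ggroup: "group (Mor ?A (P i) Y)" for i
    using comm_group_chain_map[OF lP lY] by (simp add: Complexes_def comm_group_def)
  have "group_hom ?G ?H ?r"
  proof (intro group_hom.intro ggroup group_hom_axioms.intro homI)
    fix f g assume f: "f \<in> carrier ?G" "g \<in> carrier ?G"
    show "?r f \<in> carrier ?H"
      using restr[OF cmap_comp[OF d1']] f(1) P by (simp add: Mor Comp)
    show "?r (f \<otimes>\<^bsub>?G\<^esub> g) = ?r f \<otimes>\<^bsub>?H\<^esub> ?r g"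
      using cmap_closed[OF d1'] by (auto simp: Comp) (auto simp: Complexes_def chain_map_group_def mod_hom_group_def intro!: HOL.ext)
  qed
  then have "subgroup ?Z ?G" by (rule group_hom.subgroup_kernel)
  then have grp: "group (?G\<lparr>carrier := ?Z\<rparr>)" by (rule subgroup.subgroup_is_group[OF _ ggroup])
  have "?Z = ?B"
  proof
    show "?B \<subseteq> ?Z"
    proof
      fix z assume "z \<in> ?B"
      then obtain g where g: "cmap R (P 0) Y g" "z = Comp ?A (P 1) g (d 0)" using P by (auto simp: Mor)
      have "z \<in> carrier ?G" using restr[OF cmap_comp[OF d0' g(1)] P] g(2) by (simp add: Comp)
      moreover have "?r z = \<one>\<^bsub>?H\<^esub>"
      proof (unfold Comp one, rule HOL.ext, rule restrict_ext)
        fix n x assume x: "x \<in> car (P 2) n"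
        have "d 1 n x \<in> car (P 1) n" "d 0 n (d 1 n x) = \<zero>\<^bsub>component (P 0) n\<^esub>"
          using cmap_closed[OF d1(1) x] by simp_all
        then show "z n (d 1 n x) = \<zero>\<^bsub>component Y n\<^esub>"
          using g(2) linD(4)[OF cmap_lin[OF g(1)]] by (simp add: Comp)
      qed
      ultimately show "z \<in> ?Z" by (simp add: kernel_def)
    qed
    show "?Z \<subseteq> ?B"
    proof
      fix z assume "z \<in> ?Z"
      then have z: "cmap R (P 1) Y z" "\<And>n. z n \<in> extensional (car (P 1) n)" and zd: "?r z = \<one>\<^bsub>?H\<^esub>"
        using P by (simp_all add: kernel_def Mor)
      have zk: "z n w = \<zero>\<^bsub>component Y n\<^esub>"
        if w: "w \<in> car (P 1) n" "d 0 n w = \<zero>\<^bsub>component ?N n\<^esub>" for n w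
      proof -
        have "w \<in> d 1 n ` car (P 2) n" using w d1(2) by simp
        then obtain v where v: "v \<in> car (P 2) n" "w = d 1 n v" by blast
        then show ?thesis using fun_cong[OF fun_cong[OF zd, of n], of v] by (simp add: Comp one)
      qed
      \<comment> \<open>The factor is found in each degree separately; it commutes with the
        differentials because \<open>d 0\<close> is onto and both \<open>d 0\<close> and
        \<open>z\<close> are chain maps.\<close>
      have "\<exists>f. lin R (component ?N n) (component Y n) f \<and> (\<forall>w\<in>car (P 1) n. f (d 0 n w) = z n w)" for n
        by (rule lin_factor[OF cmap_lin[OF d0(1)] d0(2)[rule_format] cmap_lin[OF z(1)] zk]) blast+
      then obtain f where f: "\<And>n. lin R (component ?N n) (component Y n) (f n)"
        "\<And>n w. w \<in> car (P 1) n \<Longrightarrow> f n (d 0 n w) = z n w" by metis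
      have "cmap R ?N Y f"
      proof (rule cmapI[OF f(1)])
        fix n x assume "x \<in> car ?N n"
        then have "x \<in> d 0 n ` car (P 1) n" using d0(2) by simp
        then obtain w where w: "w \<in> car (P 1) n" "x = d 0 n w" by blast
        show "f (n - 1) (diff ?N n x) = diff Y n (f n x)"
          using cmap_diff[OF d0(1) w(1)] f(2)[OF linD(1)[OF diff_lin[OF lP] w(1)]] cmap_diff[OF z(1) w(1)] f(2)[OF w(1)] w(2)
          by (simp del: complex_ker_simps)
      qed
      then obtain g where g: "cmap R (P 0) Y g" "\<And>n p. p \<in> car (P 0) n \<Longrightarrow> e n p = \<zero>\<^bsub>component X n\<^esub> \<Longrightarrow> g n p = f n p"
        using ext[OF pr e] by blast
      have "z = Comp ?A (P 1) (\<lambda>n. restrict (g n) (car (P 0) n)) (d 0)"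
      proof (unfold Comp, rule HOL.ext, rule extensionalityI[of _ "car (P 1) _"])
        fix n x assume x: "x \<in> car (P 1) n"
        have "d 0 n x \<in> car (P 0) n" "e n (d 0 n x) = \<zero>\<^bsub>component X n\<^esub>" using cmap_closed[OF d0(1) x] by simp_all
        then show "z n x = (\<lambda>x\<in>car (P 1) n. restrict (g n) (car (P 0) n) (d 0 n x)) x"
          using x g(2) f(2)[OF x] by simp
      qed (use z(2) in auto)
      then show "z \<in> ?B" using restr[OF g(1) P] by blast
    qed
  qed
  \<comment> \<open>Cocycles and coboundaries coincide, so Ext is a group modulo itself.\<close>
  then have "Ext1 ?A X Y = (?G\<lparr>carrier := ?Z\<rparr>) Mod carrier (?G\<lparr>carrier := ?Z\<rparr>)"
    by (simp add: Ext1_def ch Let_def)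
  then show ?thesis using trivial_group_Mod_self[OF grp] by simp
qed

section \<open>A lifting property\<close>

lemma tildeD:
  assumes "A \<in> tilde R U L"
  shows "is_complex R U A" "exact_complex A" "cycles A n \<in> L"
  using assms by (simp_all add: tilde_def)

text \<open>The kernel of \<open>P\<^sub>n \<rightarrow> A\<^sub>n \<rightarrow> Z\<^bsub>n-1\<^esub>(A)\<close> is \<open>ker e\<^sub>n + B\<^sub>n(P)\<close> because \<open>A\<close> is exact, so \<open>f\<close> first
  extends by zero on boundaries and then to all of \<open>P\<^sub>n\<close>.\<close>

lemma extend_from_kernel:
  assumes A: "A \<in> tilde R U L" and P: "is_complex R U P"
    and e: "cmap R P A e" and onto: "\<And>n. e n ` car P n = car A n"
    and S: "ext_orthogonal R U L S"
    and f: "lin R (mod_ker (component P n) (component A n) (e n)) S f"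
    and f0: "\<And>x. \<lbrakk>x \<in> car P (n + 1); e (n + 1) x = \<zero>\<^bsub>component A (n + 1)\<^esub>\<rbrakk> \<Longrightarrow> f (diff P (n + 1) x) = \<zero>\<^bsub>S\<^esub>"
  obtains g where "lin R (component P n) S g"
    "\<And>x. x \<in> car P (n + 1) \<Longrightarrow> g (diff P (n + 1) x) = \<zero>\<^bsub>S\<^esub>"
    "\<And>x. \<lbrakk>x \<in> car P n; e n x = \<zero>\<^bsub>component A n\<^esub>\<rbrakk> \<Longrightarrow> g x = f x"
proof -
  note A' = tildeD[OF A]
  note lA = is_complex_large[OF A'(1)] and lP = is_complex_large[OF P]
  let ?P = "component P n" and ?P1 = "component P (n + 1)" and ?d = "diff P (n + 1)" and ?e = "e n"
  let ?A = "component A n" and ?Z = "cycles A (n - 1)"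
  \<comment> \<open>An epimorphism onto a cycle module of \<open>A\<close>, a member of
    \<open>L\<close>, so \<open>S\<close> permits extension from its kernel \<open>?K\<close> to all
    of \<open>P n\<close>.\<close>
  let ?q = "\<lambda>x. diff A n (e n x)"
  note mS = lin_cod[OF f]
  note d = diff_lin_Suc[OF lP, of n] and en = cmap_lin[OF e, of n]
  note mP = lin_cod[OF d] and mP1 = lin_dom[OF d]
  note g = left_module_group[OF mS] left_module_group[OF mP] left_module_group[OF mP1] lin_cod_group[OF en]
  note F = linD[OF f, simplified]
  note D = linD[OF d] and E = linD[OF en]
  have q: "lin R ?P ?Z ?q" unfolding cycles_def
    by (rule lin_ker_cod[OF lin_comp[OF en diff_lin[OF lA]] diff_lin[OF lA]])
      (simp add: diff_diff[OF lA] E(1))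
  have q_on: "?q ` carrier ?P = carrier ?Z"
  proof
    show "carrier ?Z \<subseteq> ?q ` carrier ?P"
    proof
      fix z assume "z \<in> carrier ?Z"
      then have "z \<in> car A (n - 1)" "diff A (n - 1) z = \<zero>\<^bsub>component A (n - 1 - 1)\<^esub>" by (simp_all add: cycles_def)
      then obtain a where a: "a \<in> car A n" "diff A n a = z"
        using exact_complexD[OF A'(2), of z "n - 1"] by auto
      then have "a \<in> ?e ` carrier ?P" using onto by simp
      then show "z \<in> ?q ` carrier ?P" using a(2) by blast
    qed
  qed (use linD(1)[OF q] in blast)
  let ?K = "mod_ker ?P ?Z ?q"
  have K: "x \<in> carrier ?K \<longleftrightarrow> x \<in> carrier ?P \<and> diff A n (e n x) = \<zero>\<^bsub>component A (n - 1)\<^esub>" for x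
    by (simp add: cycles_def)
  \<comment> \<open>For \<open>x\<close> in \<open>?K\<close> the element \<open>e n x\<close> is a
    cycle, hence a boundary, of \<open>A\<close>. Lifting the bounding element to \<open>P\<close>
    gives \<open>p\<close> such that \<open>x - d p\<close> lies in
    \<open>ker (e n)\<close>.\<close>
  have lift: "\<exists>p\<in>carrier ?P1. e n (?d p) = e n x" if x: "x \<in> carrier ?K" for x
  proof -
    obtain a where a: "a \<in> car A (n + 1)" "diff A (n + 1) a = e n x"
      using exact_complexD[OF A'(2), of "e n x" n] x E(1) K by blast
    then have "a \<in> e (n + 1) ` carrier ?P1" using onto by simp
    then obtain p where "p \<in> carrier ?P1" "a = e (n + 1) p" by blast
    then show ?thesis using a(2) cmap_diff_Suc[OF e] by auto
  qed
  \<comment> \<open>Zero on boundaries and \<open>f\<close> on the kernel agree where both apply. If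
    \<open>e (d p) = 0\<close>, then \<open>e p\<close> is a cycle of \<open>A\<close>, hence the
    image under \<open>e\<close> of a boundary \<open>?b\<close> of \<open>P\<close>; now
    \<open>p - ?b\<close> lies in the kernel and has the same differential as \<open>p\<close>, so
    \<open>f0\<close> applies.\<close>
  have fB: "f (?d p) = \<zero>\<^bsub>S\<^esub>" if p: "p \<in> carrier ?P1" "e n (?d p) = \<zero>\<^bsub>?A\<^esub>" for p
  proof -
    have "diff A (n + 1) (e (n + 1) p) = \<zero>\<^bsub>component A (n + 1 - 1)\<^esub>" using p cmap_diff_Suc[OF e] by simp
    then obtain a where a: "a \<in> car A (n + 1 + 1)" "diff A (n + 1 + 1) a = e (n + 1) p"
      using exact_complexD[OF A'(2) cmap_closed[OF e p(1)]] by blast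
    then have "a \<in> e (n + 1 + 1) ` car P (n + 1 + 1)" using onto[of "n + 1 + 1"] by simp
    then obtain r where r: "r \<in> car P (n + 1 + 1)" "a = e (n + 1 + 1) r" by blast
    let ?b = "diff P (n + 1 + 1) r"
    have b: "?b \<in> carrier ?P1" using linD(1)[OF diff_lin_Suc[OF lP] r(1)] .
    have eb: "e (n + 1) ?b = e (n + 1) p" using a r cmap_diff_Suc[OF e r(1)] by simp
    have "?d ?b = \<zero>\<^bsub>?P\<^esub>" using diff_diff_Suc[OF lP r(1)] by simp
    then have "?d (p \<ominus>\<^bsub>?P1\<^esub> ?b) = ?d p" using D p(1) b g by (simp add: ag)
    moreover have "f (?d (p \<ominus>\<^bsub>?P1\<^esub> ?b)) = \<zero>\<^bsub>S\<^esub>"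
      using p(1) b eb g linD(6)[OF cmap_lin[OF e] p(1) b] linD(1)[OF cmap_lin[OF e] b] lin_cod_group[OF cmap_lin[OF e, of "n + 1"]]
      by (intro f0) (simp_all add: ag_closed ag_zero a_minus_def)
    ultimately show ?thesis by simp
  qed
  define k where "k x p = x \<ominus>\<^bsub>?P\<^esub> ?d p" for x p
  have k: "k x p \<in> carrier ?P" "e n (k x p) = \<zero>\<^bsub>?A\<^esub>" if "x \<in> carrier ?P" "p \<in> carrier ?P1" "e n (?d p) = e n x" for x p
    using that D E g by (simp_all add: k_def ag)
  \<comment> \<open>The map that is zero on boundaries and \<open>f\<close> on the kernel of
    \<open>e n\<close>, as a relation; \<open>lift\<close> makes it total and \<open>fB\<close>
    single-valued.\<close>
  define G where "G x y \<longleftrightarrow> (\<exists>p\<in>carrier ?P1. e n (?d p) = e n x \<and> y = f (k x p))" for x y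
  have "\<exists>h. lin R ?K S h \<and> (\<forall>x\<in>carrier ?K. \<forall>y\<in>carrier S. G x y = (y = h x))"
  proof (rule lin_of_relation[OF left_module_ker[OF q] mS])
    fix x assume x: "x \<in> carrier ?K"
    then obtain p where p: "p \<in> carrier ?P1" "e n (?d p) = e n x" using lift by blast
    have "x \<in> carrier ?P" using x by simp
    then have "f (k x p) \<in> carrier S" using k[OF _ p] F(1) by blast
    then show "\<exists>y\<in>carrier S. G x y" using p unfolding G_def by blast
  next
    fix x y x' y' assume "x \<in> carrier ?K" "x' \<in> carrier ?K" and "G x y" "G x' y'"
    then obtain p p' where x: "x \<in> carrier ?P" "x' \<in> carrier ?P"
      and p: "p \<in> carrier ?P1" "e n (?d p) = e n x" "y = f (k x p)"
      and p': "p' \<in> carrier ?P1" "e n (?d p') = e n x'" "y' = f (k x' p')" unfolding G_def by auto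
    have "k (x \<oplus>\<^bsub>?P\<^esub> x') (p \<oplus>\<^bsub>?P1\<^esub> p') = k x p \<oplus>\<^bsub>?P\<^esub> k x' p'"
      using x p(1) p'(1) D(1,2) g by (simp add: k_def ag)
    then have "y \<oplus>\<^bsub>S\<^esub> y' = f (k (x \<oplus>\<^bsub>?P\<^esub> x') (p \<oplus>\<^bsub>?P1\<^esub> p'))"
      using F(2)[of "k x p" "k x' p'"] k[OF x(1) p(1,2)] k[OF x(2) p'(1,2)] p(3) p'(3) by simp
    then have "G (x \<oplus>\<^bsub>?P\<^esub> x') (y \<oplus>\<^bsub>S\<^esub> y')"
      using x p(1,2) p'(1,2) D(1,2) E(2) g unfolding G_def
      by (intro bexI[of _ "p \<oplus>\<^bsub>?P1\<^esub> p'"]) (simp_all add: ag_closed)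
    then show "G (x \<oplus>\<^bsub>?K\<^esub> x') (y \<oplus>\<^bsub>S\<^esub> y')" by simp
  next
    fix a x y assume a: "a \<in> carrier R" and "x \<in> carrier ?K" and "G x y"
    then obtain p where x: "x \<in> carrier ?P" and p: "p \<in> carrier ?P1" "e n (?d p) = e n x" "y = f (k x p)"
      unfolding G_def by auto
    have "k (a \<odot>\<^bsub>?P\<^esub> x) (a \<odot>\<^bsub>?P1\<^esub> p) = a \<odot>\<^bsub>?P\<^esub> k x p"
      using a x p(1) D(1,3) g left_module_smult[OF mP] smult_minus[OF mP] by (simp add: k_def ag_closed a_minus_def)
    then have "a \<odot>\<^bsub>S\<^esub> y = f (k (a \<odot>\<^bsub>?P\<^esub> x) (a \<odot>\<^bsub>?P1\<^esub> p))"
      using F(3)[OF a, of "k x p"] k[OF x p(1,2)] p(3) by simp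
    then have "G (a \<odot>\<^bsub>?P\<^esub> x) (a \<odot>\<^bsub>S\<^esub> y)"
      using a x p(1,2) D(1,3) E(3) left_module_smult[OF mP1] unfolding G_def
      by (intro bexI[of _ "a \<odot>\<^bsub>?P1\<^esub> p"]) simp_all
    then show "G (a \<odot>\<^bsub>?K\<^esub> x) (a \<odot>\<^bsub>S\<^esub> y)" by simp
  next
    fix y assume "G \<zero>\<^bsub>?K\<^esub> y"
    then obtain p where p: "p \<in> carrier ?P1" "e n (?d p) = \<zero>\<^bsub>?A\<^esub>" "y = f (k \<zero>\<^bsub>?P\<^esub> p)"
      using E(4) unfolding G_def by auto
    have "k \<zero>\<^bsub>?P\<^esub> p = ?d (\<ominus>\<^bsub>?P1\<^esub> p)" using p(1) D g by (simp add: k_def ag)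
    moreover have "f (?d (\<ominus>\<^bsub>?P1\<^esub> p)) = \<zero>\<^bsub>S\<^esub>"
      using p D E g by (intro fB) (simp_all add: ag_closed ag_zero)
    ultimately show "y = \<zero>\<^bsub>S\<^esub>" using p(3) by simp
  qed
  then obtain h where h: "lin R ?K S h" "\<forall>x\<in>carrier ?K. \<forall>y\<in>carrier S. G x y = (y = h x)" by (elim exE conjE)
  obtain u where u: "lin R ?P S u" "\<And>x. x \<in> carrier ?P \<Longrightarrow> ?q x = \<zero>\<^bsub>?Z\<^esub> \<Longrightarrow> u x = h x"
    by (rule ext_orthogonalD[OF S A'(3) is_complex_component[OF P] q q_on h(1)]) blast
  have uh: "u x = y" if "x \<in> carrier ?K" "y \<in> carrier S" "G x y" for x y
    using u(2) h(2) that by auto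
  have "u (?d x) = \<zero>\<^bsub>S\<^esub>" if x: "x \<in> carrier ?P1" for x
  proof (rule uh)
    show "?d x \<in> carrier ?K"
      using x D(1) cmap_diff_Suc[OF e x] diff_diff_Suc[OF lA cmap_closed[OF e x]] unfolding K by simp
    \<comment> \<open>For the boundary of \<open>x\<close> the correcting element is
      \<open>x\<close> itself; for an element of the kernel it is zero.\<close>
    have "k (?d x) x = \<zero>\<^bsub>?P\<^esub>" using D(1)[OF x] g by (simp add: k_def ag)
    then show "G (?d x) \<zero>\<^bsub>S\<^esub>" unfolding G_def using F(4) x by (intro bexI[of _ x]) simp_all
  qed (use g in \<open>simp add: ag_closed\<close>)
  moreover have "u x = f x" if x: "x \<in> carrier ?P" "e n x = \<zero>\<^bsub>?A\<^esub>" for x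
  proof (rule uh)
    show "x \<in> carrier ?K" using x linD(4)[OF diff_lin[OF lA]] unfolding K by simp
    show "f x \<in> carrier S" using F(1) x by simp
    have "k x \<zero>\<^bsub>?P1\<^esub> = x" using x D(4) g by (simp add: k_def ag)
    then show "G x (f x)" unfolding G_def using x D(4) E(4) g
      by (intro bexI[of _ "\<zero>\<^bsub>?P1\<^esub>"]) (simp_all add: ag_closed)
  qed
  ultimately show ?thesis using that u(1) by blast
qed

text \<open>The right lifting property of \<open>\<pi>\<close> against the inclusions of
  \<open>ker e\<close> into \<open>P\<close>, with \<open>P\<close> projective over a member of
  \<open>tilde R U L\<close>. For epimorphisms it encodes orthogonality of the kernel, in a form
  that composes and passes to inverse limits.\<close>

definition right_lifting ::
  "('r, 'a) ring_scheme \<Rightarrow> 'm set set \<Rightarrow> ('r, 'm) module set \<Rightarrow> ('r, 'm) cplx \<Rightarrow> ('r, 'm) cplx \<Rightarrow> (int \<Rightarrow> 'm \<Rightarrow> 'm) \<Rightarrow> bool" where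
  "right_lifting R U L X Y \<pi> \<longleftrightarrow> (\<forall>P A e f g.
     projective (Complexes R U) P \<longrightarrow> A \<in> tilde R U L \<longrightarrow> cmap R P A e \<longrightarrow> (\<forall>n. e n ` car P n = car A n) \<longrightarrow>
     cmap R (complex_ker P A e) X f \<longrightarrow> cmap R P Y g \<longrightarrow>
     (\<forall>n. \<forall>x\<in>car P n. e n x = \<zero>\<^bsub>component A n\<^esub> \<longrightarrow> \<pi> n (f n x) = g n x) \<longrightarrow>
     (\<exists>h. cmap R P X h \<and> (\<forall>n. \<forall>x\<in>car P n. \<pi> n (h n x) = g n x) \<and>
        (\<forall>n. \<forall>x\<in>car P n. e n x = \<zero>\<^bsub>component A n\<^esub> \<longrightarrow> h n x = f n x)))"

lemma right_liftingD:
  assumes "right_lifting R U L X Y \<pi>" "projective (Complexes R U) P" "A \<in> tilde R U L" "cmap R P A e"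
    "\<And>n. e n ` car P n = car A n" "cmap R (complex_ker P A e) X f" "cmap R P Y g"
    "\<And>n x. x \<in> car P n \<Longrightarrow> e n x = \<zero>\<^bsub>component A n\<^esub> \<Longrightarrow> \<pi> n (f n x) = g n x"
  obtains h where "cmap R P X h" "\<And>n x. x \<in> car P n \<Longrightarrow> \<pi> n (h n x) = g n x"
    "\<And>n x. x \<in> car P n \<Longrightarrow> e n x = \<zero>\<^bsub>component A n\<^esub> \<Longrightarrow> h n x = f n x"
proof -
  have "\<exists>h. cmap R P X h \<and> (\<forall>n. \<forall>x\<in>car P n. \<pi> n (h n x) = g n x) \<and>
        (\<forall>n. \<forall>x\<in>car P n. e n x = \<zero>\<^bsub>component A n\<^esub> \<longrightarrow> h n x = f n x)"
    by (rule assms(1)[unfolded right_lifting_def, rule_format, OF assms(2-4) _ assms(6,7)])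
      (use assms(5,8) in simp_all)
  then show ?thesis using that by (elim exE conjE) simp
qed

text \<open>The square is lifted through \<open>\<rho>\<close>, with \<open>\<pi> \<circ> f\<close>
  prescribed on \<open>ker e\<close>, and the result is lifted through \<open>\<pi>\<close>.\<close>

lemma right_lifting_comp:
  assumes "right_lifting R U L X Y \<pi>" "right_lifting R U L Y Z \<rho>" "cmap R X Y \<pi>"
  shows "right_lifting R U L X Z (\<lambda>n x. \<rho> n (\<pi> n x))"
  unfolding right_lifting_def
proof (intro allI impI)
  fix P A e f g
  assume h: "projective (Complexes R U) P" "A \<in> tilde R U L" "cmap R P A e" "\<forall>n. e n ` car P n = car A n"
    "cmap R (complex_ker P A e) X f" "cmap R P Z g"
    "\<forall>n. \<forall>x\<in>car P n. e n x = \<zero>\<^bsub>component A n\<^esub> \<longrightarrow> \<rho> n (\<pi> n (f n x)) = g n x"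
  obtain k where k: "cmap R P Y k" "\<And>n x. x \<in> car P n \<Longrightarrow> \<rho> n (k n x) = g n x"
    "\<And>n x. x \<in> car P n \<Longrightarrow> e n x = \<zero>\<^bsub>component A n\<^esub> \<Longrightarrow> k n x = \<pi> n (f n x)"
    by (rule right_liftingD[OF assms(2) h(1-3) h(4)[rule_format] cmap_comp[OF h(5) assms(3)] h(6)])
      (use h(7) in simp_all)
  obtain l where l: "cmap R P X l" "\<And>n x. x \<in> car P n \<Longrightarrow> \<pi> n (l n x) = k n x"
    "\<And>n x. x \<in> car P n \<Longrightarrow> e n x = \<zero>\<^bsub>component A n\<^esub> \<Longrightarrow> l n x = f n x"
    by (rule right_liftingD[OF assms(1) h(1-3) h(4)[rule_format] h(5) k(1)]) (use k(3) in simp_all)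
  show "\<exists>h. cmap R P X h \<and> (\<forall>n. \<forall>x\<in>car P n. \<rho> n (\<pi> n (h n x)) = g n x) \<and>
    (\<forall>n. \<forall>x\<in>car P n. e n x = \<zero>\<^bsub>component A n\<^esub> \<longrightarrow> h n x = f n x)"
    by (rule exI[of _ l]) (use l k in simp)
qed

text \<open>By dimension shifting along a projective resolution of \<open>A\<close>, this says \<open>Ext\<^sup>1(A, K) = 0\<close> for all
  \<open>A\<close> in the class of exact complexes with cycles in \<open>L\<close>.\<close>

definition tilde_orthogonal ::
  "('r, 'a) ring_scheme \<Rightarrow> 'm set set \<Rightarrow> ('r, 'm) module set \<Rightarrow> ('r, 'm) cplx \<Rightarrow> bool" where
  "tilde_orthogonal R U L K \<longleftrightarrow> (\<forall>P A e f.
     projective (Complexes R U) P \<longrightarrow> A \<in> tilde R U L \<longrightarrow> cmap R P A e \<longrightarrow> (\<forall>n. e n ` car P n = car A n) \<longrightarrow>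
     cmap R (complex_ker P A e) K f \<longrightarrow>
     (\<exists>h. cmap R P K h \<and> (\<forall>n. \<forall>x\<in>car P n. e n x = \<zero>\<^bsub>component A n\<^esub> \<longrightarrow> h n x = f n x)))"

lemma tilde_orthogonalD:
  assumes "tilde_orthogonal R U L K" "projective (Complexes R U) P" "A \<in> tilde R U L" "cmap R P A e"
    "\<forall>n. e n ` car P n = car A n" "cmap R (complex_ker P A e) K f"
  obtains h where "cmap R P K h" "\<And>n x. x \<in> car P n \<Longrightarrow> e n x = \<zero>\<^bsub>component A n\<^esub> \<Longrightarrow> h n x = f n x"
proof -
  have "\<exists>h. cmap R P K h \<and> (\<forall>n. \<forall>x\<in>car P n. e n x = \<zero>\<^bsub>component A n\<^esub> \<longrightarrow> h n x = f n x)"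
    by (rule assms(1)[unfolded tilde_orthogonal_def, rule_format, OF assms(2-4) _ assms(6)])
      (use assms(5) in simp)
  then show ?thesis using that by (elim exE conjE) simp
qed

text \<open>Projectivity lifts \<open>g\<close> without regard to \<open>f\<close>. The error on
  \<open>ker e\<close> takes values in \<open>ker \<pi>\<close>, extends to \<open>P\<close> by
  orthogonality and is added to the lift.\<close>

lemma right_lifting_if_kernel:
  assumes X: "is_complex R U X" and Y: "is_complex R U Y" and \<pi>: "cmap R X Y \<pi>"
    and onto: "\<And>n. \<pi> n ` car X n = car Y n"
    and K: "tilde_orthogonal R U L (complex_ker X Y \<pi>)"
  shows "right_lifting R U L X Y \<pi>"
  unfolding right_lifting_def
proof (intro allI impI)
  fix P A e f g
  assume h: "projective (Complexes R U) P" "A \<in> tilde R U L" "cmap R P A e" "\<forall>n. e n ` car P n = car A n"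
    "cmap R (complex_ker P A e) X f" "cmap R P Y g"
    "\<forall>n. \<forall>x\<in>car P n. e n x = \<zero>\<^bsub>component A n\<^esub> \<longrightarrow> \<pi> n (f n x) = g n x"
  have P: "is_complex R U P" using h(1) by (simp add: projective_def)
  note lP = is_complex_large[OF P] and lX = is_complex_large[OF X]
  obtain g0 where g0: "cmap R P X g0" "\<And>n p. p \<in> car P n \<Longrightarrow> \<pi> n (g0 n p) = g n p"
    by (rule projective_complex_lift[OF h(1) X Y \<pi> onto h(6)]) (erule that, blast)
  let ?N = "complex_ker P A e" and ?K = "complex_ker X Y \<pi>"
  let ?f = "\<lambda>n x. f n x \<ominus>\<^bsub>component X n\<^esub> g0 n x"
  note gX = left_module_group[OF is_complex_module[OF X]] and gY = left_module_group[OF is_complex_module[OF Y]]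
  have f1: "cmap R ?N ?K ?f"
  proof (rule cmap_ker_cod[OF cmap_minus[OF h(5) cmap_ker_dom[OF lP h(3) g0(1)] lX] \<pi>])
    fix n x assume x: "x \<in> car ?N n"
    then show "\<pi> n (?f n x) = \<zero>\<^bsub>component Y n\<^esub>"
      using h(7) g0(2) linD(6)[OF cmap_lin[OF \<pi>] cmap_closed[OF h(5) x] cmap_closed[OF g0(1)]]
        cmap_closed[OF h(6)] gY by (simp add: ag)
  qed
  obtain u where u: "cmap R P ?K u" "\<And>n x. x \<in> car P n \<Longrightarrow> e n x = \<zero>\<^bsub>component A n\<^esub> \<Longrightarrow> u n x = ?f n x"
    by (rule tilde_orthogonalD[OF K h(1-4) f1]) (erule that, blast)
  have cu: "cmap R P X u" using cmap_comp[OF u(1) cmap_ker_incl[OF lX \<pi>]] by simp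
  have uK: "u n x \<in> car X n" "\<pi> n (u n x) = \<zero>\<^bsub>component Y n\<^esub>" if "x \<in> car P n" for n x
    using cmap_closed[OF u(1) that] by simp_all
  let ?h = "\<lambda>n x. g0 n x \<oplus>\<^bsub>component X n\<^esub> u n x"
  have "\<pi> n (?h n x) = g n x" if x: "x \<in> car P n" for n x
    using linD(2)[OF cmap_lin[OF \<pi>] cmap_closed[OF g0(1) x] uK(1)[OF x]] uK(2)[OF x] g0(2)[OF x]
      cmap_closed[OF h(6) x] gY by (simp add: ag_zero)
  moreover have "?h n x = f n x" if x: "x \<in> car P n" "e n x = \<zero>\<^bsub>component A n\<^esub>" for n x
  proof -
    have "x \<in> car ?N n" using x by simp
    then show ?thesis
      using u(2)[OF x] cmap_closed[OF g0(1) x(1)] cmap_closed[OF h(5)] gX[of n] by (simp add: ag)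
  qed
  ultimately show "\<exists>h. cmap R P X h \<and> (\<forall>n. \<forall>x\<in>car P n. \<pi> n (h n x) = g n x) \<and>
    (\<forall>n. \<forall>x\<in>car P n. e n x = \<zero>\<^bsub>component A n\<^esub> \<longrightarrow> h n x = f n x)"
    using cmap_plus[OF g0(1) cu lX] by (intro exI[of _ ?h]) simp
qed

text \<open>A map from \<open>ker e\<close> to \<open>ker \<pi>\<close> is a lifting problem over
  the zero map, and its solutions take values in \<open>ker \<pi>\<close>.\<close>

lemma kernel_if_right_lifting:
  assumes lift: "right_lifting R U L X Y \<pi>" and X: "is_complex R U X" and Y: "is_complex R U Y"
    and \<pi>: "cmap R X Y \<pi>"
  shows "tilde_orthogonal R U L (complex_ker X Y \<pi>)"
  unfolding tilde_orthogonal_def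
proof (intro allI impI)
  fix P A e f
  assume h: "projective (Complexes R U) P" "A \<in> tilde R U L" "cmap R P A e" "\<forall>n. e n ` car P n = car A n"
    and f: "cmap R (complex_ker P A e) (complex_ker X Y \<pi>) f"
  note lX = is_complex_large[OF X] and lY = is_complex_large[OF Y]
  have "is_complex R U P" using h(1) by (simp add: projective_def)
  then have z: "cmap R P Y (\<lambda>n x. \<zero>\<^bsub>component Y n\<^esub>)" by (intro cmap_zero is_complex_module lY)
  have fX: "cmap R (complex_ker P A e) X f" using cmap_comp[OF f cmap_ker_incl[OF lX \<pi>]] by simp
  obtain k where k: "cmap R P X k" "\<And>n x. x \<in> car P n \<Longrightarrow> \<pi> n (k n x) = \<zero>\<^bsub>component Y n\<^esub>"
    "\<And>n x. x \<in> car P n \<Longrightarrow> e n x = \<zero>\<^bsub>component A n\<^esub> \<Longrightarrow> k n x = f n x"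
  proof (rule right_liftingD[OF lift h(1-3) h(4)[rule_format] fX z])
    fix n x assume "x \<in> car P n" "e n x = \<zero>\<^bsub>component A n\<^esub>"
    then show "\<pi> n (f n x) = \<zero>\<^bsub>component Y n\<^esub>" using cmap_closed[OF f, of x n] by simp
  qed (erule that, blast, blast)
  show "\<exists>h. cmap R P (complex_ker X Y \<pi>) h \<and>
    (\<forall>n. \<forall>x\<in>car P n. e n x = \<zero>\<^bsub>component A n\<^esub> \<longrightarrow> h n x = f n x)"
    using cmap_ker_cod[OF k(1) \<pi> k(2)] k(3) by (intro exI[of _ k]) simp
qed

text \<open>A chain map into a complex with zero differential is a family of linear maps vanishing
  on boundaries, with no relation between the degrees; each degree is therefore extended on its
  own.\<close>

lemma tilde_orthogonal_zero_diff:
  assumes K: "is_complex R U K"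
    and zero: "\<And>n x. x \<in> car K n \<Longrightarrow> diff K n x = \<zero>\<^bsub>component K (n - 1)\<^esub>"
    and orth: "\<And>n. ext_orthogonal R U L (component K n)"
  shows "tilde_orthogonal R U L K"
  unfolding tilde_orthogonal_def
proof (intro allI impI)
  fix P A e f
  assume h: "projective (Complexes R U) P" "A \<in> tilde R U L" "cmap R P A e" "\<forall>n. e n ` car P n = car A n"
    and f: "cmap R (complex_ker P A e) K f"
  have P: "is_complex R U P" using h(1) by (simp add: projective_def)
  let ?N = "complex_ker P A e"
  have "\<exists>u. lin R (component P n) (component K n) u \<and>
    (\<forall>x\<in>car P (n + 1). u (diff P (n + 1) x) = \<zero>\<^bsub>component K n\<^esub>) \<and>
    (\<forall>x\<in>car P n. e n x = \<zero>\<^bsub>component A n\<^esub> \<longrightarrow> u x = f n x)" for n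
  proof -
    have F: "lin R (mod_ker (component P n) (component A n) (e n)) (component K n) (f n)"
      using cmap_lin[OF f, of n] by simp
    have F0: "f n (diff P (n + 1) x) = \<zero>\<^bsub>component K n\<^esub>"
      if x: "x \<in> car P (n + 1)" "e (n + 1) x = \<zero>\<^bsub>component A (n + 1)\<^esub>" for x
    proof -
      have xN: "x \<in> car ?N (n + 1)" using x by simp
      have "f n (diff ?N (n + 1) x) = \<zero>\<^bsub>component K n\<^esub>"
        using cmap_diff_Suc[OF f xN] zero[OF cmap_closed[OF f xN]] by simp
      then show ?thesis using x by simp
    qed
    show ?thesis
      by (rule extend_from_kernel[OF h(2) P h(3) h(4)[rule_format] orth F F0], assumption, assumption)
        (intro exI conjI ballI impI, assumption, simp_all)
  qed
  then obtain u where u: "\<And>n. lin R (component P n) (component K n) (u n)"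
    "\<And>n x. x \<in> car P (n + 1) \<Longrightarrow> u n (diff P (n + 1) x) = \<zero>\<^bsub>component K n\<^esub>"
    "\<And>n x. \<lbrakk>x \<in> car P n; e n x = \<zero>\<^bsub>component A n\<^esub>\<rbrakk> \<Longrightarrow> u n x = f n x" by metis
  have "cmap R P K u"
  proof (rule cmapI[OF u(1)])
    show "u (n - 1) (diff P n x) = diff K n (u n x)" if "x \<in> car P n" for n x
      using u(2)[of x "n - 1"] zero[OF linD(1)[OF u(1)]] that by simp
  qed
  then show "\<exists>h. cmap R P K h \<and> (\<forall>n. \<forall>x\<in>car P n. e n x = \<zero>\<^bsub>component A n\<^esub> \<longrightarrow> h n x = f n x)"
    using u(3) by (intro exI[of _ u]) simp
qed

text \<open>The differential maps \<open>K\<close> onto the complex \<open>T\<close> with zero differential and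
  \<open>T\<^sub>n = Z\<^bsub>n-1\<^esub>(K)\<close>; the kernel is the complex of cycles, which has zero differential too.\<close>

lemma tilde_orthogonal_exact:
  assumes U: "module_universe R U" and K: "is_complex R U K" and ex: "exact_complex K"
    and orth: "\<And>n. ext_orthogonal R U L (cycles K n)"
  shows "tilde_orthogonal R U L K"
proof -
  note lK = is_complex_large[OF K]
  define T where "T = \<lparr>component = (\<lambda>n. cycles K (n - 1)),
    diff = (\<lambda>n. \<lambda>x\<in>carrier (cycles K (n - 1)). \<zero>\<^bsub>cycles K (n - 2)\<^esub>)\<rparr>"
  have T: "component T n = cycles K (n - 1)" "x \<in> car T n \<Longrightarrow> diff T n x = \<zero>\<^bsub>component T (n - 1)\<^esub>" for n x
    by (simp_all add: T_def)
  have ZO: "cycles K n \<in> Obj (Modules R U)" for n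
    unfolding cycles_def by (rule Modules_ker[OF U is_complex_component[OF K] diff_lin[OF lK]])
  then have mZ: "left_module R (cycles K n)" for n by simp
  have "lin R (component T n) (component T (n - 1)) (diff T n)" for n
    by (rule lin_cong[OF lin_const_zero]) (simp_all add: T mZ)
  moreover have "\<zero>\<^bsub>cycles K n\<^esub> \<in> carrier (cycles K n)" for n
    using left_module_group[OF mZ] by (simp add: ag_closed)
  ultimately have Tc: "is_complex R U T"
    unfolding is_complex_iff large_complex_def using ZO T by (simp add: T_def)
  let ?q = "\<lambda>n. diff K n"
  have q: "cmap R K T ?q"
  proof (rule cmapI)
    show l: "lin R (component K n) (component T n) (diff K n)" for n
      unfolding T(1) cycles_def
      by (rule lin_ker_cod[OF diff_lin[OF lK] diff_lin[OF lK]]) (simp add: diff_diff[OF lK])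
    show "diff K (n - 1) (diff K n x) = diff T n (diff K n x)" if x: "x \<in> car K n" for n x
      using T(2)[OF linD(1)[OF l x]] diff_diff[OF lK x] by (simp add: T(1) cycles_def)
  qed
  \<comment> \<open>Surjectivity of the differential onto the cycles is exactness of
    \<open>K\<close>.\<close>
  have onto: "diff K n ` car K n = car T n" for n
    using ex[unfolded exact_complex_def, rule_format, of "n - 1"] by (simp add: T(1))
  have ker: "component (complex_ker K T ?q) n = cycles K n" for n
    by (simp add: T(1) cycles_def mod_ker_eq)
  have lift: "right_lifting R U L K T ?q"
  proof (rule right_lifting_if_kernel[OF K Tc q onto], rule tilde_orthogonal_zero_diff)
    show "is_complex R U (complex_ker K T ?q)" by (rule is_complex_ker[OF U K is_complex_large[OF Tc] q])
    show "diff (complex_ker K T ?q) n x = \<zero>\<^bsub>component (complex_ker K T ?q) (n - 1)\<^esub>"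
      if "x \<in> car (complex_ker K T ?q) n" for n x
      using that by (simp add: T(1) cycles_def)
    show "ext_orthogonal R U L (component (complex_ker K T ?q) n)" for n unfolding ker by (rule orth)
  qed
  have T_orth: "tilde_orthogonal R U L T"
    by (rule tilde_orthogonal_zero_diff[OF Tc T(2)]) (simp_all add: T(1) orth)
  show ?thesis unfolding tilde_orthogonal_def
  proof (intro allI impI)
    fix P A e f
    assume h: "projective (Complexes R U) P" "A \<in> tilde R U L" "cmap R P A e" "\<forall>n. e n ` car P n = car A n"
      and f: "cmap R (complex_ker P A e) K f"
    \<comment> \<open>Extension in two stages: the image of \<open>f\<close> in \<open>T\<close> is
      extended to \<open>P\<close>, and the extension together with \<open>f\<close> forms a square
      over the map from \<open>K\<close> to \<open>T\<close>, whose lift extends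
      \<open>f\<close>.\<close>
    obtain u where u: "cmap R P T u"
      "\<And>n x. x \<in> car P n \<Longrightarrow> e n x = \<zero>\<^bsub>component A n\<^esub> \<Longrightarrow> u n x = diff K n (f n x)"
      by (rule tilde_orthogonalD[OF T_orth h cmap_comp[OF f q]]) (erule that, blast)
    obtain k where k: "cmap R P K k" "\<And>n x. x \<in> car P n \<Longrightarrow> diff K n (k n x) = u n x"
      "\<And>n x. x \<in> car P n \<Longrightarrow> e n x = \<zero>\<^bsub>component A n\<^esub> \<Longrightarrow> k n x = f n x"
      by (rule right_liftingD[OF lift h(1-3) h(4)[rule_format] f u(1)])
        (simp add: u(2), erule that, blast, blast)
    show "\<exists>h. cmap R P K h \<and> (\<forall>n. \<forall>x\<in>car P n. e n x = \<zero>\<^bsub>component A n\<^esub> \<longrightarrow> h n x = f n x)"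
      using k(1,3) by (intro exI[of _ k]) simp
  qed
qed

section \<open>Exact complexes mapping onto a given complex\<close>

lemma lin_inverse:
  assumes f: "lin R M N f" and bij: "bij_betw f (carrier M) (carrier N)"
  shows "lin R N M (inv_into (carrier M) f)"
proof -
  let ?g = "inv_into (carrier M) f"
  have inj: "inj_on f (carrier M)" and img: "f ` carrier M = carrier N" using bij by (auto simp: bij_betw_def)
  have g: "?g y \<in> carrier M" "f (?g y) = y" if "y \<in> carrier N" for y
    using that img by (auto simp: inv_into_into f_inv_into_f)
  have eq: "?g y = x" if "x \<in> carrier M" "f x = y" for x y using that inj by auto
  show ?thesis
  proof (rule linI[OF lin_cod[OF f] lin_dom[OF f]])
    fix x y assume "x \<in> carrier N" "y \<in> carrier N"
    then show "?g (x \<oplus>\<^bsub>N\<^esub> y) = ?g x \<oplus>\<^bsub>M\<^esub> ?g y"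
      using g lin_dom_group[OF f] by (intro eq) (simp_all add: linD[OF f] ag_closed)
  next
    fix a x assume "a \<in> carrier R" "x \<in> carrier N"
    then show "?g (a \<odot>\<^bsub>N\<^esub> x) = a \<odot>\<^bsub>M\<^esub> ?g x"
      using g lin_dom[OF f] by (intro eq) (simp_all add: linD[OF f] left_module_smult)
  qed (rule g)
qed

lemma ext_orthogonal_iso:
  assumes S: "ext_orthogonal R U L S" and f: "lin R S S' \<phi>" and bij: "bij_betw \<phi> (carrier S) (carrier S')"
  shows "ext_orthogonal R U L S'"
  unfolding ext_orthogonal_def
proof (intro conjI ballI allI impI)
  show "left_module R S'" by (rule lin_cod[OF f])
  fix X W q g
  assume h: "X \<in> L" "W \<in> Obj (Modules R U)" "lin R W X q" "q ` carrier W = carrier X" "lin R (mod_ker W X q) S' g"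
  let ?\<psi> = "inv_into (carrier S) \<phi>"
  obtain k where k: "lin R W S k" "\<And>w. w \<in> carrier W \<Longrightarrow> q w = \<zero>\<^bsub>X\<^esub> \<Longrightarrow> k w = ?\<psi> (g w)"
    by (rule ext_orthogonalD[OF S h(1-4) lin_comp[OF h(5) lin_inverse[OF f bij]]]) blast
  have "\<phi> (k w) = g w" if "w \<in> carrier W" "q w = \<zero>\<^bsub>X\<^esub>" for w
    using k(2)[OF that] linD(1)[OF h(5), of w] that bij by (simp add: bij_betw_inv_into_right)
  then show "\<exists>g'. lin R W S' g' \<and> (\<forall>w\<in>carrier W. q w = \<zero>\<^bsub>X\<^esub> \<longrightarrow> g' w = g w)"
    using lin_comp[OF k(1) f] by blast
qed

text \<open>The last clause says that \<open>\<pi>\<close> is zero on homology. The complex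
  \<open>D\<close> may have homology of its own, which is why the step is iterated.\<close>

definition kills_homology :: "('r, 'a) ring_scheme \<Rightarrow> 'm set set \<Rightarrow> ('r, 'm) module set \<Rightarrow>
  ('r, 'm) cplx \<Rightarrow> ('r, 'm) cplx \<Rightarrow> (int \<Rightarrow> 'm \<Rightarrow> 'm) \<Rightarrow> bool" where
  "kills_homology R U L C D \<pi> \<longleftrightarrow> cmap R D C \<pi> \<and> (\<forall>n. \<pi> n ` car D n = car C n) \<and> right_lifting R U L D C \<pi> \<and>
     (\<forall>n. \<forall>z\<in>car D n. diff D n z = \<zero>\<^bsub>component D (n - 1)\<^esub> \<longrightarrow> (\<exists>y\<in>car C (n + 1). diff C (n + 1) y = \<pi> n z))"

text \<open>\<open>D\<close> adjoins to \<open>C\<close>, in each degree \<open>n - 1\<close>, an injective module \<open>F\<^sub>n\<close> containing \<open>C\<^sub>n / B\<^sub>n\<close>, with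
  differential \<open>C\<^sub>n \<rightarrow> F\<^sub>n\<close>: a cycle of \<open>D\<close> then projects to a boundary of \<open>C\<close>.\<close>

lemma kills_homology_exists:
  fixes C :: "('r, 'm) cplx"
  assumes R: "ring R" and U: "module_universe R U" and C: "is_complex R U C"
  shows "\<exists>D \<pi>. is_complex R U D \<and> kills_homology R U L C D \<pi>"
proof -
  note lC = is_complex_large[OF C] and mC = is_complex_module[OF C]
  let ?B = "\<lambda>n. diff C (n + 1) ` car C (n + 1)"
  have B: "submod R (component C n) (?B n)" for n by (rule submod_image[OF diff_lin_Suc[OF lC]])
  \<comment> \<open>The kernel of \<open>h\<close> is exactly the module of boundaries:
    \<open>h\<close> is the projection to \<open>C_n / B_n\<close> followed by an embedding into an
    injective module.\<close>
  have "\<exists>F h. F \<in> Obj (Modules R U) \<and> injective_module R F \<and> lin R (component C n) F h \<and>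
    (\<forall>x\<in>car C n. h x = \<zero>\<^bsub>F\<^esub> \<longleftrightarrow> x \<in> ?B n)" for n
  proof -
    let ?Q = "quot (component C n) (?B n)" and ?c = "coset_rep (component C n) (?B n)"
    note c = lin_coset_rep[OF mC B, of n]
    have "?Q \<in> Obj (Modules R U)"
      using lin_cod[OF c] universe_subset[OF U _ carrier_quot[OF mC B]] is_complex_component[OF C] by simp
    then obtain F j where F: "F \<in> Obj (Modules R U)" "injective_module R F" "lin R ?Q F j"
      "\<And>x. x \<in> carrier ?Q \<Longrightarrow> j x = \<zero>\<^bsub>F\<^esub> \<Longrightarrow> x = \<zero>\<^bsub>?Q\<^esub>"
      by (rule enough_injective_modules[OF R U]) blast
    have "j (?c x) = \<zero>\<^bsub>F\<^esub> \<longleftrightarrow> x \<in> ?B n" if x: "x \<in> car C n" for x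
      using F(4)[OF linD(1)[OF c x]] coset_rep_zero_iff[OF mC B x] linD(4)[OF F(3)] by auto
    then show ?thesis using F(1,2) lin_comp[OF c F(3)] by blast
  qed
  then obtain F h where F: "\<And>n. F n \<in> Obj (Modules R U)" "\<And>n. injective_module R (F n)"
    and h: "\<And>n. lin R (component C n) (F n) (h n)"
    and hB: "\<And>n x. x \<in> car C n \<Longrightarrow> h n x = \<zero>\<^bsub>F n\<^esub> \<longleftrightarrow> x \<in> ?B n" by metis
  have mF: "left_module R (F n)" and UF: "carrier (F n) \<in> U" for n using F(1)[of n] by simp_all
  have zF: "\<zero>\<^bsub>F n\<^esub> \<in> carrier (F n)" for n using left_module_group[OF mF] by (simp add: ag_closed)
  have zC: "\<zero>\<^bsub>component C n\<^esub> \<in> car C n" for n using left_module_group[OF mC] by (simp add: ag_closed)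
  \<comment> \<open>The shift to \<open>n + 1\<close> puts \<open>F n\<close> in degree
    \<open>n - 1\<close>, where the differential leaving degree \<open>n\<close> arrives.\<close>
  define E where "E = \<lparr>component = (\<lambda>n. prod_module (component C n) (F (n + 1))),
    diff = (\<lambda>n x. (diff C n (fst x), h n (fst x)))\<rparr>"
  have E: "component E n = prod_module (component C n) (F (n + 1))" "diff E n x = (diff C n (fst x), h n (fst x))" for n x
    by (simp_all add: E_def)
  \<comment> \<open>The differential of \<open>E\<close> squares to zero because \<open>h\<close>
    kills boundaries.\<close>
  have hd: "h (n - 1) (diff C n x) = \<zero>\<^bsub>F (n - 1)\<^esub>" if x: "x \<in> car C n" for n x
    using hB[OF linD(1)[OF diff_lin[OF lC] x]] x by auto
  have lE: "large_complex R E" unfolding large_complex_def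
  proof (intro conjI allI ballI)
    fix n
    have "lin R (component E n) (prod_module (component C (n - 1)) (F n)) (diff E n)"
      unfolding E by (intro lin_pair lin_comp[OF lin_fst[OF mC mF] diff_lin[OF lC]] lin_comp[OF lin_fst[OF mC mF] h])
    then show "lin R (component E n) (component E (n - 1)) (diff E n)" by (simp add: E(1))
    fix x assume "x \<in> car E n"
    then have "fst x \<in> car C n" by (auto simp: E)
    then show "diff E (n - 1) (diff E n x) = \<zero>\<^bsub>component E (n - 2)\<^esub>"
      by (simp add: E diff_diff[OF lC] hd)
  qed
  have "small U (car E n)" for n
    using small_times[OF U small_mem small_mem, of "car C n" "carrier (F (n + 1))"] UF is_complex_component[OF C]
    by (simp add: E)
  then obtain D \<phi> \<psi> where D: "is_complex R U D" "cmap R E D \<phi>" "cmap R D E \<psi>"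
    "\<And>n x. x \<in> car E n \<Longrightarrow> \<psi> n (\<phi> n x) = x" "\<And>n y. y \<in> car D n \<Longrightarrow> \<phi> n (\<psi> n y) = y"
    using complex_transport[OF U lE] by metis
  let ?\<pi> = "\<lambda>n x. fst (\<psi> n x)"
  have fst: "cmap R E C (\<lambda>n. fst)"
    by (rule cmapI) (simp_all add: E lin_fst[OF mC mF])
  note \<pi> = cmap_comp[OF D(3) fst]
  have onto: "?\<pi> n ` car D n = car C n" for n
  proof
    show "car C n \<subseteq> ?\<pi> n ` car D n"
    proof
      fix c assume "c \<in> car C n"
      then have m: "(c, \<zero>\<^bsub>F (n + 1)\<^esub>) \<in> car E n" using zF by (simp add: E)
      have "c = ?\<pi> n (\<phi> n (c, \<zero>\<^bsub>F (n + 1)\<^esub>))" using D(4)[OF m] by simp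
      then show "c \<in> ?\<pi> n ` car D n" using cmap_closed[OF D(2) m] by blast
    qed
  qed (use cmap_closed[OF \<pi>] in blast)
  \<comment> \<open>In degree \<open>n\<close> the kernel of the projection is a copy of the
    injective module \<open>F (n + 1)\<close>.\<close>
  have ker: "ext_orthogonal R U L (mod_ker (component D n) (component C n) (?\<pi> n))" for n
  proof (rule ext_orthogonal_iso[OF injective_ext_orthogonal[OF F(2)[of "n + 1"]]])
    let ?i = "\<lambda>y. \<phi> n (\<zero>\<^bsub>component C n\<^esub>, y)"
    have m: "(\<zero>\<^bsub>component C n\<^esub>, y) \<in> car E n" if "y \<in> carrier (F (n + 1))" for y using that zC by (simp add: E)
    have "lin R (F (n + 1)) (component E n) (\<lambda>y. (\<zero>\<^bsub>component C n\<^esub>, y))"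
      unfolding E by (intro lin_pair lin_const_zero lin_id mF mC)
    note i = lin_comp[OF this cmap_lin[OF D(2)]]
    show "lin R (F (n + 1)) (mod_ker (component D n) (component C n) (?\<pi> n)) ?i"
      by (rule lin_ker_cod[OF i cmap_lin[OF \<pi>]]) (simp add: D(4) m)
    show "bij_betw ?i (carrier (F (n + 1))) (carrier (mod_ker (component D n) (component C n) (?\<pi> n)))"
    proof (rule bij_betw_byWitness[of _ "\<lambda>x. snd (\<psi> n x)"])
      show "\<forall>y\<in>carrier (F (n + 1)). snd (\<psi> n (?i y)) = y" by (simp add: D(4) m)
      show "\<forall>x\<in>carrier (mod_ker (component D n) (component C n) (?\<pi> n)). ?i (snd (\<psi> n x)) = x"
        using D(5) by (metis (mono_tags, lifting) mem_Collect_eq mod_ker_simps(1) prod.collapse)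
      show "?i ` carrier (F (n + 1)) \<subseteq> carrier (mod_ker (component D n) (component C n) (?\<pi> n))"
        using m cmap_closed[OF D(2)] by (auto simp: D(4))
      show "(\<lambda>x. snd (\<psi> n x)) ` carrier (mod_ker (component D n) (component C n) (?\<pi> n)) \<subseteq> carrier (F (n + 1))"
        using cmap_closed[OF D(3), of _ n] by (auto simp: E mem_Times_iff)
    qed
  qed
  \<comment> \<open>The differential of \<open>E\<close> reads the first component only, so it
    vanishes on the kernel of the projection.\<close>
  have zero: "diff D n x = \<zero>\<^bsub>component D (n - 1)\<^esub>" if x: "x \<in> car D n" "?\<pi> n x = \<zero>\<^bsub>component C n\<^esub>" for n x
  proof -
    note y = cmap_closed[OF D(3) x(1)]
    have "diff D n x = \<phi> (n - 1) (diff E n (\<psi> n x))" using cmap_diff[OF D(2) y] D(5)[OF x(1)] by simp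
    also have "diff E n (\<psi> n x) = \<zero>\<^bsub>component E (n - 1)\<^esub>"
      using x(2) linD(4)[OF diff_lin[OF lC]] linD(4)[OF h] by (simp add: E)
    finally show ?thesis using linD(4)[OF cmap_lin[OF D(2)]] by simp
  qed
  have lift: "right_lifting R U L D C ?\<pi>"
  proof (rule right_lifting_if_kernel[OF D(1) C \<pi> onto], rule tilde_orthogonal_zero_diff)
    show "is_complex R U (complex_ker D C ?\<pi>)" by (rule is_complex_ker[OF U D(1) lC \<pi>])
    show "diff (complex_ker D C ?\<pi>) n x = \<zero>\<^bsub>component (complex_ker D C ?\<pi>) (n - 1)\<^esub>"
      if "x \<in> car (complex_ker D C ?\<pi>) n" for n x
      using that zero by simp
  qed (simp add: ker)
  have "\<exists>y\<in>car C (n + 1). diff C (n + 1) y = ?\<pi> n z"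
    if z: "z \<in> car D n" "diff D n z = \<zero>\<^bsub>component D (n - 1)\<^esub>" for n z
  proof -
    have "diff E n (\<psi> n z) = \<zero>\<^bsub>component E (n - 1)\<^esub>"
      using cmap_diff[OF D(3) z(1)] z(2) linD(4)[OF cmap_lin[OF D(3)]] by simp
    then have "h n (?\<pi> n z) = \<zero>\<^bsub>F n\<^esub>" by (simp add: E)
    then have "?\<pi> n z \<in> ?B n" using hB[OF cmap_closed[OF \<pi> z(1)]] by simp
    then show ?thesis by (metis imageE)
  qed
  then have "kills_homology R U L C D ?\<pi>" using \<pi> onto lift by (simp add: kills_homology_def)
  then show ?thesis using D(1) by blast
qed

section \<open>Inverse limits of towers of complexes\<close>

definition tower_limit :: "(nat \<Rightarrow> ('r, 'm) cplx) \<Rightarrow> (nat \<Rightarrow> int \<Rightarrow> 'm \<Rightarrow> 'm) \<Rightarrow> ('r, nat \<Rightarrow> 'm) cplx" where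
  "tower_limit E \<pi> = \<lparr>component = (\<lambda>n. (seq_module (\<lambda>k. component (E k) n))
       \<lparr>carrier := {x. (\<forall>k. x k \<in> car (E k) n) \<and> (\<forall>k. \<pi> k n (x (Suc k)) = x k)}\<rparr>),
     diff = (\<lambda>n x k. diff (E k) n (x k))\<rparr>"

lemma tower_limit_simps [simp]:
  "x \<in> car (tower_limit E \<pi>) n \<longleftrightarrow> (\<forall>k. x k \<in> car (E k) n) \<and> (\<forall>k. \<pi> k n (x (Suc k)) = x k)"
  "\<zero>\<^bsub>component (tower_limit E \<pi>) n\<^esub> = (\<lambda>k. \<zero>\<^bsub>component (E k) n\<^esub>)"
  "x \<oplus>\<^bsub>component (tower_limit E \<pi>) n\<^esub> y = (\<lambda>k. x k \<oplus>\<^bsub>component (E k) n\<^esub> y k)"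
  "a \<odot>\<^bsub>component (tower_limit E \<pi>) n\<^esub> x = (\<lambda>k. a \<odot>\<^bsub>component (E k) n\<^esub> x k)"
  "diff (tower_limit E \<pi>) n x = (\<lambda>k. diff (E k) n (x k))"
  by (simp_all add: tower_limit_def)

lemma large_tower_limit:
  assumes E: "\<And>k. large_complex R (E k)" and \<pi>: "\<And>k. cmap R (E (Suc k)) (E k) (\<pi> k)"
  shows "large_complex R (tower_limit E \<pi>)"
proof -
  have mE: "left_module R (component (E k) n)" for k n by (rule lin_dom[OF diff_lin[OF E]])
  note gE = left_module_group[OF mE]
  note p = linD[OF cmap_lin[OF \<pi>]]
  have m: "left_module R (component (tower_limit E \<pi>) n)" for n
    unfolding tower_limit_def cplx.simps
  proof (rule submod_left_module[OF left_module_seq[OF mE]])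
    show "submod R (seq_module (\<lambda>k. component (E k) n)) {x. (\<forall>k. x k \<in> car (E k) n) \<and> (\<forall>k. \<pi> k n (x (Suc k)) = x k)}"
      unfolding submod_def by (simp add: p ag_closed[OF gE] left_module_smult[OF mE] subset_iff)
  qed
  show ?thesis unfolding large_complex_def
  proof (intro conjI allI ballI)
    show "lin R (component (tower_limit E \<pi>) n) (component (tower_limit E \<pi>) (n - 1)) (diff (tower_limit E \<pi>) n)" for n
      by (rule linI[OF m m]) (simp_all add: linD[OF diff_lin[OF E]] cmap_diff[OF \<pi>])
    show "diff (tower_limit E \<pi>) (n - 1) (diff (tower_limit E \<pi>) n x) = \<zero>\<^bsub>component (tower_limit E \<pi>) (n - 2)\<^esub>"
      if "x \<in> car (tower_limit E \<pi>) n" for n x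
      using that by (simp add: diff_diff[OF E])
  qed
qed

text \<open>Each map of the tower vanishes on homology, so a cycle of the limit bounds in every stage; the
  correction term \<open>diff w'\<close> makes the choices of the bounding elements compatible.\<close>

lemma exact_tower_limit:
  assumes E: "\<And>k. large_complex R (E k)" and kill: "\<And>k. kills_homology R U L (E k) (E (Suc k)) (\<pi> k)"
  shows "exact_complex (tower_limit E \<pi>)"
proof (rule exact_complexI)
  have \<pi>: "cmap R (E (Suc k)) (E k) (\<pi> k)" and onto: "\<pi> k n ` car (E (Suc k)) n = car (E k) n" for k n
    using kill[of k] by (simp_all add: kills_homology_def)
  have bound: "\<exists>y\<in>car (E k) (n + 1). diff (E k) (n + 1) y = \<pi> k n z"
    if "z \<in> car (E (Suc k)) n" "diff (E (Suc k)) n z = \<zero>\<^bsub>component (E (Suc k)) (n - 1)\<^esub>" for k n z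
    using kill[of k] that unfolding kills_homology_def by blast
  show "large_complex R (tower_limit E \<pi>)" by (rule large_tower_limit[of R E \<pi>, OF E \<pi>])
  fix n x assume x: "x \<in> car (tower_limit E \<pi>) n"
    "diff (tower_limit E \<pi>) n x = \<zero>\<^bsub>component (tower_limit E \<pi>) (n - 1)\<^esub>"
  then have xk: "x k \<in> car (E k) n" "\<pi> k n (x (Suc k)) = x k" for k by simp_all
  have xd: "diff (E k) n (x k) = \<zero>\<^bsub>component (E k) (n - 1)\<^esub>" for k using fun_cong[OF x(2), of k] by simp
  have gE: "abelian_group (component (E k) i)" for k i by (rule lin_dom_group[OF diff_lin[OF E]])
  have pd: "\<pi> k n (diff (E (Suc k)) (n + 1) y) = diff (E k) (n + 1) (\<pi> k (n + 1) y)"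
    if "y \<in> car (E (Suc k)) (n + 1)" for k y by (rule cmap_diff_Suc[OF \<pi> that])
  \<comment> \<open>The invariant looks one stage ahead: a bounding element \<open>y'\<close> over
    \<open>y\<close> is what the next choice will be compared with.\<close>
  define lifted where "lifted k y \<longleftrightarrow> y \<in> car (E k) (n + 1) \<and> diff (E k) (n + 1) y = x k \<and>
    (\<exists>y'\<in>car (E (Suc k)) (n + 1). diff (E (Suc k)) (n + 1) y' = x (Suc k) \<and> \<pi> k (n + 1) y' = y)" for k y
  \<comment> \<open>\<open>x k\<close> is the image of the cycle \<open>x (Suc k)\<close>, and the
    maps of the tower send cycles to boundaries.\<close>
  have ex: "\<exists>y\<in>car (E k) (n + 1). diff (E k) (n + 1) y = x k" for k
    using bound[OF xk(1) xd, of k] xk(2)[of k] by simp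
  have "\<exists>y. \<forall>k. lifted k (y k) \<and> \<pi> k (n + 1) (y (Suc k)) = y k"
  proof (rule dependent_nat_choice)
    obtain y' where y': "y' \<in> car (E (Suc 0)) (n + 1)" "diff (E (Suc 0)) (n + 1) y' = x (Suc 0)" using ex by blast
    have "lifted 0 (\<pi> 0 (n + 1) y')"
      unfolding lifted_def using y' cmap_closed[OF \<pi> y'(1)] pd[OF y'(1)] xk(2)[of 0] by auto
    then show "\<exists>y. lifted 0 y" by blast
  next
    fix y k assume "lifted k y"
    then obtain y' where y: "y \<in> car (E k) (n + 1)" "diff (E k) (n + 1) y = x k"
      and y': "y' \<in> car (E (Suc k)) (n + 1)" "diff (E (Suc k)) (n + 1) y' = x (Suc k)" "\<pi> k (n + 1) y' = y"
      unfolding lifted_def by blast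
    obtain y'' where y'': "y'' \<in> car (E (Suc (Suc k))) (n + 1)" "diff (E (Suc (Suc k))) (n + 1) y'' = x (Suc (Suc k))"
      using ex by blast
    let ?E = "component (E (Suc k)) (n + 1)" and ?p = "\<pi> (Suc k) (n + 1) y''"
    have p: "?p \<in> carrier ?E" "diff (E (Suc k)) (n + 1) ?p = x (Suc k)"
      using cmap_closed[OF \<pi> y''(1)] pd[OF y''(1)] y''(2) xk(2) by simp_all
    \<comment> \<open>Both \<open>?p\<close> and \<open>y'\<close> bound \<open>x (Suc k)\<close>:
      the former has a bounding preimage at the next stage, the latter lies over \<open>y\<close>.
      Their difference is a cycle, so its image at stage \<open>k\<close> is a boundary
      \<open>diff w\<close>.\<close>
    let ?z = "?p \<ominus>\<^bsub>?E\<^esub> y'"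
    have z: "?z \<in> carrier ?E" using p(1) y'(1) gE by (simp add: ag_closed)
    have "diff (E (Suc k)) (n + 1) ?z = \<zero>\<^bsub>component (E (Suc k)) n\<^esub>"
      using linD(6)[OF diff_lin_Suc[OF E] p(1) y'(1)] p(2) y'(2) gE xk(1)[of "Suc k"] by (simp add: ag)
    then obtain w where w: "w \<in> car (E k) (n + 1 + 1)" "diff (E k) (n + 1 + 1) w = \<pi> k (n + 1) ?z"
      using bound[OF z] by auto
    then have "w \<in> \<pi> k (n + 1 + 1) ` car (E (Suc k)) (n + 1 + 1)" using onto by simp
    then obtain w' where w': "w' \<in> car (E (Suc k)) (n + 1 + 1)" "w = \<pi> k (n + 1 + 1) w'" by blast
    then have "w' \<in> \<pi> (Suc k) (n + 1 + 1) ` car (E (Suc (Suc k))) (n + 1 + 1)" using onto by simp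
    then obtain w'' where w'': "w'' \<in> car (E (Suc (Suc k))) (n + 1 + 1)" "w' = \<pi> (Suc k) (n + 1 + 1) w''" by blast
    let ?dw' = "diff (E (Suc k)) (n + 1 + 1) w'" and ?dw'' = "diff (E (Suc (Suc k))) (n + 1 + 1) w''"
    have dw': "?dw' \<in> carrier ?E" "diff (E (Suc k)) (n + 1) ?dw' = \<zero>\<^bsub>component (E (Suc k)) n\<^esub>"
      "\<pi> k (n + 1) ?dw' = \<pi> k (n + 1) ?z"
      using linD(1)[OF diff_lin_Suc[OF E] w'(1)] diff_diff_Suc[OF E w'(1)] cmap_diff_Suc[OF \<pi> w'(1)] w(2) w'(2) by simp_all
    have dw'': "?dw'' \<in> car (E (Suc (Suc k))) (n + 1)" "diff (E (Suc (Suc k))) (n + 1) ?dw'' = \<zero>\<^bsub>component (E (Suc (Suc k))) n\<^esub>"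
      "\<pi> (Suc k) (n + 1) ?dw'' = ?dw'"
      using linD(1)[OF diff_lin_Suc[OF E] w''(1)] diff_diff_Suc[OF E w''(1)] cmap_diff_Suc[OF \<pi> w''(1)] w''(2) by simp_all
    \<comment> \<open>Subtracting a boundary does not change the differential of \<open>?p\<close>.
      As \<open>diff w'\<close> and \<open>?z\<close> have the same image at stage \<open>k\<close>,
      the corrected element lies over \<open>y\<close>, just as \<open>y'\<close> does.\<close>
    let ?y = "?p \<ominus>\<^bsub>?E\<^esub> ?dw'"
    have y1: "?y \<in> carrier ?E" using p(1) dw'(1) gE by (simp add: ag_closed)
    have y2: "diff (E (Suc k)) (n + 1) ?y = x (Suc k)"
      using linD(6)[OF diff_lin_Suc[OF E] p(1) dw'(1)] p(2) dw'(2) gE xk(1)[of "Suc k"] by (simp add: ag neg_zero)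
    have "\<pi> k (n + 1) ?y = \<pi> k (n + 1) ?p \<ominus>\<^bsub>component (E k) (n + 1)\<^esub> \<pi> k (n + 1) ?z"
      using linD(6)[OF cmap_lin[OF \<pi>] p(1) dw'(1)] dw'(3) by simp
    also have "\<dots> = y"
      using linD(6)[OF cmap_lin[OF \<pi>] p(1) y'(1)] y'(3) cmap_closed[OF \<pi> p(1)] y(1) gE[of k "n + 1"] by (simp add: ag)
    finally have y3: "\<pi> k (n + 1) ?y = y" .
    \<comment> \<open>The same correction one stage higher preserves the look-ahead.\<close>
    let ?y'' = "y'' \<ominus>\<^bsub>component (E (Suc (Suc k))) (n + 1)\<^esub> ?dw''"
    have "?y'' \<in> car (E (Suc (Suc k))) (n + 1)" using y''(1) dw''(1) gE by (simp add: ag_closed)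
    moreover have "diff (E (Suc (Suc k))) (n + 1) ?y'' = x (Suc (Suc k))"
      using linD(6)[OF diff_lin_Suc[OF E] y''(1) dw''(1)] y''(2) dw''(2) gE xk(1)[of "Suc (Suc k)"] by (simp add: ag neg_zero)
    moreover have "\<pi> (Suc k) (n + 1) ?y'' = ?y" using linD(6)[OF cmap_lin[OF \<pi>] y''(1) dw''(1)] dw''(3) by simp
    ultimately have "lifted (Suc k) ?y" using y1 y2 unfolding lifted_def by blast
    then show "\<exists>y'. lifted (Suc k) y' \<and> \<pi> k (n + 1) y' = y" using y3 by blast
  qed
  then obtain y where "\<And>k. lifted k (y k)" "\<And>k. \<pi> k (n + 1) (y (Suc k)) = y k" by blast
  then show "\<exists>y\<in>car (tower_limit E \<pi>) (n + 1). diff (tower_limit E \<pi>) (n + 1) y = x"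
    by (intro bexI[of _ y]) (auto simp: lifted_def)
qed

text \<open>A lift into the limit is assembled stage by stage, each time by the lifting property of
  a single map of the tower; the kernel of the limit over \<open>C\<close> is not computed.\<close>

lemma exact_precover_exists:
  fixes C :: "('r, 'm) cplx"
  assumes R: "ring R" and U: "module_universe R U" and C: "is_complex R U C"
  obtains D \<rho> where "is_complex R U D" "exact_complex D" "cmap R D C \<rho>" "\<And>n. \<rho> n ` car D n = car C n"
    "right_lifting R U L D C \<rho>"
proof -
  \<comment> \<open>The condition at \<open>k = 0\<close> anchors the dependent choice at
    \<open>C\<close>.\<close>
  have "\<exists>E. \<forall>k. (is_complex R U (E k) \<and> (k = 0 \<longrightarrow> E k = C)) \<and> (\<exists>\<pi>. kills_homology R U L (E k) (E (Suc k)) \<pi>)"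
  proof (rule dependent_nat_choice)
    show "\<exists>E. is_complex R U E \<and> ((0::nat) = 0 \<longrightarrow> E = C)" using C by blast
    fix E and k :: nat assume "is_complex R U E \<and> (k = 0 \<longrightarrow> E = C)"
    then obtain D \<pi> where "is_complex R U D" "kills_homology R U L E D \<pi>"
      using kills_homology_exists[OF R U] by blast
    then show "\<exists>D. (is_complex R U D \<and> (Suc k = 0 \<longrightarrow> D = C)) \<and> (\<exists>\<pi>. kills_homology R U L E D \<pi>)" by blast
  qed
  then obtain E where E: "\<And>k. is_complex R U (E k)" "E 0 = C" and "\<forall>k. \<exists>\<pi>. kills_homology R U L (E k) (E (Suc k)) \<pi>"
    by metis
  then obtain \<pi> where kill: "\<And>k. kills_homology R U L (E k) (E (Suc k)) (\<pi> k)" by metis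
  have \<pi>: "cmap R (E (Suc k)) (E k) (\<pi> k)" and onto: "\<pi> k n ` car (E (Suc k)) n = car (E k) n"
    and lift: "right_lifting R U L (E (Suc k)) (E k) (\<pi> k)" for k n
    using kill[of k] by (simp_all add: kills_homology_def)
  note lE = is_complex_large[OF E(1)]
  let ?T = "tower_limit E \<pi>"
  note lT = large_tower_limit[of R E \<pi>, OF lE \<pi>]
  have "small U (car ?T n)" for n
  proof (rule small_subset[OF small_seq[OF U]])
    show "small U (car (E k) n)" for k using is_complex_component[OF E(1), of k n] by (auto intro: small_mem)
    show "car ?T n \<subseteq> {x. \<forall>k. x k \<in> car (E k) n}" by auto
  qed
  then obtain D \<phi> \<psi> where D: "is_complex R U D" "cmap R ?T D \<phi>" "cmap R D ?T \<psi>"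
    "\<And>n x. x \<in> car ?T n \<Longrightarrow> \<psi> n (\<phi> n x) = x" "\<And>n y. y \<in> car D n \<Longrightarrow> \<phi> n (\<psi> n y) = y"
    using complex_transport[OF U lT] by metis
  have proj: "cmap R ?T (E k) (\<lambda>n x. x k)" for k
    by (rule cmapI, rule linI[OF lin_dom[OF diff_lin[OF lT]] lin_dom[OF diff_lin[OF lE]]]) simp_all
  let ?\<rho> = "\<lambda>n x. \<psi> n x 0"
  have \<rho>: "cmap R D C ?\<rho>" using cmap_comp[OF D(3) proj[of 0]] E(2) by simp
  have "exact_complex D"
  proof (rule exact_complexI[OF is_complex_large[OF D(1)]])
    fix n z assume z: "z \<in> car D n" "diff D n z = \<zero>\<^bsub>component D (n - 1)\<^esub>"
    have "diff ?T n (\<psi> n z) = \<zero>\<^bsub>component ?T (n - 1)\<^esub>"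
      using cmap_diff[OF D(3) z(1)] z(2) linD(4)[OF cmap_lin[OF D(3)]] by (simp del: tower_limit_simps)
    then obtain y where y: "y \<in> car ?T (n + 1)" "diff ?T (n + 1) y = \<psi> n z"
      using exact_complexD[OF exact_tower_limit[of R E U L \<pi>, OF lE kill] cmap_closed[OF D(3) z(1)]] by blast
    have "diff D (n + 1) (\<phi> (n + 1) y) = z"
      using cmap_diff_Suc[OF D(2) y(1)] y(2) D(5)[OF z(1)] by (simp del: tower_limit_simps)
    then show "\<exists>y\<in>car D (n + 1). diff D (n + 1) y = z" using cmap_closed[OF D(2) y(1)] by blast
  qed
  moreover have "?\<rho> n ` car D n = car C n" for n
  proof
    show "car C n \<subseteq> ?\<rho> n ` car D n"
    proof
      fix c assume c: "c \<in> car C n"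
      \<comment> \<open>Surjectivity at every stage prolongs \<open>c\<close> to a compatible
        sequence.\<close>
      have "\<exists>x. \<forall>k. (x k \<in> car (E k) n \<and> (k = 0 \<longrightarrow> x k = c)) \<and> \<pi> k n (x (Suc k)) = x k"
      proof (rule dependent_nat_choice)
        show "\<exists>x. x \<in> car (E 0) n \<and> ((0::nat) = 0 \<longrightarrow> x = c)" using c E(2) by blast
        fix x and k :: nat assume "x \<in> car (E k) n \<and> (k = 0 \<longrightarrow> x = c)"
        then have "x \<in> \<pi> k n ` car (E (Suc k)) n" using onto by simp
        then show "\<exists>y. (y \<in> car (E (Suc k)) n \<and> (Suc k = 0 \<longrightarrow> y = c)) \<and> \<pi> k n y = x" by auto
      qed
      then obtain x where x: "\<And>k. x k \<in> car (E k) n" "x 0 = c" "\<And>k. \<pi> k n (x (Suc k)) = x k" by blast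
      then have xT: "x \<in> car ?T n" by simp
      have "?\<rho> n (\<phi> n x) = c" using D(4)[OF xT] x(2) by simp
      then show "c \<in> ?\<rho> n ` car D n" using cmap_closed[OF D(2) xT] by blast
    qed
  qed (use cmap_closed[OF \<rho>] in blast)
  moreover have "right_lifting R U L D C ?\<rho>"
    unfolding right_lifting_def
  proof (intro allI impI)
    fix P A e f g
    assume h: "projective (Complexes R U) P" "A \<in> tilde R U L" "cmap R P A e" "\<forall>n. e n ` car P n = car A n"
      "cmap R (complex_ker P A e) D f" "cmap R P C g"
      "\<forall>n. \<forall>x\<in>car P n. e n x = \<zero>\<^bsub>component A n\<^esub> \<longrightarrow> \<psi> n (f n x) 0 = g n x"
    note f\<psi> = cmap_comp[OF h(5) D(3)]
    \<comment> \<open>Prescribing coordinate \<open>k\<close> of \<open>f\<close> on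
      \<open>ker e\<close> at stage \<open>k\<close> makes the assembled lift restrict to
      \<open>f\<close>; stage \<open>0\<close> is \<open>g\<close> because the tower starts at
      \<open>C\<close>.\<close>
    define ok where "ok k s \<longleftrightarrow> cmap R P (E k) s \<and>
      (\<forall>n. \<forall>x\<in>car P n. e n x = \<zero>\<^bsub>component A n\<^esub> \<longrightarrow> s n x = \<psi> n (f n x) k) \<and> (k = 0 \<longrightarrow> s = g)" for k s
    have "\<exists>s. \<forall>k. ok k (s k) \<and> (\<forall>n. \<forall>x\<in>car P n. \<pi> k n (s (Suc k) n x) = s k n x)"
    proof (rule dependent_nat_choice)
      show "\<exists>s. ok 0 s" using h(6,7) E(2) unfolding ok_def by (intro exI[of _ g]) simp
      fix s k assume s: "ok k s"
      obtain t where "cmap R P (E (Suc k)) t" "\<And>n x. x \<in> car P n \<Longrightarrow> \<pi> k n (t n x) = s n x"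
        "\<And>n x. x \<in> car P n \<Longrightarrow> e n x = \<zero>\<^bsub>component A n\<^esub> \<Longrightarrow> t n x = \<psi> n (f n x) (Suc k)"
      proof (rule right_liftingD[OF lift h(1-3) h(4)[rule_format] cmap_comp[OF f\<psi> proj]])
        show "cmap R P (E k) s" using s by (simp add: ok_def)
        fix n x assume x: "x \<in> car P n" "e n x = \<zero>\<^bsub>component A n\<^esub>"
        then have "\<psi> n (f n x) \<in> car ?T n" using cmap_closed[OF f\<psi>, of x n] by simp
        then show "\<pi> k n (\<psi> n (f n x) (Suc k)) = s n x" using s x by (simp add: ok_def)
      qed (erule that, blast, blast)
      then show "\<exists>t. ok (Suc k) t \<and> (\<forall>n. \<forall>x\<in>car P n. \<pi> k n (t n x) = s n x)"
        by (intro exI[of _ t]) (simp add: ok_def)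
    qed
    then obtain s where s: "\<forall>k. ok k (s k) \<and> (\<forall>n. \<forall>x\<in>car P n. \<pi> k n (s (Suc k) n x) = s k n x)" by (elim exE)
    have sm: "cmap R P (E k) (s k)" for k using s by (simp add: ok_def)
    have sf: "s k n x = \<psi> n (f n x) k" if "x \<in> car P n" "e n x = \<zero>\<^bsub>component A n\<^esub>" for k n x
      using s that by (simp add: ok_def)
    have s0: "s 0 = g" using s by (simp add: ok_def)
    let ?S = "\<lambda>n x k. s k n x"
    have S: "cmap R P ?T ?S"
    proof (rule cmapI)
      show "lin R (component P n) (component ?T n) (?S n)" for n
        by (rule linI[OF lin_dom[OF cmap_lin[OF h(3)]] lin_dom[OF diff_lin[OF lT]]])
          (use s in \<open>simp_all add: linD[OF cmap_lin[OF sm]]\<close>)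
      show "?S (n - 1) (diff P n x) = diff ?T n (?S n x)" if "x \<in> car P n" for n x
        using that by (simp add: cmap_diff[OF sm])
    qed
    have "?\<rho> n (\<phi> n (?S n x)) = g n x" if x: "x \<in> car P n" for n x
      using D(4)[OF cmap_closed[OF S x]] s0 by simp
    moreover have "\<phi> n (?S n x) = f n x" if x: "x \<in> car P n" "e n x = \<zero>\<^bsub>component A n\<^esub>" for n x
    proof -
      have "?S n x = \<psi> n (f n x)" using sf[OF x] by (intro ext)
      then show ?thesis using D(5) cmap_closed[OF h(5), of x n] x by simp
    qed
    ultimately show "\<exists>h. cmap R P D h \<and> (\<forall>n. \<forall>x\<in>car P n. \<psi> n (h n x) 0 = g n x) \<and>
      (\<forall>n. \<forall>x\<in>car P n. e n x = \<zero>\<^bsub>component A n\<^esub> \<longrightarrow> h n x = f n x)"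
      using cmap_comp[OF S D(2)] by (intro exI[of _ "\<lambda>n x. \<phi> n (?S n x)"]) simp
  qed
  ultimately show ?thesis using that[OF D(1) _ \<rho>] by blast
qed

section \<open>Precovers of exact complexes\<close>

text \<open>Cutting the codomain down to the image turns \<open>a\<close> into an epimorphism; the
  image is an object since the universe is closed under subsets.\<close>

lemma projective_lift_image:
  assumes U: "module_universe R U" and P: "projective (Modules R U) P"
    and X: "X \<in> Obj (Modules R U)" and Z: "Z \<in> Obj (Modules R U)"
    and a: "lin R X Z a" and g: "lin R P Z g" and img: "\<And>p. p \<in> carrier P \<Longrightarrow> g p \<in> a ` carrier X"
  obtains h where "lin R P X h" "\<And>p. p \<in> carrier P \<Longrightarrow> a (h p) = g p"
proof -
  let ?I = "Z\<lparr>carrier := a ` carrier X\<rparr>"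
  have mZ: "left_module R Z" using Z by simp
  note I = submod_image[OF a]
  have "a ` carrier X \<in> U"
    by (rule universe_subset[OF U, of "carrier Z"]) (use Z linD(1)[OF a] in auto)
  then have IO: "?I \<in> Obj (Modules R U)" using submod_left_module[OF mZ I] by simp
  have aI: "lin R X ?I a" by (rule lin_restrict_cod[OF a I]) blast
  have gI: "lin R P ?I g" by (rule lin_restrict_cod[OF g I img])
  have "a ` carrier X = carrier ?I" by simp
  then have "\<exists>h. lin R P X h \<and> (\<forall>p\<in>carrier P. a (h p) = g p)"
    using P X IO aI gI unfolding projective_Modules_iff by blast
  then show ?thesis using that by blast
qed

text \<open>The lift exists because \<open>Ext^1(V, ker a) = 0\<close>. Over a projective
  \<open>Q\<close> mapping onto \<open>V\<close> there is a lift \<open>s\<close>; on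
  \<open>ker q\<close> it lands in \<open>ker a\<close>, that restriction extends to
  \<open>g\<close> on \<open>Q\<close>, and \<open>s - g\<close> descends to
  \<open>V\<close>.\<close>

lemma lift_through_orthogonal_kernel:
  assumes R: "ring R" and U: "module_universe R U"
    and V: "V \<in> L" "V \<in> Obj (Modules R U)" and X: "X \<in> Obj (Modules R U)" and ZO: "Z \<in> Obj (Modules R U)"
    and a: "lin R X Z a" and orth: "ext_orthogonal R U L (mod_ker X Z a)"
    and \<psi>: "lin R V Z \<psi>" and img: "\<And>v. v \<in> carrier V \<Longrightarrow> \<psi> v \<in> a ` carrier X"
  obtains \<phi> where "lin R V X \<phi>" "\<And>v. v \<in> carrier V \<Longrightarrow> a (\<phi> v) = \<psi> v"
proof -
  have mX: "left_module R X" and Z: "left_module R Z" using X ZO by simp_all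
  obtain Q q where Q: "projective (Modules R U) Q" "lin R Q V q" "q ` carrier Q = carrier V"
    using enough_projective_modules[OF R U V(2)] .
  have QO: "Q \<in> Obj (Modules R U)" using Q(1) by (simp add: projective_def)
  obtain s where s: "lin R Q X s" "\<And>x. x \<in> carrier Q \<Longrightarrow> a (s x) = \<psi> (q x)"
    by (rule projective_lift_image[OF U Q(1) X ZO a lin_comp[OF Q(2) \<psi>] img[OF linD(1)[OF Q(2)]]]) blast+
  have "lin R (mod_ker Q V q) (mod_ker X Z a) s"
    by (rule lin_ker_cod[OF lin_ker_dom[OF s(1) Q(2)] a]) (simp add: s(2) linD(4)[OF \<psi>])
  then obtain g where g: "lin R Q (mod_ker X Z a) g" "\<And>x. x \<in> carrier Q \<Longrightarrow> q x = \<zero>\<^bsub>V\<^esub> \<Longrightarrow> g x = s x"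
    by (rule ext_orthogonalD[OF orth V(1) QO Q(2,3)]) blast
  note gX = left_module_group[OF mX]
  have gk: "g x \<in> carrier X" "a (g x) = \<zero>\<^bsub>Z\<^esub>" if "x \<in> carrier Q" for x using linD(1)[OF g(1) that] by simp_all
  have d: "lin R Q X (\<lambda>x. s x \<ominus>\<^bsub>X\<^esub> g x)" by (rule lin_diff[OF s(1) lin_ker_codD[OF g(1) a]])
  obtain \<phi> where \<phi>: "lin R V X \<phi>" "\<And>x. x \<in> carrier Q \<Longrightarrow> \<phi> (q x) = s x \<ominus>\<^bsub>X\<^esub> g x"
    by (rule lin_factor[OF Q(2,3) d]) (use g(2) linD(1)[OF s(1)] gX in \<open>simp add: ag\<close>, blast)
  have "a (\<phi> v) = \<psi> v" if v: "v \<in> carrier V" for v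
  proof -
    have "v \<in> q ` carrier Q" using v Q(3) by simp
    then obtain x where x: "x \<in> carrier Q" "v = q x" by blast
    have "\<psi> v \<in> carrier Z" by (rule linD(1)[OF \<psi> v])
    then show ?thesis
      using \<phi>(2)[OF x(1)] x linD(6)[OF a linD(1)[OF s(1) x(1)] gk(1)[OF x(1)]] s(2)[OF x(1)] gk(2)[OF x(1)]
        left_module_group[OF Z] by (simp add: a_minus_def neg_zero ag_zero)
  qed
  then show ?thesis using that \<phi>(1) by blast
qed

text \<open>\<open>Epi\<close> contains extensional maps only; restricting \<open>p\<close> to the
  carrier changes neither image nor kernel.\<close>

lemma projectively_resolving_kernel:
  assumes res: "projectively_resolving R U L" and L: "L \<subseteq> Obj (Modules R U)"
    and BC: "B \<in> L" "C \<in> L" and p: "lin R B C p" "p ` carrier B = carrier C"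
  shows "mod_ker B C p \<in> L"
proof -
  have m: "left_module R B" "left_module R C" using BC L by auto
  have "restrict p (carrier B) \<in> Epi (Modules R U) B C"
    using restrict_mod_hom[OF p(1)] p(2) by (simp add: Epi_Modules_iff[OF m] mod_hom_iff[OF m])
  then have "mod_ker B C (restrict p (carrier B)) \<in> L"
    using res BC unfolding projectively_resolving_def by blast
  moreover have "mod_ker B C (restrict p (carrier B)) = mod_ker B C p"
    unfolding mod_ker_eq by (rule arg_cong[of _ _ "\<lambda>S. B\<lparr>carrier := S\<rparr>"]) auto
  ultimately show ?thesis by simp
qed

text \<open>A horseshoe lemma for a pair of precovers \<open>a\<close> and \<open>b\<close>: \<open>B\<close> is the pushout of
  \<open>X \<leftarrow> ker p \<rightarrow> P\<close> for a projective \<open>P\<close> mapping onto \<open>Y\<close> by \<open>p\<close>.\<close>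

lemma extension_of_precovers:
  fixes E E' X Y :: "('r, 'm) module"
  assumes R: "ring R" and U: "module_universe R U" and L: "L \<subseteq> Obj (Modules R U)"
    and res: "projectively_resolving R U L"
    and E: "E \<in> Obj (Modules R U)" and E': "E' \<in> Obj (Modules R U)" and \<delta>: "lin R E E' \<delta>"
    and X: "X \<in> L" and a: "lin R X E a" and aker: "a ` carrier X = {x \<in> carrier E. \<delta> x = \<zero>\<^bsub>E'\<^esub>}"
    and orth: "ext_orthogonal R U L (mod_ker X E a)"
    and Y: "Y \<in> L" and b: "lin R Y E' b" and bim: "b ` carrier Y = \<delta> ` carrier E"
  obtains B \<iota> \<beta> \<alpha> where "B \<in> Obj (Modules R U)" "lin R X B \<iota>" "inj_on \<iota> (carrier X)" "lin R B Y \<beta>"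
    "\<beta> ` carrier B = carrier Y" "\<iota> ` carrier X = {x \<in> carrier B. \<beta> x = \<zero>\<^bsub>Y\<^esub>}" "lin R B E \<alpha>"
    "\<And>x. x \<in> carrier X \<Longrightarrow> \<alpha> (\<iota> x) = a x" "\<And>x. x \<in> carrier B \<Longrightarrow> \<delta> (\<alpha> x) = b (\<beta> x)"
proof -
  have XO: "X \<in> Obj (Modules R U)" and YO: "Y \<in> Obj (Modules R U)" using X Y L by blast+
  have mX: "left_module R X" and mY: "left_module R Y" and mE: "left_module R E" and mE': "left_module R E'"
    using XO YO E E' by simp_all
  obtain P p where P: "projective (Modules R U) P" "lin R P Y p" "p ` carrier P = carrier Y"
    using enough_projective_modules[OF R U YO] .
  have PL: "P \<in> L" using P(1) res by (simp add: projectively_resolving_def)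
  have PO: "P \<in> Obj (Modules R U)" using PL L by blast
  have mP: "left_module R P" using PO by simp
  note g = left_module_group[OF mX] left_module_group[OF mY] left_module_group[OF mE] left_module_group[OF mE']
    left_module_group[OF mP]
  \<comment> \<open>The composite \<open>b \<circ> p\<close> lifts along \<open>\<delta>\<close>
    because \<open>b\<close> and \<open>\<delta>\<close> have the same image.\<close>
  obtain \<psi> where \<psi>: "lin R P E \<psi>" "\<And>x. x \<in> carrier P \<Longrightarrow> \<delta> (\<psi> x) = b (p x)"
  proof (rule projective_lift_image[OF U P(1) E E' \<delta> lin_comp[OF P(2) b]])
    show "b (p x) \<in> \<delta> ` carrier E" if "x \<in> carrier P" for x using bim linD(1)[OF P(2) that] by blast
  qed blast
  let ?V = "mod_ker P Y p"
  \<comment> \<open>\<open>P\<close> and \<open>Y\<close> lie in \<open>L\<close>, hence so does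
    \<open>ker p\<close>, and \<open>Ext^1(ker p, ker a) = 0\<close>. By dimension shifting this
    group is \<open>Ext^2(Y, ker a)\<close>, the obstruction to combining the two precovers.\<close>
  have V: "?V \<in> L" by (rule projectively_resolving_kernel[OF res L PL Y P(2,3)])
  have \<psi>V: "\<psi> v \<in> a ` carrier X" if "v \<in> carrier ?V" for v
    using that aker \<psi>(2)[of v] linD(1)[OF \<psi>(1), of v] linD(4)[OF b] by simp
  \<comment> \<open>On \<open>ker p\<close> the map \<open>\<psi>\<close> goes into
    \<open>ker \<delta>\<close>, which is the image of \<open>a\<close>; its lift to
    \<open>X\<close> is the map along which the pushout is formed.\<close>
  obtain \<phi> where \<phi>: "lin R ?V X \<phi>" "\<And>v. v \<in> carrier ?V \<Longrightarrow> a (\<phi> v) = \<psi> v"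
    using lift_through_orthogonal_kernel[OF R U V _ XO E a orth lin_ker_dom[OF \<psi>(1) P(2)] \<psi>V] V L by blast
  note FV = linD[OF \<phi>(1), simplified]
  let ?M = "prod_module X P"
  note M = left_module_prod[OF mX mP]
  let ?j = "\<lambda>v. (\<ominus>\<^bsub>X\<^esub> \<phi> v, v)"
  \<comment> \<open>Dividing by these pairs identifies \<open>\<phi> v\<close> in \<open>X\<close>
    with \<open>v\<close> in \<open>P\<close>.\<close>
  let ?S = "?j ` carrier ?V"
  have mV: "left_module R ?V" by (rule left_module_ker[OF P(2)])
  have "lin R ?V X (\<lambda>v. \<zero>\<^bsub>X\<^esub> \<ominus>\<^bsub>X\<^esub> \<phi> v)" by (rule lin_diff[OF lin_const_zero[OF mV mX] \<phi>(1)])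
  then have "lin R ?V X (\<lambda>v. \<ominus>\<^bsub>X\<^esub> \<phi> v)" by (rule lin_cong) (use FV(1) g in \<open>simp add: ag\<close>)
  from submod_image[OF lin_pair[OF this lin_ker_incl[OF P(2)]]] have S: "submod R ?M ?S" .
  obtain Q r where Q: "carrier Q \<subseteq> carrier X \<times> carrier P" and c: "lin R ?M Q r" and c_on: "r ` carrier ?M = carrier Q"
    and r0: "\<And>m. m \<in> carrier ?M \<Longrightarrow> r m = \<zero>\<^bsub>Q\<^esub> \<longleftrightarrow> m \<in> ?S"
    using that[OF carrier_quot[OF M S, unfolded prod_module_simps] lin_coset_rep[OF M S]
        coset_rep_onto[OF M S] coset_rep_zero_iff[OF M S]] .
  have S_iff: "(x, v) \<in> ?S \<longleftrightarrow> v \<in> carrier P \<and> p v = \<zero>\<^bsub>Y\<^esub> \<and> x = \<ominus>\<^bsub>X\<^esub> \<phi> v" for x v by auto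
  have c0: "r (x, v) = \<zero>\<^bsub>Q\<^esub> \<longleftrightarrow> p v = \<zero>\<^bsub>Y\<^esub> \<and> x = \<ominus>\<^bsub>X\<^esub> \<phi> v" if "x \<in> carrier X" "v \<in> carrier P" for x v
    using r0[of "(x, v)"] that S_iff by simp
  have small: "small U (carrier Q)"
    by (rule small_subset[OF small_times[OF U small_mem small_mem] Q]) (use XO PO in simp_all)
  obtain B \<theta> \<eta> where B: "B \<in> Obj (Modules R U)" "lin R Q B \<theta>" "lin R B Q \<eta>"
    "\<And>x. x \<in> carrier Q \<Longrightarrow> \<eta> (\<theta> x) = x" "\<And>y. y \<in> carrier B \<Longrightarrow> \<theta> (\<eta> y) = y"
    by (rule module_transport[OF U lin_cod[OF c] small]) blast
  \<comment> \<open>The class of \<open>(x, v)\<close> in the pushout; maps out of \<open>B\<close>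
    are prescribed on such classes.\<close>
  define \<gamma> where "\<gamma> x v = \<theta> (r (x, v))" for x v
  have \<gamma>: "lin R ?M B (\<lambda>m. \<gamma> (fst m) (snd m))" using lin_comp[OF c B(2)] by (simp add: \<gamma>_def)
  have \<gamma>_mem: "\<gamma> x v \<in> carrier B" if "x \<in> carrier X" "v \<in> carrier P" for x v
    using linD(1)[OF \<gamma>, of "(x, v)"] that by simp
  have \<gamma>_on: "\<exists>x\<in>carrier X. \<exists>v\<in>carrier P. y = \<gamma> x v" if y: "y \<in> carrier B" for y
  proof -
    have "\<eta> y \<in> r ` carrier ?M" using linD(1)[OF B(3) y] c_on by simp
    then obtain x v where xv: "x \<in> carrier X" "v \<in> carrier P" "\<eta> y = r (x, v)" by auto
    have "\<gamma> x v = \<theta> (\<eta> y)" by (simp only: \<gamma>_def xv(3))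
    then have "y = \<gamma> x v" using B(5)[OF y] by simp
    then show ?thesis using xv(1,2) by blast
  qed
  have \<gamma>0: "\<gamma> x v = \<zero>\<^bsub>B\<^esub> \<longleftrightarrow> p v = \<zero>\<^bsub>Y\<^esub> \<and> x = \<ominus>\<^bsub>X\<^esub> \<phi> v" if xv: "x \<in> carrier X" "v \<in> carrier P" for x v
  proof -
    have "\<eta> (\<gamma> x v) = r (x, v)" unfolding \<gamma>_def using linD(1)[OF c, of "(x, v)"] xv B(4) by simp
    then have "\<gamma> x v = \<zero>\<^bsub>B\<^esub> \<longleftrightarrow> r (x, v) = \<zero>\<^bsub>Q\<^esub>"
      using linD(4)[OF B(3)] linD(4)[OF B(2)] unfolding \<gamma>_def by auto
    then show ?thesis using c0[OF xv] by simp
  qed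
  have \<gamma>M: "(\<lambda>m. \<gamma> (fst m) (snd m)) ` carrier ?M = carrier B" using \<gamma>_mem \<gamma>_on by force
  obtain \<beta> where \<beta>: "lin R B Y \<beta>" "\<And>m. m \<in> carrier ?M \<Longrightarrow> \<beta> (\<gamma> (fst m) (snd m)) = p (snd m)"
    by (rule lin_factor[OF \<gamma> \<gamma>M lin_comp[OF lin_snd[OF mX mP] P(2)]]) (use \<gamma>0 in auto)
  have \<beta>\<gamma>: "\<beta> (\<gamma> x v) = p v" if "x \<in> carrier X" "v \<in> carrier P" for x v using \<beta>(2)[of "(x, v)"] that by simp
  \<comment> \<open>\<open>a x + \<psi> v\<close> vanishes on the pairs in \<open>?S\<close>, since
    \<open>a \<circ> \<phi> = \<psi>\<close> on \<open>ker p\<close>.\<close>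
  have al: "lin R ?M E (\<lambda>m. a (fst m) \<oplus>\<^bsub>E\<^esub> \<psi> (snd m))"
    by (rule lin_plus[OF lin_comp[OF lin_fst[OF mX mP] a] lin_comp[OF lin_snd[OF mX mP] \<psi>(1)]])
  obtain \<alpha> where \<alpha>: "lin R B E \<alpha>" "\<And>m. m \<in> carrier ?M \<Longrightarrow> \<alpha> (\<gamma> (fst m) (snd m)) = a (fst m) \<oplus>\<^bsub>E\<^esub> \<psi> (snd m)"
  proof (rule lin_factor[OF \<gamma> \<gamma>M al])
    fix m assume m: "m \<in> carrier ?M" "\<gamma> (fst m) (snd m) = \<zero>\<^bsub>B\<^esub>"
    then have v: "snd m \<in> carrier P" "p (snd m) = \<zero>\<^bsub>Y\<^esub>" "fst m = \<ominus>\<^bsub>X\<^esub> \<phi> (snd m)" using \<gamma>0 by auto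
    then show "a (fst m) \<oplus>\<^bsub>E\<^esub> \<psi> (snd m) = \<zero>\<^bsub>E\<^esub>"
      using \<phi>(2)[of "snd m"] FV(1)[of "snd m"] linD(5)[OF a] linD(1)[OF \<psi>(1) v(1)] g by (simp add: ag)
  qed blast
  have \<alpha>\<gamma>: "\<alpha> (\<gamma> x v) = a x \<oplus>\<^bsub>E\<^esub> \<psi> v" if "x \<in> carrier X" "v \<in> carrier P" for x v using \<alpha>(2)[of "(x, v)"] that by simp
  let ?\<iota> = "\<lambda>x. \<gamma> x \<zero>\<^bsub>P\<^esub>"
  have zP: "\<zero>\<^bsub>P\<^esub> \<in> carrier P" using g by (simp add: ag_closed)
  have \<iota>: "lin R X B ?\<iota>"
    using lin_comp[OF lin_pair[OF lin_id[OF mX] lin_const_zero[OF mX mP]] \<gamma>] by simp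
  have "inj_on ?\<iota> (carrier X)" unfolding lin_inj_iff[OF \<iota>]
    using \<gamma>0[OF _ zP] FV(4) g by (simp add: neg_zero)
  moreover have "\<beta> ` carrier B = carrier Y"
  proof
    show "carrier Y \<subseteq> \<beta> ` carrier B"
    proof
      fix y assume "y \<in> carrier Y"
      then have "y \<in> p ` carrier P" using P(3) by simp
      then obtain v where v: "v \<in> carrier P" "y = p v" by blast
      have zX: "\<zero>\<^bsub>X\<^esub> \<in> carrier X" using g by (simp add: ag_closed)
      show "y \<in> \<beta> ` carrier B" using \<beta>\<gamma>[OF zX v(1)] \<gamma>_mem[OF zX v(1)] v(2) by force
    qed
  qed (use linD(1)[OF \<beta>(1)] in blast)
  moreover have "?\<iota> ` carrier X = {x \<in> carrier B. \<beta> x = \<zero>\<^bsub>Y\<^esub>}"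
  proof
    show "?\<iota> ` carrier X \<subseteq> {x \<in> carrier B. \<beta> x = \<zero>\<^bsub>Y\<^esub>}"
      using linD(1)[OF \<iota>] \<beta>\<gamma>[OF _ zP] linD(4)[OF P(2)] by auto
    show "{x \<in> carrier B. \<beta> x = \<zero>\<^bsub>Y\<^esub>} \<subseteq> ?\<iota> ` carrier X"
    proof
      fix y assume "y \<in> {x \<in> carrier B. \<beta> x = \<zero>\<^bsub>Y\<^esub>}"
      then have y: "y \<in> carrier B" "\<beta> y = \<zero>\<^bsub>Y\<^esub>" by simp_all
      obtain x v where xv: "x \<in> carrier X" "v \<in> carrier P" "y = \<gamma> x v" using \<gamma>_on[OF y(1)] by blast
      have pv: "p v = \<zero>\<^bsub>Y\<^esub>" using y(2) \<beta>\<gamma>[OF xv(1,2)] xv(3) by simp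
      have f: "\<phi> v \<in> carrier X" using FV(1) xv(2) pv by simp
      have n: "\<ominus>\<^bsub>X\<^esub> \<phi> v \<in> carrier X" using f g by (simp add: ag_closed)
      have s: "x \<oplus>\<^bsub>X\<^esub> \<phi> v \<in> carrier X" using f xv(1) g by (simp add: ag_closed)
      \<comment> \<open>When \<open>p v = 0\<close>, the pairs \<open>(x, v)\<close> and
        \<open>(x + \<phi> v, 0)\<close> differ by an element of \<open>?S\<close>.\<close>
      have "\<gamma> (x \<oplus>\<^bsub>X\<^esub> \<phi> v) \<zero>\<^bsub>P\<^esub> \<oplus>\<^bsub>B\<^esub> \<gamma> (\<ominus>\<^bsub>X\<^esub> \<phi> v) v = \<gamma> (x \<oplus>\<^bsub>X\<^esub> \<phi> v \<oplus>\<^bsub>X\<^esub> \<ominus>\<^bsub>X\<^esub> \<phi> v) (\<zero>\<^bsub>P\<^esub> \<oplus>\<^bsub>P\<^esub> v)"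
        using linD(2)[OF \<gamma>, of "(x \<oplus>\<^bsub>X\<^esub> \<phi> v, \<zero>\<^bsub>P\<^esub>)" "(\<ominus>\<^bsub>X\<^esub> \<phi> v, v)"] s n zP xv(2) by simp
      also have "\<dots> = y" using xv f g by (simp add: ag)
      also have "\<gamma> (\<ominus>\<^bsub>X\<^esub> \<phi> v) v = \<zero>\<^bsub>B\<^esub>" using \<gamma>0[OF n xv(2)] pv by simp
      finally have "y = \<gamma> (x \<oplus>\<^bsub>X\<^esub> \<phi> v) \<zero>\<^bsub>P\<^esub>"
        using \<gamma>_mem[OF s zP] lin_cod_group[OF \<gamma>] by (simp add: ag_zero)
      then show "y \<in> ?\<iota> ` carrier X" using s by blast
    qed
  qed
  moreover have "\<alpha> (?\<iota> x) = a x" if "x \<in> carrier X" for x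
    using \<alpha>\<gamma>[OF that zP] linD(4)[OF \<psi>(1)] linD(1)[OF a that] g by (simp add: ag_zero)
  moreover have "\<delta> (\<alpha> y) = b (\<beta> y)" if y: "y \<in> carrier B" for y
  proof -
    obtain x v where xv: "x \<in> carrier X" "v \<in> carrier P" "y = \<gamma> x v" using \<gamma>_on[OF y] by blast
    have "a x \<in> {x \<in> carrier E. \<delta> x = \<zero>\<^bsub>E'\<^esub>}" using aker xv(1) by blast
    then have "\<delta> (\<alpha> y) = b (p v)"
      using \<alpha>\<gamma>[OF xv(1,2)] xv(3) linD(2)[OF \<delta> _ linD(1)[OF \<psi>(1) xv(2)]] \<psi>(2)[OF xv(2)]
        linD(1)[OF b linD(1)[OF P(2) xv(2)]] g by (simp add: ag_zero)
    then show ?thesis using \<beta>\<gamma>[OF xv(1,2)] xv(3) by simp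
  qed
  ultimately show ?thesis using that[OF B(1) \<iota> _ \<beta>(1) _ _ \<alpha>(1)] by blast
qed

text \<open>The module in degree \<open>n\<close> depends only on the precovers fixed for the cycles
  in degrees \<open>n\<close> and \<open>n - 1\<close>. All degrees are thus built independently,
  with no recursion over the integers; neighbouring degrees share one precover, through which the
  differential passes.\<close>

lemma tilde_precover_of_exact:
  fixes E :: "('r, 'm) cplx"
  assumes R: "ring R" and U: "module_universe R U" and cls: "module_class R U L"
    and res: "projectively_resolving R U L" and pre: "special_precovering (Modules R U) L"
    and E: "is_complex R U E" and ex: "exact_complex E"
  obtains A \<alpha> where "A \<in> tilde R U L" "cmap R A E \<alpha>" "\<And>n. \<alpha> n ` car A n = car E n" "right_lifting R U L A E \<alpha>"
proof -
  have L: "L \<subseteq> Obj (Modules R U)" using cls by (simp add: module_class_def)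
  note lE = is_complex_large[OF E]
  have "\<exists>X a. X \<in> L \<and> lin R X (cycles E n) a \<and> a ` carrier X = carrier (cycles E n) \<and>
    ext_orthogonal R U L (mod_ker X (cycles E n) a)" for n
    by (rule special_precover_module[OF R U L pre, of "cycles E n"])
      (use Modules_ker[OF U is_complex_component[OF E] diff_lin[OF lE]] in \<open>simp add: cycles_def\<close>, blast)
  then obtain X a where X: "\<And>n. X n \<in> L" and aZ: "\<And>n. lin R (X n) (cycles E n) (a n)"
    and aon: "\<And>n. a n ` carrier (X n) = carrier (cycles E n)"
    and orth0: "\<And>n. ext_orthogonal R U L (mod_ker (X n) (cycles E n) (a n))" by metis
  have a: "lin R (X n) (component E n) (a n)" for n
    using lin_ker_codD[OF aZ[unfolded cycles_def] diff_lin[OF lE]] .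
  have orth: "ext_orthogonal R U L (mod_ker (X n) (component E n) (a n))" for n
    using orth0[of n] by (simp add: mod_ker_eq cycles_def)
  have aker: "a n ` carrier (X n) = {x \<in> car E n. diff E n x = \<zero>\<^bsub>component E (n - 1)\<^esub>}" for n
    using aon by (simp add: cycles_def)
  \<comment> \<open>Exactness identifies the cycles in degree \<open>n - 1\<close> with the image of
    the differential, as the horseshoe requires.\<close>
  have aim: "a (n - 1) ` carrier (X (n - 1)) = diff E n ` car E n" for n
    using ex[unfolded exact_complex_def, rule_format, of "n - 1"] aon by simp
  define good where "good n B \<iota> \<beta> \<alpha> \<longleftrightarrow> B \<in> Obj (Modules R U) \<and> lin R (X n) B \<iota> \<and> inj_on \<iota> (carrier (X n)) \<and>
    lin R B (X (n - 1)) \<beta> \<and> \<beta> ` carrier B = carrier (X (n - 1)) \<and>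
    \<iota> ` carrier (X n) = {x \<in> carrier B. \<beta> x = \<zero>\<^bsub>X (n - 1)\<^esub>} \<and> lin R B (component E n) \<alpha> \<and>
    (\<forall>x\<in>carrier (X n). \<alpha> (\<iota> x) = a n x) \<and> (\<forall>x\<in>carrier B. diff E n (\<alpha> x) = a (n - 1) (\<beta> x))" for n B \<iota> \<beta> \<alpha>
  have "\<exists>B \<iota> \<beta> \<alpha>. good n B \<iota> \<beta> \<alpha>" for n
    unfolding good_def
    by (rule extension_of_precovers[OF R U L res is_complex_component[OF E] is_complex_component[OF E] diff_lin[OF lE]
          X a aker orth X a aim])
      (intro exI conjI; assumption?; blast)
  then obtain B \<iota> \<beta> \<alpha> where good: "\<And>n. good n (B n) (\<iota> n) (\<beta> n) (\<alpha> n)" by metis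
  have B: "\<And>n. B n \<in> Obj (Modules R U)" and \<iota>: "\<And>n. lin R (X n) (B n) (\<iota> n)"
    and inj: "\<And>n. inj_on (\<iota> n) (carrier (X n))" and \<beta>: "\<And>n. lin R (B n) (X (n - 1)) (\<beta> n)"
    and \<beta>on: "\<And>n. \<beta> n ` carrier (B n) = carrier (X (n - 1))"
    and \<iota>ker: "\<And>n. \<iota> n ` carrier (X n) = {x \<in> carrier (B n). \<beta> n x = \<zero>\<^bsub>X (n - 1)\<^esub>}"
    and \<alpha>: "\<And>n. lin R (B n) (component E n) (\<alpha> n)"
    and \<alpha>\<iota>: "\<And>n x. x \<in> carrier (X n) \<Longrightarrow> \<alpha> n (\<iota> n x) = a n x"
    and \<delta>\<alpha>: "\<And>n x. x \<in> carrier (B n) \<Longrightarrow> diff E n (\<alpha> n x) = a (n - 1) (\<beta> n x)"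
    using good unfolding good_def by simp_all
  \<comment> \<open>The differential is the epimorphism \<open>\<beta>\<close> onto
    \<open>X (n - 1)\<close> followed by the monomorphism \<open>\<iota>\<close>, so its kernel is a
    copy of \<open>X n\<close> and its image a copy of \<open>X (n - 1)\<close>.\<close>
  define A where "A = \<lparr>component = B, diff = (\<lambda>n. \<lambda>x\<in>carrier (B n). \<iota> (n - 1) (\<beta> n x))\<rparr>"
  have A: "component A n = B n" "x \<in> carrier (B n) \<Longrightarrow> diff A n x = \<iota> (n - 1) (\<beta> n x)" for n x
    by (simp_all add: A_def)
  have inj0: "\<iota> n x = \<zero>\<^bsub>B n\<^esub> \<longleftrightarrow> x = \<zero>\<^bsub>X n\<^esub>" if "x \<in> carrier (X n)" for n x
    using inj[of n] linD(4)[OF \<iota>] that unfolding lin_inj_iff[OF \<iota>] by metis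
  have \<beta>\<iota>: "\<iota> n x \<in> carrier (B n)" "\<beta> n (\<iota> n x) = \<zero>\<^bsub>X (n - 1)\<^esub>" if "x \<in> carrier (X n)" for n x
    using \<iota>ker[of n] that by blast+
  have lin_d: "lin R (B n) (B (n - 1)) (diff A n)" for n
    by (rule lin_cong[OF lin_comp[OF \<beta> \<iota>]]) (simp add: A)
  have dd: "diff A (n - 1) (diff A n x) = \<zero>\<^bsub>B (n - 2)\<^esub>" if "x \<in> carrier (B n)" for n x
    using that \<beta>\<iota>[OF linD(1)[OF \<beta> that]] linD(4)[OF \<iota>] by (simp add: A)
  have Ac: "is_complex R U A"
    using B lin_d dd by (auto simp: is_complex_iff large_complex_def A) (simp add: A_def)
  note lA = is_complex_large[OF Ac]
  have cyc: "diff A n x = \<zero>\<^bsub>component A (n - 1)\<^esub> \<longleftrightarrow> \<beta> n x = \<zero>\<^bsub>X (n - 1)\<^esub>" if "x \<in> carrier (B n)" for n x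
    unfolding A(1) A(2)[OF that] by (rule inj0[OF linD(1)[OF \<beta> that]])
  have exA: "exact_complex A"
  proof (rule exact_complexI[OF lA])
    fix n x assume x: "x \<in> car A n" "diff A n x = \<zero>\<^bsub>component A (n - 1)\<^esub>"
    then have "x \<in> \<iota> n ` carrier (X n)" using cyc \<iota>ker by (simp add: A)
    then obtain l where l: "l \<in> carrier (X n)" "x = \<iota> n l" by blast
    then have "l \<in> \<beta> (n + 1) ` carrier (B (n + 1))" using \<beta>on[of "n + 1"] by simp
    then obtain y where y: "y \<in> carrier (B (n + 1))" "l = \<beta> (n + 1) y" by blast
    then show "\<exists>y\<in>car A (n + 1). diff A (n + 1) y = x"
      using l(2) by (intro bexI[of _ y]) (simp_all add: A)
  qed
  have carrier_cyc: "carrier (cycles A n) = \<iota> n ` carrier (X n)" for n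
    unfolding cycles_def \<iota>ker mod_ker_simps using cyc[of _ n] unfolding A(1) by auto
  have \<iota>Z: "lin R (X n) (cycles A n) (\<iota> n)" for n
    unfolding cycles_def
    by (rule lin_ker_cod[OF _ diff_lin[OF lA]]) (use \<iota> \<beta>\<iota> in \<open>simp_all add: A linD(4)[OF \<iota>]\<close>)
  have "cycles A n \<in> L" for n
  proof -
    have "restrict (\<iota> n) (carrier (X n)) \<in> mod_hom R (X n) (cycles A n)" by (rule restrict_mod_hom[OF \<iota>Z])
    moreover have "bij_betw (restrict (\<iota> n) (carrier (X n))) (carrier (X n)) (carrier (cycles A n))"
      using inj carrier_cyc by (simp add: bij_betw_def inj_on_restrict_eq)
    moreover have "cycles A n \<in> Obj (Modules R U)"
      unfolding cycles_def by (rule Modules_ker[OF U is_complex_component[OF Ac] diff_lin[OF lA]])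
    ultimately show ?thesis using cls X[of n] unfolding module_class_def by blast
  qed
  then have At: "A \<in> tilde R U L" using Ac exA by (simp add: tilde_def)
  have c\<alpha>: "cmap R A E \<alpha>"
    by (rule cmapI) (use \<alpha> \<alpha>\<iota> linD(1)[OF \<beta>] \<delta>\<alpha> in \<open>simp_all add: A\<close>)
  have gE: "abelian_group (component E n)" for n by (rule lin_cod_group[OF \<alpha>])
  have on: "\<alpha> n ` car A n = car E n" for n
  proof
    show "car E n \<subseteq> \<alpha> n ` car A n"
    proof
      fix e assume e: "e \<in> car E n"
      then have "diff E n e \<in> a (n - 1) ` carrier (X (n - 1))" using aim by simp
      then obtain y where y: "y \<in> carrier (X (n - 1))" "diff E n e = a (n - 1) y" by blast
      then have "y \<in> \<beta> n ` carrier (B n)" using \<beta>on by simp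
      then obtain x where x: "x \<in> carrier (B n)" "y = \<beta> n x" by blast
      note \<alpha>x = linD(1)[OF \<alpha> x(1)]
      \<comment> \<open>\<open>e\<close> and \<open>\<alpha> n x\<close> have the same differential,
        so they differ by a cycle, and \<open>a n\<close> reaches every cycle.\<close>
      have "e \<ominus>\<^bsub>component E n\<^esub> \<alpha> n x \<in> a n ` carrier (X n)" unfolding aker
        using e \<alpha>x linD(6)[OF diff_lin[OF lE] e \<alpha>x] \<delta>\<alpha>[OF x(1)] y(2) x(2) gE linD(1)[OF a y(1)]
        by (simp add: ag)
      then obtain l where l: "l \<in> carrier (X n)" "e \<ominus>\<^bsub>component E n\<^esub> \<alpha> n x = a n l" by blast
      have "\<alpha> n (x \<oplus>\<^bsub>B n\<^esub> \<iota> n l) = \<alpha> n x \<oplus>\<^bsub>component E n\<^esub> (e \<ominus>\<^bsub>component E n\<^esub> \<alpha> n x)"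
        using linD(2)[OF \<alpha> x(1) \<beta>\<iota>(1)[OF l(1)]] \<alpha>\<iota>[OF l(1)] l(2) by simp
      also have "\<dots> = e" using e \<alpha>x gE[of n] by (simp add: ag)
      finally have "e = \<alpha> n (x \<oplus>\<^bsub>B n\<^esub> \<iota> n l)" ..
      moreover have "x \<oplus>\<^bsub>B n\<^esub> \<iota> n l \<in> car A n"
        using x(1) \<beta>\<iota>(1)[OF l(1)] lin_dom_group[OF \<alpha>[of n]] by (simp add: A ag_closed)
      ultimately show "e \<in> \<alpha> n ` car A n" by blast
    qed
  qed (use cmap_closed[OF c\<alpha>] in blast)
  let ?K = "complex_ker A E \<alpha>"
  note K = is_complex_ker[OF U Ac lE c\<alpha>]
  have "right_lifting R U L A E \<alpha>"
  proof (rule right_lifting_if_kernel[OF Ac E c\<alpha> on], rule tilde_orthogonal_exact[OF U K])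
    show "exact_complex ?K"
    proof (rule exact_complexI[OF is_complex_large[OF K]])
      fix n z assume z: "z \<in> car ?K n" "diff ?K n z = \<zero>\<^bsub>component ?K (n - 1)\<^esub>"
      then have z': "z \<in> car A n" "\<alpha> n z = \<zero>\<^bsub>component E n\<^esub>" "diff A n z = \<zero>\<^bsub>component A (n - 1)\<^esub>" by simp_all
      obtain y where y: "y \<in> car A (n + 1)" "diff A (n + 1) y = z" using exact_complexD[OF exA z'(1,3)] .
      \<comment> \<open>The bounding element \<open>y\<close> may lie outside the kernel, but
        \<open>\<alpha> y\<close> is a cycle and therefore equals
        \<open>\<alpha> (\<iota> l)\<close>; subtracting the cycle \<open>\<iota> l\<close> moves
        \<open>y\<close> into the kernel without changing its differential.\<close>
      have "diff E (n + 1) (\<alpha> (n + 1) y) = \<zero>\<^bsub>component E (n + 1 - 1)\<^esub>"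
        using cmap_diff_Suc[OF c\<alpha> y(1)] y(2) z'(2) by simp
      then have "\<alpha> (n + 1) y \<in> a (n + 1) ` carrier (X (n + 1))"
        unfolding aker using cmap_closed[OF c\<alpha> y(1)] by simp
      then obtain l where l: "l \<in> carrier (X (n + 1))" "\<alpha> (n + 1) y = a (n + 1) l" by blast
      let ?i = "\<iota> (n + 1) l"
      have i: "?i \<in> car A (n + 1)" "diff A (n + 1) ?i = \<zero>\<^bsub>component A n\<^esub>"
        using \<beta>\<iota>[OF l(1)] cyc[of ?i "n + 1"] by (simp_all add: A)
      let ?y = "y \<ominus>\<^bsub>component A (n + 1)\<^esub> ?i"
      have gA: "abelian_group (component A m)" for m by (rule lin_dom_group[OF diff_lin[OF lA]])
      have "?y \<in> car A (n + 1)" using y(1) i(1) gA by (simp add: ag_closed)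
      moreover have "\<alpha> (n + 1) ?y = \<zero>\<^bsub>component E (n + 1)\<^esub>"
        using linD(6)[OF cmap_lin[OF c\<alpha>] y(1) i(1)] l(2) \<alpha>\<iota>[OF l(1)] linD(1)[OF a l(1)] gE by (simp add: ag)
      moreover have "diff A (n + 1) ?y = z"
        using linD(6)[OF diff_lin_Suc[OF lA] y(1) i(1)] i(2) y(2) z'(1) gA[of n] by (simp add: a_minus_def neg_zero ag_zero)
      ultimately show "\<exists>y\<in>car ?K (n + 1). diff ?K (n + 1) y = z" by (intro bexI[of _ ?y]) simp_all
    qed
    fix n
    have zk: "x \<in> carrier (cycles ?K n) \<longleftrightarrow> x \<in> carrier (B n) \<and> \<alpha> n x = \<zero>\<^bsub>component E n\<^esub> \<and> \<beta> n x = \<zero>\<^bsub>X (n - 1)\<^esub>" for x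
      using cyc[of x n] unfolding cycles_def mod_ker_simps complex_ker_simps A(1) by auto
    \<comment> \<open>The cycles of the kernel are a copy, under \<open>\<iota> n\<close>, of the
      kernel of the precover \<open>a n\<close>.\<close>
    show "ext_orthogonal R U L (cycles ?K n)"
    proof (rule ext_orthogonal_iso[OF orth[of n]])
      show "lin R (mod_ker (X n) (component E n) (a n)) (cycles ?K n) (\<iota> n)"
        unfolding cycles_def
      proof (rule lin_ker_cod[OF _ diff_lin[OF is_complex_large[OF K]]])
        have "lin R (mod_ker (X n) (component E n) (a n)) (component A n) (\<iota> n)"
          using lin_ker_dom[OF \<iota> a] by (simp add: A)
        then show "lin R (mod_ker (X n) (component E n) (a n)) (component ?K n) (\<iota> n)"
          unfolding complex_ker_simps by (rule lin_ker_cod[OF _ cmap_lin[OF c\<alpha>]]) (simp add: \<alpha>\<iota>)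
        fix x assume "x \<in> carrier (mod_ker (X n) (component E n) (a n))"
        then show "diff ?K n (\<iota> n x) = \<zero>\<^bsub>component ?K (n - 1)\<^esub>"
          using \<beta>\<iota>[of x n] \<alpha>\<iota>[of x n] cyc[of "\<iota> n x" n] by (simp add: A)
      qed
      show "bij_betw (\<iota> n) (carrier (mod_ker (X n) (component E n) (a n))) (carrier (cycles ?K n))"
        unfolding bij_betw_def
      proof
        show "inj_on (\<iota> n) (carrier (mod_ker (X n) (component E n) (a n)))"
          by (rule inj_on_subset[OF inj]) auto
        show "\<iota> n ` carrier (mod_ker (X n) (component E n) (a n)) = carrier (cycles ?K n)"
        proof
          show "\<iota> n ` carrier (mod_ker (X n) (component E n) (a n)) \<subseteq> carrier (cycles ?K n)"
            unfolding subset_iff zk using \<beta>\<iota> \<alpha>\<iota> by auto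
          show "carrier (cycles ?K n) \<subseteq> \<iota> n ` carrier (mod_ker (X n) (component E n) (a n))"
          proof
            fix x assume x: "x \<in> carrier (cycles ?K n)"
            then have "x \<in> \<iota> n ` carrier (X n)" unfolding zk \<iota>ker by simp
            then obtain l where "l \<in> carrier (X n)" "x = \<iota> n l" by blast
            then show "x \<in> \<iota> n ` carrier (mod_ker (X n) (component E n) (a n))"
              using x \<alpha>\<iota> unfolding zk by auto
          qed
        qed
      qed
    qed
  qed
  then show ?thesis using that[OF At c\<alpha> on] by blast
qed

section \<open>Special precovers of complexes\<close>

theorem theorem3p11:
  fixes R :: "'r ring" and U :: "'m set set"
    and L :: "('r, 'm) module set" and C :: "('r, 'm) cplx"
  assumes "ring R"
    and "module_universe R U"
    and "module_class R U L"
    and "projectively_resolving R U L"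
    and "special_precovering (Modules R U) L"
    and "C \<in> Obj (Complexes R U)"
  shows "\<exists>D f. special_precover (Complexes R U) (tilde R U L) C D f"
proof -
  note R = assms(1) and U = assms(2)
  have C: "is_complex R U C" using assms(6) by simp
  obtain E \<rho> where E: "is_complex R U E" "exact_complex E" "cmap R E C \<rho>" "\<And>n. \<rho> n ` car E n = car C n"
    "right_lifting R U L E C \<rho>"
    using exact_precover_exists[OF R U C] by metis
  obtain A \<alpha> where A: "A \<in> tilde R U L" "cmap R A E \<alpha>" "\<And>n. \<alpha> n ` car A n = car E n" "right_lifting R U L A E \<alpha>"
    using tilde_precover_of_exact[OF R U assms(3-5) E(1,2)] by metis
  have Ac: "is_complex R U A" by (rule tildeD(1)[OF A(1)])
  note lA = is_complex_large[OF Ac] and lC = is_complex_large[OF C]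
  let ?g = "\<lambda>n x. \<rho> n (\<alpha> n x)"
  have g: "cmap R A C ?g" by (rule cmap_comp[OF A(2) E(3)])
  \<comment> \<open>Morphisms of \<open>Complexes\<close> are extensional in each degree; the
    restriction leaves the kernel unchanged.\<close>
  let ?f = "\<lambda>n. restrict (?g n) (car A n)"
  have fm: "?f \<in> chain_map R A C" by (rule restrict_chain_map[OF g lA])
  have f: "cmap R A C ?f"
    using fm chain_map_iff[OF is_complex_module[OF Ac] is_complex_module[OF C]] by blast
  have "?f n ` car A n = car C n" for n
    using A(3)[of n] E(4)[of n] by (simp add: image_image[symmetric])
  then have epi: "?f \<in> Epi (Complexes R U) A C" using fm by (simp add: Complexes_def)
  have ker: "complex_ker A C ?f = complex_ker A C ?g"
  proof -
    have "{x \<in> car A n. ?f n x = \<zero>\<^bsub>component C n\<^esub>} = {x \<in> car A n. ?g n x = \<zero>\<^bsub>component C n\<^esub>}" for n by auto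
    then show ?thesis unfolding complex_ker_def mod_ker_eq a_kernel_def' by simp
  qed
  \<comment> \<open>This kernel is an extension of the kernels of the two factors; composing their
    lifting properties yields its orthogonality at once.\<close>
  have orth: "tilde_orthogonal R U L (complex_ker A C ?f)"
    unfolding ker by (rule kernel_if_right_lifting[OF right_lifting_comp[OF A(4) E(5) A(2)] Ac C g])
  have "trivial_group (Ext1 (Complexes R U) X (Ker (Complexes R U) A C ?f))" if X: "X \<in> tilde R U L" for X
  proof -
    have "trivial_group (Ext1 (Complexes R U) X (complex_ker A C ?f))"
    proof (rule Ext1_trivial_complex[OF R U tildeD(1)[OF X] is_complex_ker[OF U Ac lC f]])
      fix P e h
      assume h: "projective (Complexes R U) P" "cmap R P X e" "\<forall>n. e n ` car P n = car X n"
        "cmap R (complex_ker P X e) (complex_ker A C ?f) h"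
      obtain k where "cmap R P (complex_ker A C ?f) k"
        "\<And>n p. p \<in> car P n \<Longrightarrow> e n p = \<zero>\<^bsub>component X n\<^esub> \<Longrightarrow> k n p = h n p"
        by (rule tilde_orthogonalD[OF orth h(1) X h(2-4)]) (erule that, blast)
      then show "\<exists>k. cmap R P (complex_ker A C ?f) k \<and>
        (\<forall>n. \<forall>p\<in>car P n. e n p = \<zero>\<^bsub>component X n\<^esub> \<longrightarrow> k n p = h n p)"
        by (intro exI[of _ k]) simp
    qed
    then show ?thesis by (simp add: Complexes_def)
  qed
  then have "special_precover (Complexes R U) (tilde R U L) C A ?f"
    using A(1) epi by (simp add: special_precover_def)
  then show ?thesis by blast
qed

end
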